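(* Consider real matched pairs of Lie algebras $\mathfrak g=\mathfrak g_1\oplus\mathfrak g_2$ with $\mathfrak g_2=\mathbb RA$, described by the Lie bracket of $\mathfrak g_1$ and the linear maps $\beta:\mathfrak g_1\to\mathfrak g_1$, $\chi:\mathfrak g_1\to\mathbb R$ with $[X,A]=\beta(X)+\chi(X)A$ for $X\in\mathfrak g_1$. In dimension $1+1$, there exist, up to isomorphism, the following non-isomorphic matched pairs of Lie algebras, where $X$ is a generator of $\mathfrak g_1$: 1. $\chi=0$ and $\beta=0$. 2. $\chi=0$ and $\beta(X)=X$. 3. $\chi(X)=1$ and $\beta=0$. 4. $\chi(X)=1$ and $\beta(X)=X$. In dimension $2+1$, there exist, up to isomorphism, the following non-isomorphic matched pairs of Lie algebras, where $X,Y$ are generators of $\mathfrak g_1$: 1. $\chi=0$ and $\beta=0$: 1.1. $[X,Y]=0$. 1.2. $[X,Y]=Y$. 2. $\chi=0$ and $\beta\neq0$: 2.1. $[X,Y]=0$, $\beta(X)=X$, $\beta(Y)=rY$, $-1\leq r\leq1$. 2.2. $[X,Y]=0$, $\beta(X)=X+Y$, $\beta(Y)=Y$. 2.3. $[X,Y]=0$, $\beta(X)=Y$, $\beta(Y)=0$. 2.4. $[X,Y]=Y$, $\beta(X)=Y$, $\beta(Y)=0$. 2.5. $[X,Y]=Y$, $\beta(X)=0$, $\beta(Y)=Y$. 3. $\chi\neq0$ and $\beta=0$: $[X,Y]=aY$, $\chi(X)=1$, $\chi(Y)=0$, $a\in\mathbb R$. 4. $\chi\neq0$ and $\beta\neq0$: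 $\chi(X)=1$, $\chi(Y)=0$ and 4.1. $[X,Y]=dY$, $\beta(X)=X+bY$, $\beta(Y)=dY$, either $d=1$ and $b\in\mathbb R$, or $d\neq1$ and $b=0$. 4.2. $[X,Y]=dY$, $\beta(X)=Y$, $\beta(Y)=0$, $d\in\mathbb R$. 4.3. $[X,Y]=-Y$, $\beta(X)=aY$, $\beta(Y)=X$, $a=1,0,-1$. Every matched pair above can be exponentiated to a matched pair of Lie groups having at most $2$ connected components.
   Context: All Lie algebras and Lie groups are real. Matched pair of Lie algebras: Lie subalgebras $\mathfrak g_1,\mathfrak g_2$ of a Lie algebra $\mathfrak{g}$ with $\mathfrak{g}=\mathfrak{g}_1\oplus\mathfrak{g}_2$ as vector spaces; it is of dimension $n_1+n_2$ if $\dim\mathfrak g_i=n_i$. Two are isomorphic if there is an isomorphism of the ambient Lie algebras sending $\mathfrak g_i$ onto $\mathfrak g_i'$ ($i=1,2$). Matched pair of Lie groups: $G$ is a Lie group, $G_1,G_2$ are groups with a homomorphism $i:G_1\to G$ and an anti-homomorphism $j:G_2\to G$, both with closed image and homeomorphisms onto their images, $i(G_1)\cap j(G_2)=\{e\}$, and the complement of $i(G_1)j(G_2)$ in $G$ has measure zero. Its matched pair of Lie algebras consists of the Lie subalgebras of ${\rm Lie}(G)$ tangent to $i(G_1)$ and $j(G_2)$. A matched pair of Lie algebras is exponentiated to a matched pair of Lie groups if the matched pair of Lie algebras of the latter is isomorphic to the given one. "At most 2 connected components" means that each of $G,G_1,G_2$ has at most two connected components.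
   Formalization: In dimension 2+1 the list is complete except for pairs with χ=0, [X,Y]=0 and β without real eigenvector (e.g. β(X)=Y, β(Y)=-X), which it omits; entries 4.1 with d=1 and different b≠0 are not claimed non-isomorphic, since rescaling Y makes them isomorphic. *)

theory Defs
  imports "HOL-Analysis.Analysis" "HOL-Algebra.Group" "HOL-Library.Function_Algebras"
begin

section \<open>Matched pairs of Lie algebras\<close>

text \<open>The Lie algebra of a Lie group is realised below as a space of operators
  on smooth functions, so that functions into a real vector space have to form a real vector space.\<close>

instantiation "fun" :: (type, real_vector) real_vector
begin

definition scaleR_fun :: "real \<Rightarrow> ('a \<Rightarrow> 'b) \<Rightarrow> 'a \<Rightarrow> 'b"
  where "scaleR_fun c f = (\<lambda>x. c *\<^sub>R f x)"

instance
  by standard (auto simp: scaleR_fun_def plus_fun_def scaleR_add_right scaleR_add_left)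

end

definition lie_algebra :: "'a::real_vector set \<Rightarrow> ('a \<Rightarrow> 'a \<Rightarrow> 'a) \<Rightarrow> bool"
  where "lie_algebra L br \<longleftrightarrow>
    subspace L \<and>
    (\<forall>x\<in>L. \<forall>y\<in>L. br x y \<in> L) \<and>
    (\<forall>x\<in>L. \<forall>y\<in>L. \<forall>z\<in>L. br (x + y) z = br x z + br y z \<and> br x (y + z) = br x y + br x z) \<and>
    (\<forall>c. \<forall>x\<in>L. \<forall>y\<in>L. br (c *\<^sub>R x) y = c *\<^sub>R br x y \<and> br x (c *\<^sub>R y) = c *\<^sub>R br x y) \<and>
    (\<forall>x\<in>L. br x x = 0) \<and>
    (\<forall>x\<in>L. \<forall>y\<in>L. \<forall>z\<in>L. br x (br y z) + br y (br z x) + br z (br x y) = 0)"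

definition lie_subalgebra :: "'a::real_vector set \<Rightarrow> 'a set \<Rightarrow> ('a \<Rightarrow> 'a \<Rightarrow> 'a) \<Rightarrow> bool"
  where "lie_subalgebra H L br \<longleftrightarrow> subspace H \<and> H \<subseteq> L \<and> (\<forall>x\<in>H. \<forall>y\<in>H. br x y \<in> H)"

record 'a lie_pair =
  ambient :: "'a set"
  bracket :: "'a \<Rightarrow> 'a \<Rightarrow> 'a"
  part1 :: "'a set"
  part2 :: "'a set"

definition matched_pair :: "'a::real_vector lie_pair \<Rightarrow> bool"
  where "matched_pair P \<longleftrightarrow>
    lie_algebra (ambient P) (bracket P) \<and>
    lie_subalgebra (part1 P) (ambient P) (bracket P) \<and>
    lie_subalgebra (part2 P) (ambient P) (bracket P) \<and>
    part1 P \<inter> part2 P = {0} \<and>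
    ambient P = {x + y | x y. x \<in> part1 P \<and> y \<in> part2 P}"

text \<open>Since \<^const>\<open>dim\<close> is 0 for infinite-dimensional spaces, this is meant for positive \<open>n1\<close> and \<open>n2\<close>.\<close>

definition matched_pair_dim :: "'a::real_vector lie_pair \<Rightarrow> nat \<Rightarrow> nat \<Rightarrow> bool"
  where "matched_pair_dim P n1 n2 \<longleftrightarrow> matched_pair P \<and> dim (part1 P) = n1 \<and> dim (part2 P) = n2"

definition lie_pair_iso :: "'a::real_vector lie_pair \<Rightarrow> 'b::real_vector lie_pair \<Rightarrow> bool"
  where "lie_pair_iso P Q \<longleftrightarrow> (\<exists>f.
    bij_betw f (ambient P) (ambient Q) \<and>
    (\<forall>x\<in>ambient P. \<forall>y\<in>ambient P. f (x + y) = f x + f y) \<and>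
    (\<forall>c. \<forall>x\<in>ambient P. f (c *\<^sub>R x) = c *\<^sub>R f x) \<and>
    (\<forall>x\<in>ambient P. \<forall>y\<in>ambient P. f (bracket P x y) = bracket Q (f x) (f y)) \<and>
    f ` part1 P = part1 Q \<and> f ` part2 P = part2 Q)"

definition described_by ::
    "'a::real_vector lie_pair \<Rightarrow> 'a \<Rightarrow> ('a \<Rightarrow> 'a) \<Rightarrow> ('a \<Rightarrow> real) \<Rightarrow> bool"
  where "described_by P A \<beta> chi \<longleftrightarrow>
    A \<noteq> 0 \<and> part2 P = span {A} \<and>
    (\<forall>X\<in>part1 P. \<beta> X \<in> part1 P \<and> bracket P X A = \<beta> X + chi X *\<^sub>R A)"

text \<open>The candidate pair on \<open>'v \<oplus> \<real>A\<close>, with \<open>A = (0, 1)\<close>, that is described by a bracket \<open>b\<close>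
  on \<open>'v\<close> and by \<open>\<beta>\<close> and \<open>chi\<close>; it is a matched pair only for suitable data.\<close>

definition pair_of ::
    "('v::real_vector \<Rightarrow> 'v \<Rightarrow> 'v) \<Rightarrow> ('v \<Rightarrow> 'v) \<Rightarrow> ('v \<Rightarrow> real) \<Rightarrow> ('v \<times> real) lie_pair"
  where "pair_of b \<beta> chi =
    \<lparr>ambient = UNIV,
     bracket = (\<lambda>(X, s) (Y, t). (b X Y + t *\<^sub>R \<beta> X - s *\<^sub>R \<beta> Y, t * chi X - s * chi Y)),
     part1 = UNIV \<times> {0},
     part2 = {0} \<times> UNIV\<rparr>"

lemma bracket_pair_of:
  assumes "linear \<beta>" "linear chi" "\<And>Z. b Z 0 = 0"
  shows "bracket (pair_of b \<beta> chi) (X, 0) (0, 1) = (\<beta> X, 0) + chi X *\<^sub>R (0, 1)"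
    and "bracket (pair_of b \<beta> chi) (X, 0) (Y, 0) = (b X Y, 0)"
  using assms by (auto simp: pair_of_def linear_0)

section \<open>The lists\<close>

text \<open>In dimension 1+1 the generator is \<open>X = 1\<close>; the arguments are the coefficient of \<open>\<beta>(X)\<close>
  and the value \<open>chi(X)\<close>.\<close>

definition pair1 :: "real \<Rightarrow> real \<Rightarrow> (real \<times> real) lie_pair"
  where "pair1 \<beta>X chiX = pair_of (\<lambda>_ _. 0) (\<lambda>x. x * \<beta>X) (\<lambda>x. x * chiX)"

datatype entry1 = E1 | E2 | E3 | E4

fun listed1 :: "entry1 \<Rightarrow> (real \<times> real) lie_pair"
  where
    "listed1 E1 = pair1 0 0"
  | "listed1 E2 = pair1 1 0"
  | "listed1 E3 = pair1 0 1"
  | "listed1 E4 = pair1 1 1"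

text \<open>In dimension 2+1 the generators are \<open>X = (1, 0)\<close> and \<open>Y = (0, 1)\<close>; the arguments are
  \<open>[X,Y]\<close>, \<open>\<beta>(X)\<close>, \<open>\<beta>(Y)\<close>, \<open>chi(X)\<close>, \<open>chi(Y)\<close>.\<close>

definition pair2 ::
    "real \<times> real \<Rightarrow> real \<times> real \<Rightarrow> real \<times> real \<Rightarrow> real \<Rightarrow> real \<Rightarrow> ((real \<times> real) \<times> real) lie_pair"
  where "pair2 XY \<beta>X \<beta>Y chiX chiY =
    pair_of (\<lambda>(x, y) (x', y'). (x * y' - y * x') *\<^sub>R XY)
            (\<lambda>(x, y). x *\<^sub>R \<beta>X + y *\<^sub>R \<beta>Y)
            (\<lambda>(x, y). x * chiX + y * chiY)"

abbreviation (input) genX :: "real \<times> real" where "genX \<equiv> (1, 0)"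
abbreviation (input) genY :: "real \<times> real" where "genY \<equiv> (0, 1)"

datatype entry2 =
    E11 | E12
  | E21 real | E22 | E23 | E24 | E25
  | E3a real
  | E41 real real | E42 real | E43 real

fun admissible :: "entry2 \<Rightarrow> bool"
  where
    "admissible (E21 r) \<longleftrightarrow> -1 \<le> r \<and> r \<le> 1"
  | "admissible (E41 d b) \<longleftrightarrow> d = 1 \<or> (d \<noteq> 1 \<and> b = 0)"
  | "admissible (E43 a) \<longleftrightarrow> a \<in> {1, 0, -1}"
  | "admissible _ \<longleftrightarrow> True"

text \<open>The pairs \<open>E41 1 b\<close> with \<open>b \<noteq> 0\<close> are isomorphic to each other, by rescaling \<open>Y\<close>. The list does
  not contain the pairs with \<open>[X,Y] = 0\<close>, \<open>chi = 0\<close> and \<open>\<beta>\<close> without real eigenvalues.\<close>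

fun listed2 :: "entry2 \<Rightarrow> ((real \<times> real) \<times> real) lie_pair"
  where
    "listed2 E11 = pair2 0 0 0 0 0"
  | "listed2 E12 = pair2 genY 0 0 0 0"
  | "listed2 (E21 r) = pair2 0 genX (r *\<^sub>R genY) 0 0"
  | "listed2 E22 = pair2 0 (genX + genY) genY 0 0"
  | "listed2 E23 = pair2 0 genY 0 0 0"
  | "listed2 E24 = pair2 genY genY 0 0 0"
  | "listed2 E25 = pair2 genY 0 genY 0 0"
  | "listed2 (E3a a) = pair2 (a *\<^sub>R genY) 0 0 1 0"
  | "listed2 (E41 d b) = pair2 (d *\<^sub>R genY) (genX + b *\<^sub>R genY) (d *\<^sub>R genY) 1 0"
  | "listed2 (E42 d) = pair2 (d *\<^sub>R genY) genY 0 1 0"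
  | "listed2 (E43 a) = pair2 (- genY) (a *\<^sub>R genY) genX 1 0"

section \<open>Lie groups\<close>

primrec Ck_on :: "nat \<Rightarrow> 'a::real_normed_vector set \<Rightarrow> ('a \<Rightarrow> 'b::real_normed_vector) \<Rightarrow> bool"
  where
    "Ck_on 0 = (\<lambda>S f. continuous_on S f)"
  | "Ck_on (Suc k) = (\<lambda>S f. (\<forall>x\<in>S. f differentiable (at x)) \<and>
      (\<forall>v. Ck_on k S (\<lambda>x. frechet_derivative f (at x) v)))"

text \<open>Only used for open subsets of Euclidean spaces, where it is the usual notion.\<close>

definition smooth_on :: "'a::real_normed_vector set \<Rightarrow> ('a \<Rightarrow> 'b::real_normed_vector) \<Rightarrow> bool"
  where "smooth_on S f \<longleftrightarrow> (\<forall>k. Ck_on k S f)"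

text \<open>Manifolds modelled on \<open>'e\<close>; a chart is a pair of its domain and its coordinate map.\<close>

record ('p, 'e) manifold =
  topo :: "'p topology"
  atlas :: "('p set \<times> ('p \<Rightarrow> 'e)) set"

definition smooth_manifold :: "('p, 'e::euclidean_space) manifold \<Rightarrow> bool"
  where "smooth_manifold M \<longleftrightarrow>
    Hausdorff_space (topo M) \<and>
    (\<exists>B. countable B \<and> (\<forall>V\<in>B. openin (topo M) V) \<and>
      (\<forall>U x. openin (topo M) U \<and> x \<in> U \<longrightarrow> (\<exists>V\<in>B. x \<in> V \<and> V \<subseteq> U))) \<and>
    (\<forall>(U, \<phi>)\<in>atlas M. openin (topo M) U \<and> open (\<phi> ` U) \<and>
      homeomorphic_map (subtopology (topo M) U) (top_of_set (\<phi> ` U)) \<phi>) \<and>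
    topspace (topo M) = (\<Union>(U, \<phi>)\<in>atlas M. U) \<and>
    (\<forall>(U, \<phi>)\<in>atlas M. \<forall>(V, \<psi>)\<in>atlas M. smooth_on (\<phi> ` (U \<inter> V)) (\<psi> \<circ> inv_into U \<phi>))"

definition smooth_map ::
    "('p, 'e::euclidean_space) manifold \<Rightarrow> ('q, 'f::euclidean_space) manifold \<Rightarrow> ('p \<Rightarrow> 'q) \<Rightarrow> bool"
  where "smooth_map M N f \<longleftrightarrow>
    continuous_map (topo M) (topo N) f \<and>
    (\<forall>(U, \<phi>)\<in>atlas M. \<forall>(V, \<psi>)\<in>atlas N.
      smooth_on (\<phi> ` (U \<inter> f -` V)) (\<psi> \<circ> f \<circ> inv_into U \<phi>))"

definition prod_manifold ::
    "('p, 'e::euclidean_space) manifold \<Rightarrow> ('q, 'f::euclidean_space) manifold \<Rightarrow> ('p \<times> 'q, 'e \<times> 'f) manifold"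
  where "prod_manifold M N =
    \<lparr>topo = prod_topology (topo M) (topo N),
     atlas = {(U \<times> V, map_prod \<phi> \<psi>) | U \<phi> V \<psi>. (U, \<phi>) \<in> atlas M \<and> (V, \<psi>) \<in> atlas N}\<rparr>"

definition model_manifold :: "('e, 'e::euclidean_space) manifold"
  where "model_manifold = \<lparr>topo = euclidean, atlas = {(UNIV, id)}\<rparr>"

definition lie_group :: "'p monoid \<Rightarrow> ('p, 'e::euclidean_space) manifold \<Rightarrow> bool"
  where "lie_group G M \<longleftrightarrow>
    group G \<and> smooth_manifold M \<and> topspace (topo M) = carrier G \<and>
    smooth_map (prod_manifold M M) M (\<lambda>(x, y). x \<otimes>\<^bsub>G\<^esub> y) \<and>
    smooth_map M M (\<lambda>x. inv\<^bsub>G\<^esub> x)"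

subsection \<open>The Lie algebra of a Lie group\<close>

text \<open>Smooth functions are extended by 0 outside the manifold, and operators on them by 0
  outside the smooth functions, so that equality of functions and of operators is the intended one.\<close>

definition smooth_functions :: "('p, 'e::euclidean_space) manifold \<Rightarrow> ('p \<Rightarrow> real) set"
  where "smooth_functions M =
    {f. smooth_map M model_manifold f \<and> (\<forall>x. x \<notin> topspace (topo M) \<longrightarrow> f x = 0)}"

text \<open>A smooth vector field, identified with its action on smooth functions: in each chart it is
  the directional derivative along a smooth field \<open>V\<close> of vectors in \<open>'e\<close>.\<close>

definition vector_field ::
    "('p, 'e::euclidean_space) manifold \<Rightarrow> (('p \<Rightarrow> real) \<Rightarrow> ('p \<Rightarrow> real)) \<Rightarrow> bool"
  where "vector_field M D \<longleftrightarrow>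
    (\<forall>f. f \<notin> smooth_functions M \<longrightarrow> D f = 0) \<and>
    (\<forall>f x. x \<notin> topspace (topo M) \<longrightarrow> D f x = 0) \<and>
    (\<forall>(U, \<phi>)\<in>atlas M. \<exists>V. smooth_on (\<phi> ` U) V \<and>
      (\<forall>f\<in>smooth_functions M. \<forall>p\<in>U.
        D f p = frechet_derivative (f \<circ> inv_into U \<phi>) (at (\<phi> p)) (V (\<phi> p))))"

definition left_translate :: "'p monoid \<Rightarrow> 'p \<Rightarrow> ('p \<Rightarrow> real) \<Rightarrow> ('p \<Rightarrow> real)"
  where "left_translate G g f = (\<lambda>x. if x \<in> carrier G then f (g \<otimes>\<^bsub>G\<^esub> x) else 0)"

definition Lie ::
    "'p monoid \<Rightarrow> ('p, 'e::euclidean_space) manifold \<Rightarrow> (('p \<Rightarrow> real) \<Rightarrow> ('p \<Rightarrow> real)) set"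
  where "Lie G M = {D. vector_field M D \<and>
    (\<forall>g\<in>carrier G. \<forall>f\<in>smooth_functions M. D (left_translate G g f) = left_translate G g (D f))}"

definition commutator ::
    "(('p \<Rightarrow> real) \<Rightarrow> ('p \<Rightarrow> real)) \<Rightarrow> (('p \<Rightarrow> real) \<Rightarrow> ('p \<Rightarrow> real)) \<Rightarrow> ('p \<Rightarrow> real) \<Rightarrow> ('p \<Rightarrow> real)"
  where "commutator D E = (\<lambda>f. D (E f) - E (D f))"

text \<open>The elements of the Lie algebra whose value at the identity is the velocity of a smooth
  curve inside \<open>H\<close>. Used for closed subgroups \<open>H\<close>, which are embedded submanifolds.\<close>

definition tangent_algebra ::
    "'p monoid \<Rightarrow> ('p, 'e::euclidean_space) manifold \<Rightarrow> 'p set \<Rightarrow> (('p \<Rightarrow> real) \<Rightarrow> ('p \<Rightarrow> real)) set"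
  where "tangent_algebra G M H = {D \<in> Lie G M.
    \<exists>\<gamma>::real \<Rightarrow> 'p. smooth_map model_manifold M \<gamma> \<and> range \<gamma> \<subseteq> H \<and> \<gamma> 0 = \<one>\<^bsub>G\<^esub> \<and>
      (\<forall>f\<in>smooth_functions M. ((f \<circ> \<gamma>) has_real_derivative D f \<one>\<^bsub>G\<^esub>) (at 0))}"

section \<open>Matched pairs of Lie groups and exponentiation\<close>

definition antihom :: "'q monoid \<Rightarrow> 'p monoid \<Rightarrow> ('q \<Rightarrow> 'p) set"
  where "antihom G H = {h. h \<in> carrier G \<rightarrow> carrier H \<and>
    (\<forall>x\<in>carrier G. \<forall>y\<in>carrier G. h (x \<otimes>\<^bsub>G\<^esub> y) = h y \<otimes>\<^bsub>H\<^esub> h x)}"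

text \<open>\<open>G1\<close> and \<open>G2\<close> carry topologies \<open>T1\<close> and \<open>T2\<close>. The embedding conditions make them
  isomorphic (up to passing to the opposite group) to closed subgroups of \<open>G\<close>, so that they are
  automatically Lie groups. Measure zero means Lebesgue measure zero in all charts.\<close>

definition matched_pair_groups ::
    "'p monoid \<Rightarrow> ('p, 'e::euclidean_space) manifold \<Rightarrow>
     'q monoid \<Rightarrow> 'q topology \<Rightarrow> ('q \<Rightarrow> 'p) \<Rightarrow>
     'r monoid \<Rightarrow> 'r topology \<Rightarrow> ('r \<Rightarrow> 'p) \<Rightarrow> bool"
  where "matched_pair_groups G M G1 T1 i G2 T2 j \<longleftrightarrow>
    lie_group G M \<and>
    group G1 \<and> topspace T1 = carrier G1 \<and>
    group G2 \<and> topspace T2 = carrier G2 \<and>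
    i \<in> hom G1 G \<and> j \<in> antihom G2 G \<and>
    embedding_map T1 (topo M) i \<and> closedin (topo M) (i ` carrier G1) \<and>
    embedding_map T2 (topo M) j \<and> closedin (topo M) (j ` carrier G2) \<and>
    i ` carrier G1 \<inter> j ` carrier G2 = {\<one>\<^bsub>G\<^esub>} \<and>
    (\<forall>(U, \<phi>)\<in>atlas M.
      negligible (\<phi> ` (U - {i x \<otimes>\<^bsub>G\<^esub> j y | x y. x \<in> carrier G1 \<and> y \<in> carrier G2})))"

definition lie_pair_of_groups ::
    "'p monoid \<Rightarrow> ('p, 'e::euclidean_space) manifold \<Rightarrow> 'q monoid \<Rightarrow> ('q \<Rightarrow> 'p) \<Rightarrow>
     'r monoid \<Rightarrow> ('r \<Rightarrow> 'p) \<Rightarrow> (('p \<Rightarrow> real) \<Rightarrow> ('p \<Rightarrow> real)) lie_pair"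
  where "lie_pair_of_groups G M G1 i G2 j =
    \<lparr>ambient = Lie G M,
     bracket = commutator,
     part1 = tangent_algebra G M (i ` carrier G1),
     part2 = tangent_algebra G M (j ` carrier G2)\<rparr>"

definition at_most_two_components :: "'p topology \<Rightarrow> bool"
  where "at_most_two_components T \<longleftrightarrow>
    finite (connected_components_of T) \<and> card (connected_components_of T) \<le> 2"

text \<open>For a pair whose Lie algebra is a whole Euclidean space \<open>'a\<close>, as in the lists above; \<open>G\<close> is
  then modelled on \<open>'a\<close>. The elements of the three groups may be taken in \<open>\<real>^4\<close> without
  loss of generality: a second countable manifold has at most the cardinality of the continuum,
  and topologies and charts are unrelated to those of \<open>\<real>^4\<close>.\<close>

definition exponentiable_le2 :: "'a::euclidean_space lie_pair \<Rightarrow> bool"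
  where "exponentiable_le2 P \<longleftrightarrow>
    (\<exists>(G :: (real \<times> real \<times> real \<times> real) monoid) (M :: (real \<times> real \<times> real \<times> real, 'a) manifold)
      (G1 :: (real \<times> real \<times> real \<times> real) monoid) T1 i
      (G2 :: (real \<times> real \<times> real \<times> real) monoid) T2 j.
      matched_pair_groups G M G1 T1 i G2 T2 j \<and>
      lie_pair_iso (lie_pair_of_groups G M G1 i G2 j) P \<and>
      at_most_two_components (topo M) \<and>
      at_most_two_components T1 \<and> at_most_two_components T2)"

end

theory Submission
  imports Defs
begin

text \<open>In coordinates a pair of dimension 2+1 is a point of a variety cut out by the Jacobi identity,
  and two of them are isomorphic iff a change of basis \<open>X \<mapsto> p X + q Y\<close>, \<open>Y \<mapsto> r X + s Y\<close>, \<open>A \<mapsto> l A\<close>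
  transforms the structure constants into each other; both the list and the absence of repetitions are
  then linear algebra.

  For the exponentiation, every Lie algebra of the lists except those of \<open>E43\<close> is \<open>\<real>h \<ltimes> V\<close> with \<open>V\<close>
  abelian and \<open>h\<close> acting by a matrix \<open>N\<close>. Take the semidirect product of \<open>V\<close> by \<open>s > 0\<close>, or by
  \<open>s \<noteq> 0\<close>, acting by \<open>sgn s * exp (ln \<bar>s\<bar> N)\<close>, with subgroups of elements \<open>(c s + v, s)\<close> where \<open>c\<close> is a
  cocycle and \<open>v\<close> ranges over a subspace. The pairs \<open>E43 a\<close> live in \<open>PGL(2, \<real>)\<close>, as the group of upper
  triangular matrices and the units of the algebra of matrices \<open>(x, a y; y, x)\<close>. The Iwasawa decomposition
  identifies \<open>PGL(2, \<real>)\<close> with an open subset of \<open>\<real>\<^sup>3\<close>, so that all Lie groups used here have a single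
  chart; the coordinates are then smooth functions on the whole group, and the Lie algebra is read off
  the derivative of the multiplication.\<close>

subsection \<open>Functions of class \<open>C\<^sup>k\<close>\<close>

text \<open>What decides about the number of components is the condition that the product of the two
  subgroups be conull. In the semidirect products it is delicate only when neither \<open>X\<close>
  nor \<open>A\<close> lies in the abelian ideal, so that the subgroup of \<open>A\<close> is the
  graph of a cocycle. An element \<open>(v, s)\<close> is then a product iff some scalar
  \<open>r\<close> solves one real equation; for the cocycle \<open>1 - s\<close> the solution is
  \<open>r = s + v\<close>. With positive scalars only, this fails on an open set; with all nonzero
  scalars it fails only on a hyperplane. Hence the second component.

  In the projective linear group the cosets of the triangular group are the lines spanned by bottom
  rows, so the other subgroup must have a conull orbit on the projective line. For
  \<open>a = 1\<close> its identity component reaches only the lines with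
  \<open>\<bar>y\<bar> < \<bar>x\<bar>\<close>; the matrices of negative determinant supply the
  others.

  The Lie algebra consists of operators on global functions; with several charts, recovering a
  tangent vector from its operator would take cutoff functions.\<close>

lemma Ck_on_cong:
  assumes "open S" "\<And>x. x \<in> S \<Longrightarrow> f x = g x" "Ck_on k S f"
  shows "Ck_on k S g"
  using assms(2,3)
proof (induction k arbitrary: f g)
  case 0
  then show ?case using continuous_on_cong[of S S f g] by simp
next
  case (Suc k)
  have D: "(f has_derivative frechet_derivative f (at x)) (at x)" if "x \<in> S" for x
    using Suc.prems(2) that frechet_derivative_works by auto
  have *: "(g has_derivative frechet_derivative f (at x)) (at x)" if "x \<in> S" for x
    by (rule has_derivative_transform_within_open[OF D[OF that] assms(1) that Suc.prems(1)])
  have eq: "frechet_derivative f (at x) = frechet_derivative g (at x)" if "x \<in> S" for x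
    by (rule frechet_derivative_at[OF *[OF that]])
  have "Ck_on k S (\<lambda>x. frechet_derivative g (at x) v)" for v
    by (rule Suc.IH[of "\<lambda>x. frechet_derivative f (at x) v"]) (use Suc.prems(2) eq in simp_all)
  moreover have "\<forall>x\<in>S. g differentiable (at x)"
    using * differentiable_def by blast
  ultimately show ?case by simp
qed

text \<open>The recursion of \<open>Ck_on\<close> speaks of \<open>frechet_derivative\<close>, a
  chosen derivative. By uniqueness of derivatives any explicit formula may replace it, and the
  closure properties below are inductions on \<open>k\<close> through this rule.\<close>

lemma Ck_on_SucI:
  assumes "open S" "\<And>x. x \<in> S \<Longrightarrow> (f has_derivative f' x) (at x)"
    and "\<And>v. Ck_on k S (\<lambda>x. f' x v)"
  shows "Ck_on (Suc k) S f"
proof -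
  have "f' x = frechet_derivative f (at x)" if "x \<in> S" for x
    by (rule frechet_derivative_at[OF assms(2)[OF that]])
  then have "Ck_on k S (\<lambda>x. frechet_derivative f (at x) v)" for v
    using Ck_on_cong[OF assms(1) _ assms(3)[of v]] by auto
  then show ?thesis using assms(2) by (auto simp: differentiable_def)
qed

lemma Ck_on_Suc_has_derivative:
  assumes "Ck_on (Suc k) S f" "x \<in> S"
  shows "(f has_derivative frechet_derivative f (at x)) (at x)"
  using assms by (auto simp: frechet_derivative_works[symmetric])

lemma Ck_on_Suc_imp: "Ck_on (Suc k) S f \<Longrightarrow> Ck_on k S f"
proof (induction k arbitrary: f)
  case 0
  then show ?case
    by (auto intro!: continuous_at_imp_continuous_on dest: differentiable_imp_continuous_within)
qed auto

lemma Ck_on_const: "open S \<Longrightarrow> Ck_on k S (\<lambda>x. c)"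
proof (induction k arbitrary: c)
  case (Suc k)
  then show ?case by (intro Ck_on_SucI[where f' = "\<lambda>_ _. 0"]) auto
qed auto

lemma Ck_on_linear_compose:
  assumes L: "bounded_linear L" and S: "open S"
  shows "Ck_on k S f \<Longrightarrow> Ck_on k S (\<lambda>x. L (f x))"
proof (induction k arbitrary: f)
  case 0
  then show ?case using bounded_linear.continuous_on[OF L] by simp
next
  case (Suc k)
  show ?case
  proof (rule Ck_on_SucI[OF S])
    show "((\<lambda>x. L (f x)) has_derivative (\<lambda>v. L (frechet_derivative f (at x) v))) (at x)" if "x \<in> S" for x
      by (rule bounded_linear.has_derivative[OF L Ck_on_Suc_has_derivative[OF Suc.prems that]])
    show "Ck_on k S (\<lambda>x. L (frechet_derivative f (at x) v))" for v
      by (rule Suc.IH) (use Suc.prems in simp)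
  qed
qed

lemma Ck_on_ident: "open S \<Longrightarrow> Ck_on k S (\<lambda>x. x)"
proof (cases k)
  case (Suc l)
  assume S: "open S"
  show ?thesis unfolding Suc
    by (rule Ck_on_SucI[OF S has_derivative_ident]) (rule Ck_on_const[OF S])
qed simp

lemma Ck_on_add:
  assumes S: "open S"
  shows "Ck_on k S f \<Longrightarrow> Ck_on k S g \<Longrightarrow> Ck_on k S (\<lambda>x. f x + g x)"
proof (induction k arbitrary: f g)
  case 0
  then show ?case by (simp add: continuous_on_add)
next
  case (Suc k)
  show ?case
  proof (rule Ck_on_SucI[OF S])
    show "((\<lambda>x. f x + g x) has_derivative (\<lambda>v. frechet_derivative f (at x) v + frechet_derivative g (at x) v)) (at x)"
      if "x \<in> S" for x
      by (intro has_derivative_add Ck_on_Suc_has_derivative[OF Suc.prems(1) that]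
          Ck_on_Suc_has_derivative[OF Suc.prems(2) that])
    show "Ck_on k S (\<lambda>x. frechet_derivative f (at x) v + frechet_derivative g (at x) v)" for v
      by (rule Suc.IH) (use Suc.prems in simp_all)
  qed
qed

lemma Ck_on_sum:
  assumes "open S" "\<And>i. i \<in> I \<Longrightarrow> Ck_on k S (f i)"
  shows "Ck_on k S (\<lambda>x. \<Sum>i\<in>I. f i x)"
  using assms(2)
  by (induction I rule: infinite_finite_induct) (auto intro: Ck_on_const Ck_on_add assms(1))

text \<open>The product rule yields two terms of the same bilinear shape with one factor
  differentiated, so the induction runs over arbitrary \<open>f\<close> and \<open>g\<close>; the
  undifferentiated factor enters through \<open>Ck_on_Suc_imp\<close>.\<close>

lemma Ck_on_bilinear:
  assumes "bounded_bilinear B" "open S"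
  shows "Ck_on k S f \<Longrightarrow> Ck_on k S g \<Longrightarrow> Ck_on k S (\<lambda>x. B (f x) (g x))"
proof (induction k arbitrary: f g)
  case 0
  then show ?case using bounded_bilinear.continuous_on[OF assms(1)] by simp
next
  case (Suc k)
  have fg: "Ck_on k S f" "Ck_on k S g" using Suc.prems Ck_on_Suc_imp by blast+
  show ?case
  proof (rule Ck_on_SucI[OF assms(2)])
    show "((\<lambda>x. B (f x) (g x)) has_derivative
       (\<lambda>v. B (f x) (frechet_derivative g (at x) v) + B (frechet_derivative f (at x) v) (g x))) (at x)"
      if "x \<in> S" for x
      by (rule bounded_bilinear.FDERIV[OF assms(1) Ck_on_Suc_has_derivative[OF Suc.prems(1) that]
            Ck_on_Suc_has_derivative[OF Suc.prems(2) that]])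
    show "Ck_on k S (\<lambda>x. B (f x) (frechet_derivative g (at x) v) + B (frechet_derivative f (at x) v) (g x))" for v
      by (rule Ck_on_add[OF assms(2)]; rule Suc.IH) (use Suc.prems fg in simp_all)
  qed
qed

lemma linear_basis_expansion:
  fixes L :: "'b::euclidean_space \<Rightarrow> 'c::real_vector"
  assumes "linear L"
  shows "L v = (\<Sum>b\<in>Basis. (v \<bullet> b) *\<^sub>R L b)"
proof -
  have "L v = L (\<Sum>b\<in>Basis. (v \<bullet> b) *\<^sub>R b)" by (simp add: euclidean_representation)
  also have "\<dots> = (\<Sum>b\<in>Basis. (v \<bullet> b) *\<^sub>R L b)"
    by (simp add: linear_sum[OF assms] linear_cmul[OF assms])
  finally show ?thesis .
qed

text \<open>In the chain rule the derivative of \<open>g\<close> is taken in a direction that itself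
  moves with \<open>x\<close>, so it is not a fixed function composed with \<open>f\<close>.
  Expanding the direction in \<open>Basis\<close> turns it into a sum of products of a component of
  the derivative of \<open>f\<close> and a partial derivative of \<open>g\<close> composed with
  \<open>f\<close>, to which the induction hypothesis applies.\<close>

lemma Ck_on_compose:
  fixes f :: "'a::real_normed_vector \<Rightarrow> 'b::euclidean_space"
  assumes "open S" "open T" "\<And>x. x \<in> S \<Longrightarrow> f x \<in> T"
  shows "Ck_on k T g \<Longrightarrow> Ck_on k S f \<Longrightarrow> Ck_on k S (\<lambda>x. g (f x))"
proof (induction k arbitrary: g)
  case 0
  then show ?case using assms(3) by (auto intro: continuous_on_compose2)
next
  case (Suc k)
  let ?g' = "\<lambda>y. frechet_derivative g (at y)"
  let ?f' = "\<lambda>x. frechet_derivative f (at x)"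
  have fk: "Ck_on k S f" using Suc.prems Ck_on_Suc_imp by blast
  have lin: "linear (?g' (f x))" if "x \<in> S" for x
    using Suc.prems(1) assms(3)[OF that] by (auto intro: linear_frechet_derivative)
  show ?case
  proof (rule Ck_on_SucI[OF assms(1)])
    show "((\<lambda>x. g (f x)) has_derivative (\<lambda>v. \<Sum>b\<in>Basis. (?f' x v \<bullet> b) *\<^sub>R ?g' (f x) b)) (at x)"
      if x: "x \<in> S" for x
    proof -
      have "((\<lambda>x. g (f x)) has_derivative (\<lambda>v. ?g' (f x) (?f' x v))) (at x)"
        using has_derivative_compose[OF Ck_on_Suc_has_derivative[OF Suc.prems(2) x]
            Ck_on_Suc_has_derivative[OF Suc.prems(1) assms(3)[OF x]]] .
      then show ?thesis by (simp add: linear_basis_expansion[OF lin[OF x], symmetric])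
    qed
    show "Ck_on k S (\<lambda>x. \<Sum>b\<in>Basis. (?f' x v \<bullet> b) *\<^sub>R ?g' (f x) b)" for v
    proof (intro Ck_on_sum assms(1) Ck_on_bilinear[OF bounded_bilinear_scaleR])
      fix b :: 'b
      show "Ck_on k S (\<lambda>x. ?f' x v \<bullet> b)"
        using Suc.prems(2) by (intro Ck_on_linear_compose[OF bounded_linear_inner_left] assms(1)) auto
      show "Ck_on k S (\<lambda>x. ?g' (f x) b)"
        using Suc.prems(1) fk by (intro Suc.IH) auto
    qed
  qed
qed

subsection \<open>Smooth maps\<close>

named_theorems smooth_intros

lemma smooth_on_cong:
  "open S \<Longrightarrow> (\<And>x. x \<in> S \<Longrightarrow> f x = g x) \<Longrightarrow> smooth_on S f \<Longrightarrow> smooth_on S g"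
  unfolding smooth_on_def by (blast intro: Ck_on_cong)

lemma smooth_onI:
  assumes "open S" "\<And>x. x \<in> S \<Longrightarrow> (f has_derivative f' x) (at x)"
    and "\<And>v. smooth_on S (\<lambda>x. f' x v)"
  shows "smooth_on S f"
  using Ck_on_SucI[OF assms(1,2)] assms(3) Ck_on_Suc_imp unfolding smooth_on_def by blast

lemma smooth_on_has_derivative:
  "smooth_on S f \<Longrightarrow> x \<in> S \<Longrightarrow> (f has_derivative frechet_derivative f (at x)) (at x)"
  unfolding smooth_on_def using Ck_on_Suc_has_derivative by blast

lemma smooth_on_differentiable: "smooth_on S f \<Longrightarrow> x \<in> S \<Longrightarrow> f differentiable (at x)"
  using smooth_on_has_derivative unfolding differentiable_def by blast

lemma smooth_on_frechet_derivative:
  "smooth_on S f \<Longrightarrow> smooth_on S (\<lambda>x. frechet_derivative f (at x) v)"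
  unfolding smooth_on_def
proof (intro allI)
  fix k
  assume "\<forall>k. Ck_on k S f"
  then have "Ck_on (Suc k) S f" by blast
  then show "Ck_on k S (\<lambda>x. frechet_derivative f (at x) v)" by simp
qed

lemma smooth_on_imp_continuous_on: "smooth_on S f \<Longrightarrow> continuous_on S f"
  unfolding smooth_on_def by (metis Ck_on.simps(1))

lemma smooth_on_const [smooth_intros]: "open S \<Longrightarrow> smooth_on S (\<lambda>x. c)"
  by (simp add: smooth_on_def Ck_on_const)

lemma smooth_on_ident [smooth_intros]: "open S \<Longrightarrow> smooth_on S (\<lambda>x. x)"
  by (simp add: smooth_on_def Ck_on_ident)

lemma smooth_on_linear_compose:
  "bounded_linear L \<Longrightarrow> open S \<Longrightarrow> smooth_on S f \<Longrightarrow> smooth_on S (\<lambda>x. L (f x))"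
  by (simp add: smooth_on_def Ck_on_linear_compose)

lemmas smooth_on_fst [smooth_intros] = smooth_on_linear_compose[OF bounded_linear_fst]
  and smooth_on_snd [smooth_intros] = smooth_on_linear_compose[OF bounded_linear_snd]
  and smooth_on_minus [smooth_intros] = smooth_on_linear_compose[OF bounded_linear_minus[OF bounded_linear_ident]]

lemma smooth_on_add [smooth_intros]:
  "open S \<Longrightarrow> smooth_on S f \<Longrightarrow> smooth_on S g \<Longrightarrow> smooth_on S (\<lambda>x. f x + g x)"
  by (simp add: smooth_on_def Ck_on_add)

lemma smooth_on_diff [smooth_intros]:
  "open S \<Longrightarrow> smooth_on S f \<Longrightarrow> smooth_on S g \<Longrightarrow> smooth_on S (\<lambda>x. f x - g x)"
  using smooth_on_add[of S f "\<lambda>x. - g x"] smooth_on_minus[of S g] by simp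

lemma smooth_on_sum [smooth_intros]:
  "open S \<Longrightarrow> (\<And>i. i \<in> I \<Longrightarrow> smooth_on S (f i)) \<Longrightarrow> smooth_on S (\<lambda>x. \<Sum>i\<in>I. f i x)"
  by (simp add: smooth_on_def Ck_on_sum)

lemma smooth_on_bilinear:
  "bounded_bilinear B \<Longrightarrow> open S \<Longrightarrow> smooth_on S f \<Longrightarrow> smooth_on S g
    \<Longrightarrow> smooth_on S (\<lambda>x. B (f x) (g x))"
  by (simp add: smooth_on_def Ck_on_bilinear)

lemmas smooth_on_scaleR [smooth_intros] = smooth_on_bilinear[OF bounded_bilinear_scaleR]
  and smooth_on_inner [smooth_intros] = smooth_on_bilinear[OF bounded_bilinear_inner]
  and smooth_on_mult [smooth_intros] = smooth_on_bilinear[OF bounded_bilinear_mult]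

lemma smooth_on_compose:
  fixes f :: "'a::real_normed_vector \<Rightarrow> 'b::euclidean_space"
  shows "open S \<Longrightarrow> open T \<Longrightarrow> smooth_on T g \<Longrightarrow> smooth_on S f \<Longrightarrow> (\<And>x. x \<in> S \<Longrightarrow> f x \<in> T)
    \<Longrightarrow> smooth_on S (\<lambda>x. g (f x))"
  by (simp add: smooth_on_def Ck_on_compose)

lemma smooth_on_Pair [smooth_intros]:
  assumes "open S" "smooth_on S f" "smooth_on S g"
  shows "smooth_on S (\<lambda>x. (f x, g x))"
proof -
  have "bounded_linear (\<lambda>x. (x, 0))" "bounded_linear (\<lambda>x. (0, x))"
    by (auto intro!: bounded_linear_Pair bounded_linear_ident bounded_linear_zero)
  then have "smooth_on S (\<lambda>x. (f x, 0) + (0, g x))"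
    using smooth_on_linear_compose[of "\<lambda>x. (x, 0)" S f] smooth_on_linear_compose[of "\<lambda>x. (0, x)" S g] assms
    by (intro smooth_on_add) auto
  then show ?thesis by simp
qed

lemma smooth_on_power [smooth_intros]:
  fixes f :: "'a::real_normed_vector \<Rightarrow> real"
  shows "open S \<Longrightarrow> smooth_on S f \<Longrightarrow> smooth_on S (\<lambda>x. f x ^ n)"
  by (induction n) (auto intro: smooth_intros)

text \<open>The derivative is a polynomial in \<open>inverse\<close> itself, so class
  \<open>k\<close> passes from the function to its derivative and the induction feeds on itself. The
  exponential works the same way.\<close>

lemma smooth_on_real_inverse: "smooth_on (- {0::real}) inverse"
proof -
  have "Ck_on k (- {0::real}) inverse" for k
  proof (induction k)
    case 0
    then show ?case by (auto intro!: continuous_intros)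
  next
    case (Suc k)
    show ?case
    proof (rule Ck_on_SucI)
      show "open (- {0::real})" by auto
      show "(inverse has_derivative (\<lambda>v. v * - (inverse x * inverse x))) (at x)" if "x \<in> - {0}" for x :: real
        using that by (auto intro!: derivative_eq_intros simp: algebra_simps)
      show "Ck_on k (- {0}) (\<lambda>x::real. v * - (inverse x * inverse x))" for v
        by (intro Ck_on_bilinear[OF bounded_bilinear_mult] Ck_on_const Suc
            Ck_on_linear_compose[OF bounded_linear_minus[OF bounded_linear_ident]]) auto
    qed
  qed
  then show ?thesis by (simp add: smooth_on_def)
qed

lemma smooth_on_exp_real: "smooth_on UNIV (exp :: real \<Rightarrow> real)"
proof -
  have "Ck_on k UNIV (exp :: real \<Rightarrow> real)" for k
  proof (induction k)
    case 0
    then show ?case by (auto intro!: continuous_intros)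
  next
    case (Suc k)
    show ?case
    proof (rule Ck_on_SucI)
      show "(exp has_derivative (\<lambda>v. v * exp x)) (at x)" for x :: real
        by (auto intro!: derivative_eq_intros)
      show "Ck_on k UNIV (\<lambda>x::real. v * exp x)" for v
        by (intro Ck_on_bilinear[OF bounded_bilinear_mult] Ck_on_const Suc) auto
    qed auto
  qed
  then show ?thesis by (simp add: smooth_on_def)
qed

text \<open>Both branches have derivative \<open>1 / x\<close>, which reduces the claim to
  \<open>inverse\<close>. Together with the locally constant \<open>sgn\<close> this gives smooth
  coordinates on the multiplicative group of all nonzero scalars.\<close>

lemma smooth_on_ln_abs: "smooth_on (- {0::real}) (\<lambda>x. ln \<bar>x\<bar>)"
proof (rule smooth_onI)
  show "((\<lambda>x. ln \<bar>x\<bar>) has_derivative (\<lambda>v. v * inverse x)) (at x)" if "x \<in> - {0}" for x :: real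
  proof (cases "x > 0")
    case True
    have "((\<lambda>x. ln x) has_derivative (\<lambda>v. v * inverse x)) (at x)"
      using True by (auto intro!: derivative_eq_intros)
    then show ?thesis
      by (rule has_derivative_transform_within_open[of _ _ _ _ "{0<..}"]) (use True in auto)
  next
    case False
    then have "x < 0" using that by auto
    then have "((\<lambda>x. ln (- x)) has_derivative (\<lambda>v. v * inverse x)) (at x)"
      by (auto intro!: derivative_eq_intros)
    then show ?thesis
      by (rule has_derivative_transform_within_open[of _ _ _ _ "{..<0}"]) (use \<open>x < 0\<close> in auto)
  qed
qed (auto intro!: smooth_intros smooth_on_real_inverse)

lemma smooth_on_sgn: "smooth_on (- {0::real}) sgn"
proof (rule smooth_onI)
  show "(sgn has_derivative (\<lambda>v. 0)) (at x)" if "x \<in> - {0}" for x :: real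
  proof (cases "x > 0")
    case True
    have "((\<lambda>x. 1) has_derivative (\<lambda>v. 0)) (at x)" by simp
    then show ?thesis
      by (rule has_derivative_transform_within_open[of _ _ _ _ "{0<..}"]) (use True in auto)
  next
    case False
    have "((\<lambda>x. - 1) has_derivative (\<lambda>v. 0)) (at x)" by simp
    then show ?thesis
      by (rule has_derivative_transform_within_open[of _ _ _ _ "{..<0}"]) (use that False in auto)
  qed
qed (auto intro!: smooth_intros)

lemma smooth_on_inverse_compose [smooth_intros]:
  fixes f :: "'a::real_normed_vector \<Rightarrow> real"
  shows "open S \<Longrightarrow> smooth_on S f \<Longrightarrow> (\<And>x. x \<in> S \<Longrightarrow> f x \<noteq> 0) \<Longrightarrow> smooth_on S (\<lambda>x. inverse (f x))"
  by (rule smooth_on_compose[OF _ _ smooth_on_real_inverse]) auto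

lemma smooth_on_divide [smooth_intros]:
  fixes f g :: "'a::real_normed_vector \<Rightarrow> real"
  shows "open S \<Longrightarrow> smooth_on S f \<Longrightarrow> smooth_on S g \<Longrightarrow> (\<And>x. x \<in> S \<Longrightarrow> g x \<noteq> 0)
    \<Longrightarrow> smooth_on S (\<lambda>x. f x / g x)"
  unfolding divide_inverse by (intro smooth_intros)

lemma smooth_on_exp_compose [smooth_intros]:
  fixes f :: "'a::real_normed_vector \<Rightarrow> real"
  shows "open S \<Longrightarrow> smooth_on S f \<Longrightarrow> smooth_on S (\<lambda>x. exp (f x))"
  by (rule smooth_on_compose[OF _ _ smooth_on_exp_real]) auto

lemma smooth_on_ln_abs_compose [smooth_intros]:
  fixes f :: "'a::real_normed_vector \<Rightarrow> real"
  shows "open S \<Longrightarrow> smooth_on S f \<Longrightarrow> (\<And>x. x \<in> S \<Longrightarrow> f x \<noteq> 0) \<Longrightarrow> smooth_on S (\<lambda>x. ln \<bar>f x\<bar>)"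
  by (rule smooth_on_compose[OF _ _ smooth_on_ln_abs]) auto

lemma smooth_on_sgn_compose [smooth_intros]:
  fixes f :: "'a::real_normed_vector \<Rightarrow> real"
  shows "open S \<Longrightarrow> smooth_on S f \<Longrightarrow> (\<And>x. x \<in> S \<Longrightarrow> f x \<noteq> 0) \<Longrightarrow> smooth_on S (\<lambda>x. sgn (f x))"
  by (rule smooth_on_compose[OF _ _ smooth_on_sgn]) auto

text \<open>The mean value theorem is applied twice to the second difference over a parallelogram:
  in direction \<open>v\<close> to the difference across the side \<open>w\<close>, and in direction
  \<open>w\<close> to the derivative along \<open>v\<close>.\<close>

lemma second_difference_mean_value:
  fixes f :: "'a::real_normed_vector \<Rightarrow> real"
  assumes f': "\<And>y. y \<in> S \<Longrightarrow> (f has_derivative f' y) (at y)"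
    and f'': "\<And>y. y \<in> S \<Longrightarrow> ((\<lambda>y. f' y v) has_derivative f'' y) (at y)"
    and h: "0 < h" and S: "\<And>s t. s \<in> {0..h} \<Longrightarrow> t \<in> {0..h} \<Longrightarrow> x + s *\<^sub>R v + t *\<^sub>R w \<in> S"
  shows "\<exists>s\<in>{0<..<h}. \<exists>t\<in>{0<..<h}.
    f (x + h *\<^sub>R v + h *\<^sub>R w) - f (x + h *\<^sub>R v) - f (x + h *\<^sub>R w) + f x = h * h * f'' (x + s *\<^sub>R v + t *\<^sub>R w) w"
proof -
  have D: "((\<lambda>s. f (x + s *\<^sub>R v + t *\<^sub>R w)) has_real_derivative f' (x + s *\<^sub>R v + t *\<^sub>R w) v) (at s)"
    if "s \<in> {0..h}" "t \<in> {0..h}" for s t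
  proof -
    have 1: "((\<lambda>s. x + s *\<^sub>R v + t *\<^sub>R w) has_derivative (\<lambda>c. c *\<^sub>R v)) (at s)"
      by (auto intro!: derivative_eq_intros)
    have 2: "linear (f' (x + s *\<^sub>R v + t *\<^sub>R w))"
      using f'[OF S[OF that]] has_derivative_linear by blast
    have 3: "(\<lambda>c. f' (x + s *\<^sub>R v + t *\<^sub>R w) (c *\<^sub>R v)) = (*) (f' (x + s *\<^sub>R v + t *\<^sub>R w) v)"
      by (simp add: fun_eq_iff linear_cmul[OF 2] mult.commute)
    show ?thesis
      using has_derivative_compose[OF 1 f'[OF S[OF that]]] unfolding 3 has_field_derivative_def .
  qed
  have D2: "((\<lambda>t. f' (x + s *\<^sub>R v + t *\<^sub>R w) v) has_real_derivative f'' (x + s *\<^sub>R v + t *\<^sub>R w) w) (at t)"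
    if "s \<in> {0..h}" "t \<in> {0..h}" for s t
  proof -
    have 1: "((\<lambda>t. x + s *\<^sub>R v + t *\<^sub>R w) has_derivative (\<lambda>c. c *\<^sub>R w)) (at t)"
      by (auto intro!: derivative_eq_intros)
    have 2: "linear (f'' (x + s *\<^sub>R v + t *\<^sub>R w))"
      using f''[OF S[OF that]] has_derivative_linear by blast
    have 3: "(\<lambda>c. f'' (x + s *\<^sub>R v + t *\<^sub>R w) (c *\<^sub>R w)) = (*) (f'' (x + s *\<^sub>R v + t *\<^sub>R w) w)"
      by (simp add: fun_eq_iff linear_cmul[OF 2] mult.commute)
    show ?thesis
      using has_derivative_compose[OF 1 f''[OF S[OF that]]] unfolding 3 has_field_derivative_def .
  qed
  define F where "F = (\<lambda>s. f (x + s *\<^sub>R v + h *\<^sub>R w) - f (x + s *\<^sub>R v + 0 *\<^sub>R w))"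
  define F' where "F' = (\<lambda>s. f' (x + s *\<^sub>R v + h *\<^sub>R w) v - f' (x + s *\<^sub>R v + 0 *\<^sub>R w) v)"
  have "DERIV F s :> F' s" if "0 \<le> s" "s \<le> h" for s
    unfolding F_def F'_def by (intro DERIV_diff D) (use that h in auto)
  from MVT2[OF h this] obtain s where s: "0 < s" "s < h" "F h - F 0 = (h - 0) * F' s" by blast
  define K where "K = (\<lambda>t. f' (x + s *\<^sub>R v + t *\<^sub>R w) v)"
  define K' where "K' = (\<lambda>t. f'' (x + s *\<^sub>R v + t *\<^sub>R w) w)"
  have "DERIV K t :> K' t" if "0 \<le> t" "t \<le> h" for t
    unfolding K_def K'_def by (intro D2) (use that s in auto)
  from MVT2[OF h this] obtain t where t: "0 < t" "t < h" "K h - K 0 = (h - 0) * K' t" by blast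
  have "F' s = h * K' t" using t(3) by (simp add: F'_def K_def)
  then have "F h - F 0 = h * h * K' t" using s(3) by simp
  show ?thesis
    using s(1,2) t(1,2) \<open>F h - F 0 = h * h * K' t\<close>
    by (intro bexI[of _ s] bexI[of _ t]) (auto simp: F_def K'_def)
qed

text \<open>The second difference is symmetric in \<open>v\<close> and \<open>w\<close>, yet equals
  \<open>h * h\<close> times either mixed derivative at some point near \<open>x\<close>. If the
  mixed derivatives differed at \<open>x\<close>, continuity would keep them apart on a small
  ball.\<close>

lemma second_derivative_symmetric:
  fixes f :: "'a::real_normed_vector \<Rightarrow> real"
  assumes S: "open S" and f: "smooth_on S f" and x: "x \<in> S"
  shows "frechet_derivative (\<lambda>y. frechet_derivative f (at y) v) (at x) w =
    frechet_derivative (\<lambda>y. frechet_derivative f (at y) w) (at x) v"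
proof (rule ccontr)
  define D where "D v w y = frechet_derivative (\<lambda>y. frechet_derivative f (at y) v) (at y) w" for v w y
  assume "\<not> ?thesis"
  then have ne: "D v w x \<noteq> D w v x" by (simp add: D_def)
  define e where "e = \<bar>D v w x - D w v x\<bar> / 2"
  have e: "e > 0" using ne by (simp add: e_def)
  have "continuous_on S (D a b)" for a b
    unfolding D_def by (rule smooth_on_imp_continuous_on[OF smooth_on_frechet_derivative[OF smooth_on_frechet_derivative[OF f]]])
  then have cont: "isCont (D a b) x" for a b
    using S x continuous_on_eq_continuous_at by blast
  obtain d1 where d1: "d1 > 0" "\<And>y. dist y x < d1 \<Longrightarrow> \<bar>D v w y - D v w x\<bar> < e"
    using cont[of v w] e unfolding continuous_at_eps_delta dist_real_def by blast
  obtain d2 where d2: "d2 > 0" "\<And>y. dist y x < d2 \<Longrightarrow> \<bar>D w v y - D w v x\<bar> < e"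
    using cont[of w v] e unfolding continuous_at_eps_delta dist_real_def by blast
  obtain d3 where d3: "d3 > 0" "\<And>y. dist y x < d3 \<Longrightarrow> y \<in> S"
    using S x by (auto simp: open_dist)
  define d where "d = min d1 (min d2 d3)"
  \<comment> \<open>The summand 1 keeps \<open>N\<close> positive even if both vectors vanish. With
    \<open>h = d / (2 * N)\<close> the whole parallelogram lies within distance \<open>d / 2\<close>
    of \<open>x\<close>.\<close>
  define N where "N = norm v + norm w + 1"
  define h where "h = d / (2 * N)"
  have pos: "N > 0" unfolding N_def by (smt (verit) norm_ge_zero)
  have d: "d > 0" using d1 d2 d3 by (simp add: d_def)
  have h: "h > 0" using d pos by (simp add: h_def)
  have small: "dist (x + s *\<^sub>R a + t *\<^sub>R b) x < d"
    if "s \<in> {0..h}" "t \<in> {0..h}" "(a, b) = (v, w) \<or> (a, b) = (w, v)" for s t a b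
  proof -
    have "norm (s *\<^sub>R a + t *\<^sub>R b) \<le> s * norm a + t * norm b"
      using that norm_triangle_ineq[of "s *\<^sub>R a" "t *\<^sub>R b"] by simp
    also have "\<dots> \<le> h * norm a + h * norm b"
      using that by (intro add_mono mult_right_mono) auto
    also have "\<dots> \<le> h * N"
      using that(3) h by (auto simp: N_def algebra_simps)
    also have "\<dots> = d / 2" using pos by (simp add: h_def)
    also have "\<dots> < d" using d by simp
    finally show ?thesis by (simp add: dist_norm add.assoc)
  qed
  have mv: "\<exists>s\<in>{0<..<h}. \<exists>t\<in>{0<..<h}.
    f (x + h *\<^sub>R a + h *\<^sub>R b) - f (x + h *\<^sub>R a) - f (x + h *\<^sub>R b) + f x = h * h * D a b (x + s *\<^sub>R a + t *\<^sub>R b)"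
    if ab: "(a, b) = (v, w) \<or> (a, b) = (w, v)" for a b
    unfolding D_def
  proof (rule second_difference_mean_value[where S = S])
    show "x + s *\<^sub>R a + t *\<^sub>R b \<in> S" if "s \<in> {0..h}" "t \<in> {0..h}" for s t
      using small[OF that ab] d3 by (simp add: d_def)
    show "(f has_derivative frechet_derivative f (at y)) (at y)" if "y \<in> S" for y
      by (rule smooth_on_has_derivative[OF f that])
    show "((\<lambda>y. frechet_derivative f (at y) a) has_derivative
      frechet_derivative (\<lambda>y. frechet_derivative f (at y) a) (at y)) (at y)" if "y \<in> S" for y
      by (rule smooth_on_has_derivative[OF smooth_on_frechet_derivative[OF f] that])
  qed (rule h)
  obtain s t where 1: "s \<in> {0<..<h}" "t \<in> {0<..<h}"
    "f (x + h *\<^sub>R v + h *\<^sub>R w) - f (x + h *\<^sub>R v) - f (x + h *\<^sub>R w) + f x = h * h * D v w (x + s *\<^sub>R v + t *\<^sub>R w)"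
    using mv[of v w] by blast
  obtain s' t' where 2: "s' \<in> {0<..<h}" "t' \<in> {0<..<h}"
    "f (x + h *\<^sub>R w + h *\<^sub>R v) - f (x + h *\<^sub>R w) - f (x + h *\<^sub>R v) + f x = h * h * D w v (x + s' *\<^sub>R w + t' *\<^sub>R v)"
    using mv[of w v] by blast
  have "x + h *\<^sub>R w + h *\<^sub>R v = x + h *\<^sub>R v + h *\<^sub>R w" by simp
  then have "f (x + h *\<^sub>R w + h *\<^sub>R v) = f (x + h *\<^sub>R v + h *\<^sub>R w)" by (rule arg_cong)
  with 1(3) 2(3) have "h * h * D v w (x + s *\<^sub>R v + t *\<^sub>R w) = h * h * D w v (x + s' *\<^sub>R w + t' *\<^sub>R v)"
    by linarith
  then have eq: "D v w (x + s *\<^sub>R v + t *\<^sub>R w) = D w v (x + s' *\<^sub>R w + t' *\<^sub>R v)"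
    using h by simp
  have "\<bar>D v w (x + s *\<^sub>R v + t *\<^sub>R w) - D v w x\<bar> < e"
    using small[of s t v w] 1 by (intro d1) (simp add: d_def)
  moreover have "\<bar>D w v (x + s' *\<^sub>R w + t' *\<^sub>R v) - D w v x\<bar> < e"
    using small[of s' t' w v] 2 by (intro d2) (simp add: d_def)
  ultimately show False using eq unfolding e_def
    by (simp add: abs_if field_simps split: if_splits)
qed

subsection \<open>Manifolds with a single chart\<close>

text \<open>The notion of exponentiation prescribes the type of the elements of the groups. A group
  living in an open subset of \<open>'e\<close> is moved there by \<open>\<kappa>\<close>; the
  continuous left inverse \<open>\<kappa>'\<close> makes the subspace topology on the image the
  right one and serves as the chart.\<close>

definition chart_embedding :: "('e::topological_space \<Rightarrow> 'p::topological_space) \<Rightarrow> ('p \<Rightarrow> 'e) \<Rightarrow> bool"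
  where "chart_embedding \<kappa> \<kappa>' \<longleftrightarrow>
    continuous_on UNIV \<kappa> \<and> continuous_on UNIV \<kappa>' \<and> (\<forall>x. \<kappa>' (\<kappa> x) = x)"

definition one_chart :: "'e::topological_space set \<Rightarrow> ('e \<Rightarrow> 'p::topological_space) \<Rightarrow> ('p \<Rightarrow> 'e) \<Rightarrow> ('p, 'e) manifold"
  where "one_chart U \<kappa> \<kappa>' = \<lparr>topo = top_of_set (\<kappa> ` U), atlas = {(\<kappa> ` U, \<kappa>')}\<rparr>"

lemma one_chart_simps [simp]:
  "topo (one_chart U \<kappa> \<kappa>') = top_of_set (\<kappa> ` U)" "atlas (one_chart U \<kappa> \<kappa>') = {(\<kappa> ` U, \<kappa>')}"
  by (simp_all add: one_chart_def)

lemma chart_embedding_inv_into: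
  assumes "chart_embedding \<kappa> \<kappa>'" "x \<in> U"
  shows "inv_into (\<kappa> ` U) \<kappa>' x = \<kappa> x"
  using assms by (intro inv_into_f_eq) (auto simp: chart_embedding_def inj_on_def)

lemma chart_embedding_image: "chart_embedding \<kappa> \<kappa>' \<Longrightarrow> \<kappa>' ` \<kappa> ` U = U"
  by (auto simp: chart_embedding_def image_image)

lemma continuous_on_map_prod:
  assumes "continuous_on UNIV f" "continuous_on UNIV g"
  shows "continuous_on UNIV (map_prod f g)"
  unfolding map_prod_def case_prod_beta
  by (intro continuous_on_Pair continuous_on_compose2[OF assms(1)] continuous_on_compose2[OF assms(2)]
      continuous_intros) auto

lemma chart_embedding_map_prod:
  "chart_embedding \<kappa> \<kappa>' \<Longrightarrow> chart_embedding l l' \<Longrightarrow> chart_embedding (map_prod \<kappa> l) (map_prod \<kappa>' l')"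
  by (auto simp: chart_embedding_def continuous_on_map_prod)

lemma prod_manifold_one_chart:
  "prod_manifold (one_chart U \<kappa> \<kappa>') (one_chart V l l') = one_chart (U \<times> V) (map_prod \<kappa> l) (map_prod \<kappa>' l')"
proof -
  have "map_prod \<kappa> l ` (U \<times> V) = \<kappa> ` U \<times> l ` V" by (auto simp: image_iff)
  then show ?thesis
    unfolding prod_manifold_def by (simp add: one_chart_def prod_topology_subtopology_eu)
qed

lemma model_manifold_one_chart: "model_manifold = one_chart UNIV id id"
  by (simp add: model_manifold_def one_chart_def)

lemma chart_embedding_id: "chart_embedding id id"
  by (simp add: chart_embedding_def)

text \<open>Continuity comes for free from smoothness in coordinates: on the image of
  \<open>\<kappa>\<close>, the map \<open>f\<close> is \<open>l\<close> after its coordinate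
  expression after \<open>\<kappa>'\<close>.\<close>

lemma smooth_map_one_chart:
  assumes U: "open U" and \<kappa>: "chart_embedding \<kappa> \<kappa>'" and l: "chart_embedding l l'"
  shows "smooth_map (one_chart U \<kappa> \<kappa>') (one_chart V l l') f \<longleftrightarrow>
    (\<forall>x\<in>U. f (\<kappa> x) \<in> l ` V) \<and> smooth_on U (\<lambda>x. l' (f (\<kappa> x)))" (is "?L \<longleftrightarrow> ?R")
proof
  assume ?L
  then have cont: "continuous_map (top_of_set (\<kappa> ` U)) (top_of_set (l ` V)) f"
    and sm: "smooth_on (\<kappa>' ` (\<kappa> ` U \<inter> f -` l ` V)) (l' \<circ> f \<circ> inv_into (\<kappa> ` U) \<kappa>')"
    by (auto simp: smooth_map_def)
  from cont have *: "f (\<kappa> x) \<in> l ` V" if "x \<in> U" for x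
    using that by (auto simp: continuous_map_def)
  then have "\<kappa> ` U \<inter> f -` l ` V = \<kappa> ` U" by auto
  with sm have "smooth_on U (l' \<circ> f \<circ> inv_into (\<kappa> ` U) \<kappa>')"
    by (simp add: chart_embedding_image[OF \<kappa>])
  then have "smooth_on U (\<lambda>x. l' (f (\<kappa> x)))"
    by (rule smooth_on_cong[OF U, rotated]) (simp add: chart_embedding_inv_into[OF \<kappa>])
  with * show ?R by blast
next
  assume R: ?R
  have "continuous_on (\<kappa> ` U) f"
  proof -
    have "continuous_on U (\<lambda>x. l' (f (\<kappa> x)))" using R smooth_on_imp_continuous_on by blast
    moreover have "continuous_on (\<kappa> ` U) \<kappa>'" using \<kappa> continuous_on_subset chart_embedding_def by blast
    ultimately have "continuous_on (\<kappa> ` U) (\<lambda>y. l' (f (\<kappa> (\<kappa>' y))))"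
      by (rule continuous_on_compose2) (simp add: chart_embedding_image[OF \<kappa>])
    then have "continuous_on (\<kappa> ` U) (\<lambda>y. l (l' (f (\<kappa> (\<kappa>' y)))))"
      using l by (intro continuous_on_compose2[of UNIV l _ "\<lambda>y. l' (f (\<kappa> (\<kappa>' y)))"]) (auto simp: chart_embedding_def)
    moreover have "l (l' (f (\<kappa> (\<kappa>' y)))) = f y" if y: "y \<in> \<kappa> ` U" for y
    proof -
      obtain x where x: "x \<in> U" "y = \<kappa> x" using y by blast
      obtain z where "f (\<kappa> x) = l z" using R x by blast
      then show ?thesis using x \<kappa> l by (simp add: chart_embedding_def)
    qed
    ultimately show ?thesis using continuous_on_cong by (metis (no_types, lifting))
  qed
  then have "continuous_map (top_of_set (\<kappa> ` U)) (top_of_set (l ` V)) f"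
    using R by auto
  moreover have "\<kappa> ` U \<inter> f -` l ` V = \<kappa> ` U" using R by auto
  moreover have "smooth_on U (l' \<circ> f \<circ> inv_into (\<kappa> ` U) \<kappa>')"
    by (rule smooth_on_cong[OF U _ conjunct2[OF R]]) (simp add: chart_embedding_inv_into[OF \<kappa>])
  ultimately show ?L
    by (simp add: smooth_map_def chart_embedding_image[OF \<kappa>])
qed

lemma smooth_manifold_one_chart:
  fixes \<kappa> :: "'e::euclidean_space \<Rightarrow> 'p::euclidean_space"
  assumes U: "open U" and \<kappa>: "chart_embedding \<kappa> \<kappa>'"
  shows "smooth_manifold (one_chart U \<kappa> \<kappa>')"
proof -
  obtain B :: "'p set set" where B: "countable B" "topological_basis B"
    using ex_countable_basis by blast
  let ?B = "(\<lambda>V. \<kappa> ` U \<inter> V) ` B"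
  have "\<forall>V\<in>?B. openin (top_of_set (\<kappa> ` U)) V"
    using B(2) by (auto simp: topological_basis_open intro!: openin_open_Int)
  moreover have "\<exists>V\<in>?B. x \<in> V \<and> V \<subseteq> W" if W: "openin (top_of_set (\<kappa> ` U)) W" "x \<in> W" for W x
  proof -
    obtain T where T: "open T" "W = \<kappa> ` U \<inter> T" using W(1) by (auto simp: openin_open)
    then obtain V where "V \<in> B" "x \<in> V" "V \<subseteq> T" using W(2) B(2) topological_basisE by (metis IntE)
    then show ?thesis using T W(2) by (intro bexI[of _ "\<kappa> ` U \<inter> V"]) auto
  qed
  ultimately have base: "\<exists>B. countable B \<and> (\<forall>V\<in>B. openin (top_of_set (\<kappa> ` U)) V) \<and>
      (\<forall>W x. openin (top_of_set (\<kappa> ` U)) W \<and> x \<in> W \<longrightarrow> (\<exists>V\<in>B. x \<in> V \<and> V \<subseteq> W))"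
    using B(1) by (intro exI[of _ ?B]) auto
  have "continuous_on (\<kappa> ` U) \<kappa>'" "continuous_on U \<kappa>"
    using \<kappa> continuous_on_subset unfolding chart_embedding_def by blast+
  then have "homeomorphic_maps (top_of_set (\<kappa> ` U)) (top_of_set U) \<kappa>' \<kappa>"
    using \<kappa> by (auto simp: homeomorphic_maps_def chart_embedding_def)
  then have hom: "homeomorphic_map (top_of_set (\<kappa> ` U)) (top_of_set U) \<kappa>'"
    by (rule homeomorphic_maps_imp_map)
  have sm: "smooth_on U (\<kappa>' \<circ> inv_into (\<kappa> ` U) \<kappa>')"
    by (rule smooth_on_cong[OF U _ smooth_on_ident[OF U]])
       (use \<kappa> in \<open>simp add: chart_embedding_inv_into chart_embedding_def\<close>)
  have "Hausdorff_space (top_of_set (\<kappa> ` U))"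
    by (simp add: Hausdorff_space_subtopology)
  then show ?thesis
    using base hom sm U by (simp add: smooth_manifold_def chart_embedding_image[OF \<kappa>] subtopology_subtopology)
qed

lemma smooth_functions_one_chart:
  assumes "open U" "chart_embedding \<kappa> \<kappa>'"
  shows "smooth_functions (one_chart U \<kappa> \<kappa>') =
    {f. smooth_on U (\<lambda>x. f (\<kappa> x)) \<and> (\<forall>x. x \<notin> \<kappa> ` U \<longrightarrow> f x = 0)}"
  unfolding smooth_functions_def model_manifold_one_chart
  by (auto simp: smooth_map_one_chart[OF assms chart_embedding_id])

lemma smooth_on_directional_derivative:
  fixes F :: "'a::euclidean_space \<Rightarrow> 'b::euclidean_space"
  assumes U: "open U" and F: "smooth_on U F" and W: "smooth_on U W"
  shows "smooth_on U (\<lambda>p. frechet_derivative F (at p) (W p))"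
proof -
  have "smooth_on U (\<lambda>p. \<Sum>b\<in>Basis. (W p \<bullet> b) *\<^sub>R frechet_derivative F (at p) b)"
    by (intro smooth_on_sum smooth_on_scaleR smooth_on_inner smooth_on_const
        smooth_on_frechet_derivative U F W)
  then show ?thesis
    by (rule smooth_on_cong[OF U, rotated])
       (metis linear_basis_expansion linear_frechet_derivative smooth_on_differentiable[OF F])
qed

text \<open>The Leibniz rule gives one term with the derivative of \<open>W\<close> and one with
  second derivatives of \<open>F\<close>. Symmetry is used to bring \<open>W p\<close> into the
  outer slot of the latter, the form in which such terms cancel in a commutator of vector
  fields.\<close>

lemma directional_derivative_of_directional_derivative:
  fixes F :: "'a::euclidean_space \<Rightarrow> real"
  assumes U: "open U" and F: "smooth_on U F" and W: "smooth_on U W" and p: "p \<in> U"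
  shows "frechet_derivative (\<lambda>q. frechet_derivative F (at q) (W q)) (at p) u =
    frechet_derivative F (at p) (frechet_derivative W (at p) u)
      + frechet_derivative (\<lambda>q. frechet_derivative F (at q) u) (at p) (W p)"
proof -
  let ?F' = "\<lambda>q. frechet_derivative F (at q)" and ?W' = "frechet_derivative W (at p)"
  let ?F'' = "\<lambda>b. frechet_derivative (\<lambda>q. ?F' q b) (at p)"
  have lin: "linear (?F' q)" if "q \<in> U" for q
    using linear_frechet_derivative smooth_on_differentiable[OF F that] by blast
  have lin2: "linear (?F'' b)" for b
    using linear_frechet_derivative smooth_on_differentiable[OF smooth_on_frechet_derivative[OF F] p] by blast
  have "((\<lambda>q. \<Sum>b\<in>Basis. (W q \<bullet> b) *\<^sub>R ?F' q b) has_derivative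
      (\<lambda>u. \<Sum>b\<in>Basis. (W p \<bullet> b) *\<^sub>R ?F'' b u + (?W' u \<bullet> b) *\<^sub>R ?F' p b)) (at p)"
    by (intro has_derivative_sum bounded_bilinear.FDERIV[OF bounded_bilinear_scaleR]
        bounded_linear.has_derivative[OF bounded_linear_inner_left]
        smooth_on_has_derivative[OF W p] smooth_on_has_derivative[OF smooth_on_frechet_derivative[OF F] p])
  then have "((\<lambda>q. ?F' q (W q)) has_derivative
      (\<lambda>u. \<Sum>b\<in>Basis. (W p \<bullet> b) *\<^sub>R ?F'' b u + (?W' u \<bullet> b) *\<^sub>R ?F' p b)) (at p)"
    by (rule has_derivative_transform_within_open[OF _ U p])
       (rule linear_basis_expansion[OF lin, symmetric])
  then have "frechet_derivative (\<lambda>q. ?F' q (W q)) (at p) u =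
      (\<Sum>b\<in>Basis. (W p \<bullet> b) *\<^sub>R ?F'' b u) + (\<Sum>b\<in>Basis. (?W' u \<bullet> b) *\<^sub>R ?F' p b)"
    by (simp add: frechet_derivative_at[symmetric] sum.distrib)
  also have "(\<Sum>b\<in>Basis. (W p \<bullet> b) *\<^sub>R ?F'' b u) = (\<Sum>b\<in>Basis. (W p \<bullet> b) *\<^sub>R ?F'' u b)"
    using second_derivative_symmetric[OF U F p] by simp
  also have "\<dots> = ?F'' u (W p)"
    by (rule linear_basis_expansion[OF lin2, symmetric])
  also have "(\<Sum>b\<in>Basis. (?W' u \<bullet> b) *\<^sub>R ?F' p b) = ?F' p (?W' u)"
    by (rule linear_basis_expansion[OF lin[OF p], symmetric])
  finally show ?thesis by simp
qed

subsection \<open>Lie groups with a single chart\<close>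

text \<open>The group is an open subset of the Euclidean space itself with smooth operations. All
  computations take place there; \<open>\<kappa>\<close> only transports the result.\<close>

locale chart_group = group G for G :: "'e::euclidean_space monoid" (structure) +
  fixes \<kappa> :: "'e \<Rightarrow> 'p::euclidean_space" and \<kappa>' :: "'p \<Rightarrow> 'e"
  assumes open_carrier: "open (carrier G)"
    and smooth_mult: "smooth_on (carrier G \<times> carrier G) (\<lambda>p. fst p \<otimes> snd p)"
    and smooth_inv: "smooth_on (carrier G) (\<lambda>x. inv x)"
    and emb: "chart_embedding \<kappa> \<kappa>'"
begin

abbreviation "U \<equiv> carrier G"

definition pushed :: "'p monoid"
  where "pushed = \<lparr>carrier = \<kappa> ` U, mult = (\<lambda>x y. \<kappa> (\<kappa>' x \<otimes> \<kappa>' y)), one = \<kappa> \<one>\<rparr>"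

abbreviation "mfd \<equiv> one_chart U \<kappa> \<kappa>'"

lemma \<kappa>'_\<kappa> [simp]: "\<kappa>' (\<kappa> x) = x"
  using emb by (simp add: chart_embedding_def)

lemma \<kappa>_eq_iff [simp]: "\<kappa> x = \<kappa> y \<longleftrightarrow> x = y"
  by (metis \<kappa>'_\<kappa>)

lemma pushed_simps [simp]:
  "carrier pushed = \<kappa> ` U" "\<one>\<^bsub>pushed\<^esub> = \<kappa> \<one>" "\<kappa> x \<otimes>\<^bsub>pushed\<^esub> \<kappa> y = \<kappa> (x \<otimes> y)"
  by (simp_all add: pushed_def)

lemma group_pushed: "group pushed"
proof (rule groupI)
  fix x assume "x \<in> carrier pushed"
  then obtain p where "p \<in> U" "x = \<kappa> p" by auto
  then show "\<exists>y\<in>carrier pushed. y \<otimes>\<^bsub>pushed\<^esub> x = \<one>\<^bsub>pushed\<^esub>"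
    by (intro bexI[of _ "\<kappa> (inv p)"]) auto
qed (auto simp: m_assoc)

lemma inv_pushed: "x \<in> U \<Longrightarrow> inv\<^bsub>pushed\<^esub> (\<kappa> x) = \<kappa> (inv x)"
  by (intro group.inv_equality[OF group_pushed]) auto

lemma lie_group_pushed: "lie_group pushed mfd"
proof -
  have "smooth_map (prod_manifold mfd mfd) mfd (\<lambda>(x, y). x \<otimes>\<^bsub>pushed\<^esub> y)"
    unfolding prod_manifold_one_chart
    by (subst smooth_map_one_chart)
       (use smooth_mult in \<open>auto simp: open_Times open_carrier chart_embedding_map_prod emb case_prod_beta\<close>)
  moreover have "smooth_map mfd mfd (\<lambda>x. inv\<^bsub>pushed\<^esub> x)"
  proof (subst smooth_map_one_chart[OF open_carrier emb emb], intro conjI ballI)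
    show "inv\<^bsub>pushed\<^esub> \<kappa> x \<in> \<kappa> ` U" if "x \<in> U" for x
      using that by (simp add: inv_pushed)
    show "smooth_on U (\<lambda>x. \<kappa>' (inv\<^bsub>pushed\<^esub> \<kappa> x))"
      by (rule smooth_on_cong[OF open_carrier _ smooth_inv]) (simp add: inv_pushed)
  qed
  ultimately show ?thesis
    by (simp add: lie_group_def group_pushed smooth_manifold_one_chart[OF open_carrier emb])
qed

abbreviation "SF \<equiv> smooth_functions mfd"

lemma mem_SF: "f \<in> SF \<longleftrightarrow> smooth_on U (\<lambda>x. f (\<kappa> x)) \<and> (\<forall>x. x \<notin> \<kappa> ` U \<longrightarrow> f x = 0)"
  by (simp add: smooth_functions_one_chart[OF open_carrier emb])

section \<open>Left-invariant vector fields and the Lie algebra of a one-chart group\<close>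

definition left_field :: "'e \<Rightarrow> 'e \<Rightarrow> 'e"
  where "left_field v p = frechet_derivative (\<lambda>q. p \<otimes> q) (at \<one>) v"

lemma has_derivative_left_mult:
  assumes "p \<in> U" "q \<in> U"
  shows "((\<lambda>q. p \<otimes> q) has_derivative
    (\<lambda>v. frechet_derivative (\<lambda>z. fst z \<otimes> snd z) (at (p, q)) (0, v))) (at q)"
proof -
  have "((\<lambda>q. (p, q)) has_derivative (\<lambda>v. (0, v))) (at q)"
    by (auto intro!: derivative_eq_intros)
  from has_derivative_compose[OF this, of "\<lambda>z. fst z \<otimes> snd z"] show ?thesis
    using smooth_on_has_derivative[OF smooth_mult, of "(p, q)"] assms by simp
qed

lemma left_mult_differentiable: "p \<in> U \<Longrightarrow> q \<in> U \<Longrightarrow> (\<lambda>q. p \<otimes> q) differentiable (at q)"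
  using has_derivative_left_mult unfolding differentiable_def by blast

lemma left_field_eq:
  assumes "p \<in> U"
  shows "left_field v p = frechet_derivative (\<lambda>z. fst z \<otimes> snd z) (at (p, \<one>)) (0, v)"
  unfolding left_field_def
  using frechet_derivative_at[OF has_derivative_left_mult[OF assms one_closed]] by metis

lemma smooth_on_left_mult: "g \<in> U \<Longrightarrow> smooth_on U (\<lambda>q. g \<otimes> q)"
  using smooth_on_compose[OF open_carrier open_Times[OF open_carrier open_carrier] smooth_mult, of "\<lambda>q. (g, q)"]
  by (simp add: smooth_on_Pair smooth_on_const smooth_on_ident open_carrier)

lemma smooth_left_field: "smooth_on U (left_field v)"
proof -
  have "smooth_on U (\<lambda>p. frechet_derivative (\<lambda>z. fst z \<otimes> snd z) (at (p, \<one>)) (0, v))"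
    by (rule smooth_on_compose[OF open_carrier open_Times[OF open_carrier open_carrier]
          smooth_on_frechet_derivative[OF smooth_mult], where f = "\<lambda>p. (p, \<one>)"])
       (auto simp: smooth_on_Pair smooth_on_const smooth_on_ident open_carrier)
  then show ?thesis
    by (rule smooth_on_cong[OF open_carrier, rotated]) (simp add: left_field_eq)
qed

lemma linear_left_field: "p \<in> U \<Longrightarrow> linear (\<lambda>v. left_field v p)"
  unfolding left_field_def using left_mult_differentiable[of p \<one>] linear_frechet_derivative by auto

lemma left_field_one: "left_field v \<one> = v"
proof -
  have "((\<lambda>q. q) has_derivative (\<lambda>v. v)) (at \<one>)" by simp
  then have "((\<lambda>q. \<one> \<otimes> q) has_derivative (\<lambda>v. v)) (at \<one>)"
    by (rule has_derivative_transform_within_open[OF _ open_carrier one_closed]) simp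
  then show ?thesis unfolding left_field_def by (simp add: frechet_derivative_at[symmetric])
qed

text \<open>Associativity, differentiated in \<open>q\<close> at the identity: both
  \<open>g (p q)\<close> and \<open>(g p) q\<close> have the same derivative.\<close>

lemma left_field_translate:
  assumes g: "g \<in> U" and p: "p \<in> U"
  shows "frechet_derivative (\<lambda>q. g \<otimes> q) (at p) (left_field v p) = left_field v (g \<otimes> p)"
proof -
  have 1: "((\<lambda>q. p \<otimes> q) has_derivative (\<lambda>v. left_field v p)) (at \<one>)"
    unfolding left_field_def using left_mult_differentiable[OF p one_closed] frechet_derivative_works by auto
  have 2: "((\<lambda>q. g \<otimes> q) has_derivative frechet_derivative (\<lambda>q. g \<otimes> q) (at p)) (at (p \<otimes> \<one>))"
    using left_mult_differentiable[OF g p] frechet_derivative_works p by auto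
  have "((\<lambda>q. g \<otimes> (p \<otimes> q)) has_derivative
      (\<lambda>v. frechet_derivative (\<lambda>q. g \<otimes> q) (at p) (left_field v p))) (at \<one>)"
    by (rule has_derivative_compose[OF 1 2])
  then have "((\<lambda>q. (g \<otimes> p) \<otimes> q) has_derivative
      (\<lambda>v. frechet_derivative (\<lambda>q. g \<otimes> q) (at p) (left_field v p))) (at \<one>)"
    by (rule has_derivative_transform_within_open[OF _ open_carrier one_closed]) (simp add: g p m_assoc)
  then show ?thesis unfolding left_field_def[of _ "g \<otimes> p"] by (metis frechet_derivative_at)
qed

text \<open>The default value 0 follows the conventions in \<open>vector_field\<close>, so that
  operators which agree on smooth functions are equal.\<close>

definition field_op :: "'e \<Rightarrow> ('p \<Rightarrow> real) \<Rightarrow> 'p \<Rightarrow> real"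
  where "field_op v = (\<lambda>f x. if f \<in> SF \<and> x \<in> \<kappa> ` U
    then frechet_derivative (\<lambda>q. f (\<kappa> q)) (at (\<kappa>' x)) (left_field v (\<kappa>' x)) else 0)"

lemma field_op_apply:
  "f \<in> SF \<Longrightarrow> p \<in> U \<Longrightarrow> field_op v f (\<kappa> p) = frechet_derivative (\<lambda>q. f (\<kappa> q)) (at p) (left_field v p)"
  by (simp add: field_op_def)

lemma field_op_one:
  "f \<in> SF \<Longrightarrow> field_op v f (\<kappa> \<one>) = frechet_derivative (\<lambda>q. f (\<kappa> q)) (at \<one>) v"
  by (simp add: field_op_apply left_field_one)

lemma frechet_derivative_inv_into:
  "p \<in> U \<Longrightarrow> frechet_derivative (f \<circ> inv_into (\<kappa> ` U) \<kappa>') (at p) = frechet_derivative (\<lambda>q. f (\<kappa> q)) (at p)"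
  if "f \<in> SF"
proof -
  assume p: "p \<in> U"
  have "((\<lambda>q. f (\<kappa> q)) has_derivative frechet_derivative (\<lambda>q. f (\<kappa> q)) (at p)) (at p)"
    using that p by (auto simp: mem_SF intro: smooth_on_has_derivative)
  then have "(f \<circ> inv_into (\<kappa> ` U) \<kappa>' has_derivative frechet_derivative (\<lambda>q. f (\<kappa> q)) (at p)) (at p)"
    by (rule has_derivative_transform_within_open[OF _ open_carrier p])
       (simp add: chart_embedding_inv_into[OF emb])
  then show ?thesis by (rule frechet_derivative_at[symmetric])
qed

lemma vector_field_one_chart:
  "vector_field mfd D \<longleftrightarrow> (\<forall>f. f \<notin> SF \<longrightarrow> D f = 0) \<and> (\<forall>f x. x \<notin> \<kappa> ` U \<longrightarrow> D f x = 0) \<and>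
    (\<exists>V. smooth_on U V \<and> (\<forall>f\<in>SF. \<forall>p\<in>U. D f (\<kappa> p) = frechet_derivative (\<lambda>q. f (\<kappa> q)) (at p) (V p)))"
  by (simp add: vector_field_def chart_embedding_image[OF emb] frechet_derivative_inv_into)

lemma left_translate_apply:
  "g \<in> U \<Longrightarrow> p \<in> U \<Longrightarrow> left_translate pushed (\<kappa> g) f (\<kappa> p) = f (\<kappa> (g \<otimes> p))"
  by (simp add: left_translate_def)

lemma left_translate_SF:
  assumes "g \<in> U" "f \<in> SF"
  shows "left_translate pushed (\<kappa> g) f \<in> SF"
proof -
  have "smooth_on U (\<lambda>x. f (\<kappa> (g \<otimes> x)))"
    using smooth_on_compose[OF open_carrier open_carrier _ smooth_on_left_mult[OF assms(1)], of "\<lambda>x. f (\<kappa> x)"] assms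
    by (simp add: mem_SF)
  then have "smooth_on U (\<lambda>x. left_translate pushed (\<kappa> g) f (\<kappa> x))"
    by (rule smooth_on_cong[OF open_carrier, rotated]) (simp add: left_translate_apply assms)
  then show ?thesis by (auto simp: mem_SF left_translate_def)
qed

lemma frechet_derivative_left_translate:
  assumes g: "g \<in> U" and f: "f \<in> SF" and p: "p \<in> U"
  shows "frechet_derivative (\<lambda>q. left_translate pushed (\<kappa> g) f (\<kappa> q)) (at p) (left_field v p) =
    frechet_derivative (\<lambda>q. f (\<kappa> q)) (at (g \<otimes> p)) (left_field v (g \<otimes> p))"
proof -
  have 1: "((\<lambda>q. g \<otimes> q) has_derivative frechet_derivative (\<lambda>q. g \<otimes> q) (at p)) (at p)"
    using left_mult_differentiable[OF g p] frechet_derivative_works by auto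
  have 2: "((\<lambda>q. f (\<kappa> q)) has_derivative frechet_derivative (\<lambda>q. f (\<kappa> q)) (at (g \<otimes> p))) (at (g \<otimes> p))"
    using f g p by (auto simp: mem_SF intro: smooth_on_has_derivative)
  have "((\<lambda>q. left_translate pushed (\<kappa> g) f (\<kappa> q)) has_derivative
     (\<lambda>u. frechet_derivative (\<lambda>q. f (\<kappa> q)) (at (g \<otimes> p)) (frechet_derivative (\<lambda>q. g \<otimes> q) (at p) u))) (at p)"
    by (rule has_derivative_transform_within_open[OF has_derivative_compose[OF 1 2] open_carrier p])
       (simp add: left_translate_apply g)
  from frechet_derivative_at[OF this, symmetric] show ?thesis
    by (simp add: left_field_translate[OF g p])
qed

lemma field_op_Lie: "field_op v \<in> Lie pushed mfd"
proof -
  have "vector_field mfd (field_op v)"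
    unfolding vector_field_one_chart
    by (auto simp: field_op_apply fun_eq_iff field_op_def smooth_left_field intro!: exI[of _ "left_field v"])
  moreover have "field_op v (left_translate pushed (\<kappa> g) f) x = left_translate pushed (\<kappa> g) (field_op v f) x"
    if g: "g \<in> U" and f: "f \<in> SF" for g f x
  proof (cases "x \<in> \<kappa> ` U")
    case True
    then obtain p where "p \<in> U" "x = \<kappa> p" by auto
    then show ?thesis
      using f g by (simp add: field_op_apply left_translate_SF frechet_derivative_left_translate left_translate_apply)
  qed (simp add: field_op_def left_translate_def)
  ultimately show ?thesis
    unfolding Lie_def by (auto simp: fun_eq_iff)
qed

text \<open>By invariance the value of \<open>D f\<close> at \<open>\<kappa> g\<close> is the value
  of \<open>D\<close> on a translate of \<open>f\<close> at the identity, and there only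
  \<open>V\<close> at the identity enters. Thus an invariant operator is determined by one tangent
  vector.\<close>

lemma Lie_memD:
  assumes D: "D \<in> Lie pushed mfd" and V: "\<And>f p. f \<in> SF \<Longrightarrow> p \<in> U \<Longrightarrow>
    D f (\<kappa> p) = frechet_derivative (\<lambda>q. f (\<kappa> q)) (at p) (V p)"
  shows "D = field_op (V \<one>)"
proof (intro ext)
  fix f x
  have v: "vector_field mfd D" using D by (simp add: Lie_def)
  show "D f x = field_op (V \<one>) f x"
  proof (cases "f \<in> SF \<and> x \<in> \<kappa> ` U")
    case True
    then obtain g where g: "g \<in> U" "x = \<kappa> g" by auto
    have f: "f \<in> SF" using True by simp
    have "D f (\<kappa> g) = left_translate pushed (\<kappa> g) (D f) (\<kappa> \<one>)"
      using g by (simp add: left_translate_apply)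
    also have "\<dots> = D (left_translate pushed (\<kappa> g) f) (\<kappa> \<one>)"
      using D f g by (simp add: Lie_def)
    also have "\<dots> = frechet_derivative (\<lambda>q. left_translate pushed (\<kappa> g) f (\<kappa> q)) (at \<one>) (left_field (V \<one>) \<one>)"
      using V[OF left_translate_SF[OF g(1) f] one_closed] by (simp add: left_field_one)
    also have "\<dots> = field_op (V \<one>) f (\<kappa> g)"
      using g f by (simp add: frechet_derivative_left_translate field_op_apply)
    finally show ?thesis using g by simp
  next
    case False
    then show ?thesis using v by (auto simp: vector_field_one_chart field_op_def)
  qed
qed

lemma Lie_eq: "Lie pushed mfd = range field_op"
proof
  show "Lie pushed mfd \<subseteq> range field_op"
  proof
    fix D assume D: "D \<in> Lie pushed mfd"
    then have "vector_field mfd D" by (simp add: Lie_def)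
    then obtain V where "\<And>f p. f \<in> SF \<Longrightarrow> p \<in> U \<Longrightarrow>
        D f (\<kappa> p) = frechet_derivative (\<lambda>q. f (\<kappa> q)) (at p) (V p)"
      unfolding vector_field_one_chart by blast
    from Lie_memD[OF D this] show "D \<in> range field_op" by blast
  qed
qed (use field_op_Lie in auto)

text \<open>These are the global test functions that recover a tangent vector at the identity from
  the operator, componentwise.\<close>

definition coordinate :: "'e \<Rightarrow> 'p \<Rightarrow> real"
  where "coordinate b x = (if x \<in> \<kappa> ` U then \<kappa>' x \<bullet> b else 0)"

lemma coordinate_SF: "coordinate b \<in> SF"
proof -
  have "smooth_on U (\<lambda>x. x \<bullet> b)"
    by (intro smooth_on_inner smooth_on_ident smooth_on_const open_carrier)
  then have "smooth_on U (\<lambda>x. coordinate b (\<kappa> x))"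
    by (rule smooth_on_cong[OF open_carrier, rotated]) (simp add: coordinate_def)
  then show ?thesis by (simp add: mem_SF coordinate_def)
qed

lemma field_op_coordinate: "field_op v (coordinate b) (\<kappa> \<one>) = v \<bullet> b"
proof -
  have "((\<lambda>q. q \<bullet> b) has_derivative (\<lambda>v. v \<bullet> b)) (at \<one>)"
    by (auto intro!: derivative_eq_intros)
  then have "((\<lambda>q. coordinate b (\<kappa> q)) has_derivative (\<lambda>v. v \<bullet> b)) (at \<one>)"
    by (rule has_derivative_transform_within_open[OF _ open_carrier one_closed]) (simp add: coordinate_def)
  then show ?thesis
    by (simp add: field_op_one coordinate_SF frechet_derivative_at[symmetric])
qed

lemma field_op_inject: "field_op v = field_op w \<longleftrightarrow> v = w"
proof
  assume eq: "field_op v = field_op w"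
  show "v = w"
  proof (rule euclidean_eqI)
    show "v \<bullet> b = w \<bullet> b" for b
      using field_op_coordinate[of v b] field_op_coordinate[of w b] unfolding eq by simp
  qed
qed simp

lemma linear_field_op: "linear field_op"
proof -
  have "field_op (a *\<^sub>R v + b *\<^sub>R w) f x = a * field_op v f x + b * field_op w f x" for a b v w f x
  proof (cases "f \<in> SF \<and> x \<in> \<kappa> ` U")
    case True
    then obtain p where p: "p \<in> U" "x = \<kappa> p" and f: "f \<in> SF" by auto
    have lin: "linear (frechet_derivative (\<lambda>q. f (\<kappa> q)) (at p))"
      using f p by (auto simp: mem_SF intro: linear_frechet_derivative smooth_on_differentiable)
    show ?thesis
      using p f
      by (simp add: field_op_apply linear_add[OF lin] linear_cmul[OF lin]
          linear_add[OF linear_left_field[OF p(1)]] linear_cmul[OF linear_left_field[OF p(1)]])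
  qed (auto simp: field_op_def)
  then have *: "field_op (a *\<^sub>R v + b *\<^sub>R w) = a *\<^sub>R field_op v + b *\<^sub>R field_op w" for a b v w
    by (intro ext) (simp add: plus_fun_def scaleR_fun_def)
  show ?thesis
  proof (rule linearI)
    show "field_op (v + w) = field_op v + field_op w" for v w using *[of 1 v 1 w] by simp
    show "field_op (a *\<^sub>R v) = a *\<^sub>R field_op v" for a v using *[of a v 0 v] by simp
  qed
qed

lemma field_op_SF:
  assumes "f \<in> SF"
  shows "field_op v f \<in> SF"
proof -
  have "smooth_on U (\<lambda>p. frechet_derivative (\<lambda>q. f (\<kappa> q)) (at p) (left_field v p))"
    using assms by (intro smooth_on_directional_derivative open_carrier smooth_left_field) (simp add: mem_SF)
  then have "smooth_on U (\<lambda>p. field_op v f (\<kappa> p))"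
    by (rule smooth_on_cong[OF open_carrier, rotated]) (simp add: field_op_apply assms)
  then show ?thesis by (auto simp: mem_SF field_op_def)
qed

definition lie_bracket :: "'e \<Rightarrow> 'e \<Rightarrow> 'e"
  where "lie_bracket v w =
    frechet_derivative (left_field w) (at \<one>) v - frechet_derivative (left_field v) (at \<one>) w"

text \<open>The second order terms of the two compositions cancel by symmetry, leaving the
  derivative along \<open>V\<close>. The commutator inherits left invariance, so by
  \<open>Lie_memD\<close> only the value of \<open>V\<close> at the identity counts, where a
  left-invariant field takes its defining vector as value.\<close>

lemma commutator_field_op: "commutator (field_op v) (field_op w) = field_op (lie_bracket v w)"
proof -
  define V where "V p = frechet_derivative (left_field w) (at p) (left_field v p)
    - frechet_derivative (left_field v) (at p) (left_field w p)" for p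
  have V: "commutator (field_op v) (field_op w) f (\<kappa> p) = frechet_derivative (\<lambda>q. f (\<kappa> q)) (at p) (V p)"
    if f: "f \<in> SF" and p: "p \<in> U" for f p
  proof -
    let ?F = "\<lambda>q. f (\<kappa> q)"
    have F: "smooth_on U ?F" using f by (simp add: mem_SF)
    have lin: "linear (frechet_derivative ?F (at p))"
      using F p by (intro linear_frechet_derivative smooth_on_differentiable)
    have twice: "field_op v (field_op w f) (\<kappa> p) =
        frechet_derivative ?F (at p) (frechet_derivative (left_field w) (at p) (left_field v p))
        + frechet_derivative (\<lambda>q. frechet_derivative ?F (at q) (left_field v p)) (at p) (left_field w p)" for v w
    proof -
      have "((\<lambda>q. frechet_derivative ?F (at q) (left_field w q)) has_derivative
          frechet_derivative (\<lambda>q. frechet_derivative ?F (at q) (left_field w q)) (at p)) (at p)"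
        using smooth_on_has_derivative[OF smooth_on_directional_derivative[OF open_carrier F smooth_left_field] p] .
      then have "((\<lambda>q. field_op w f (\<kappa> q)) has_derivative
          frechet_derivative (\<lambda>q. frechet_derivative ?F (at q) (left_field w q)) (at p)) (at p)"
        by (rule has_derivative_transform_within_open[OF _ open_carrier p]) (simp add: field_op_apply f)
      from frechet_derivative_at[OF this, symmetric] show ?thesis
        by (simp add: field_op_apply[OF field_op_SF[OF f] p]
            directional_derivative_of_directional_derivative[OF open_carrier F smooth_left_field p])
    qed
    show ?thesis
      using second_derivative_symmetric[OF open_carrier F p, of "left_field v p" "left_field w p"]
      by (simp add: commutator_def twice V_def linear_diff[OF lin])
  qed
  have "commutator (field_op v) (field_op w) \<in> Lie pushed mfd"
  proof -
    have "smooth_on U V"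
      unfolding V_def
      by (intro smooth_on_diff smooth_on_directional_derivative open_carrier smooth_left_field)
    \<comment> \<open>On a function outside \<open>SF\<close> the inner operator returns the zero
      function, which is smooth; the outer operator has to send it to 0 again.\<close>
    moreover have zero: "field_op u 0 = 0" for u
    proof (intro ext)
      fix x
      show "field_op u 0 x = 0 x"
        by (auto simp: field_op_def zero_fun_def)
    qed
    moreover have "field_op u f = 0" if "f \<notin> SF" for u f
      using that by (simp add: field_op_def fun_eq_iff)
    moreover have "field_op u f x = 0" if "x \<notin> \<kappa> ` U" for u f x
      using that by (auto simp: field_op_def)
    ultimately have "vector_field mfd (commutator (field_op v) (field_op w))"
      unfolding vector_field_one_chart using V by (auto simp: commutator_def)
    moreover have "field_op u (left_translate pushed g f) = left_translate pushed g (field_op u f)"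
      if "g \<in> \<kappa> ` U" "f \<in> SF" for u g f
      using field_op_Lie[of u] that by (auto simp: Lie_def)
    moreover have "left_translate pushed g (f - h) = left_translate pushed g f - left_translate pushed g h" for g f h
      by (auto simp: left_translate_def fun_eq_iff)
    ultimately show ?thesis
      by (simp add: Lie_def commutator_def field_op_SF)
  qed
  from Lie_memD[OF this V] show ?thesis
    by (simp add: V_def lie_bracket_def left_field_one)
qed

definition tangent :: "'e set \<Rightarrow> 'e set"
  where "tangent H = {v. \<exists>c. smooth_on UNIV c \<and> range c \<subseteq> H \<and> c 0 = \<one> \<and> (c has_vector_derivative v) (at 0)}"

text \<open>Curves in \<open>H\<close> and in its image correspond under \<open>\<kappa>\<close>.
  The chain rule turns a velocity into the derivatives of all smooth functions; conversely the
  coordinate functions alone determine the velocity.\<close>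

lemma tangent_algebra_pushed:
  assumes H: "H \<subseteq> U"
  shows "field_op ` tangent H = tangent_algebra pushed mfd (\<kappa> ` H)"
proof (rule subset_antisym; rule subsetI)
  fix D assume "D \<in> field_op ` tangent H"
  then obtain v c where D: "D = field_op v" and c: "smooth_on UNIV c" "range c \<subseteq> H" "c 0 = \<one>"
    "(c has_vector_derivative v) (at 0)" by (auto simp: tangent_def)
  have cU: "c t \<in> U" for t using c(2) H by auto
  have 1: "smooth_map model_manifold mfd (\<lambda>t. \<kappa> (c t))"
    unfolding model_manifold_one_chart
    by (subst smooth_map_one_chart[OF open_UNIV chart_embedding_id emb]) (use c(1) cU in auto)
  have 2: "((\<lambda>t. f (\<kappa> (c t))) has_real_derivative D f (\<kappa> \<one>)) (at 0)" if f: "f \<in> SF" for f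
  proof -
    have c': "(c has_derivative (\<lambda>t. t *\<^sub>R v)) (at 0)" using c(4) by (simp add: has_vector_derivative_def)
    have f': "((\<lambda>q. f (\<kappa> q)) has_derivative frechet_derivative (\<lambda>q. f (\<kappa> q)) (at \<one>)) (at (c 0))"
      using f c(3) by (auto simp: mem_SF intro: smooth_on_has_derivative)
    have "linear (frechet_derivative (\<lambda>q. f (\<kappa> q)) (at \<one>))"
      using f' has_derivative_linear by blast
    then have "(\<lambda>t. frechet_derivative (\<lambda>q. f (\<kappa> q)) (at \<one>) (t *\<^sub>R v)) = (*) (D f (\<kappa> \<one>))"
      using f by (simp add: fun_eq_iff linear_cmul D field_op_one mult.commute)
    then show ?thesis
      using has_derivative_compose[OF c' f'] by (simp add: has_field_derivative_def)
  qed
  show "D \<in> tangent_algebra pushed mfd (\<kappa> ` H)"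
    unfolding tangent_algebra_def using 1 2 c field_op_Lie
    by (auto simp: D o_def intro!: exI[of _ "\<lambda>t. \<kappa> (c t)"])
next
  fix D assume "D \<in> tangent_algebra pushed mfd (\<kappa> ` H)"
  then obtain v \<gamma> where D: "D = field_op v" and \<gamma>: "smooth_map model_manifold mfd \<gamma>" "range \<gamma> \<subseteq> \<kappa> ` H" "\<gamma> 0 = \<kappa> \<one>"
    and d: "\<And>f. f \<in> SF \<Longrightarrow> ((f \<circ> \<gamma>) has_real_derivative D f (\<kappa> \<one>)) (at 0)"
    unfolding tangent_algebra_def Lie_eq by auto
  define c where "c t = \<kappa>' (\<gamma> t)" for t
  have \<gamma>H: "\<exists>p\<in>H. \<gamma> t = \<kappa> p" for t using \<gamma>(2) by blast
  have "smooth_on UNIV c"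
    using \<gamma>(1) unfolding model_manifold_one_chart c_def
    by (subst (asm) smooth_map_one_chart[OF open_UNIV chart_embedding_id emb]) auto
  moreover have "range c \<subseteq> H"
  proof (rule image_subsetI)
    fix t
    obtain p where "p \<in> H" "\<gamma> t = \<kappa> p" using \<gamma>H[of t] by blast
    then show "c t \<in> H" by (simp add: c_def)
  qed
  moreover have "c 0 = \<one>" by (simp add: c_def \<gamma>)
  moreover have "(c has_vector_derivative v) (at 0)"
  proof -
    have "((\<lambda>t. c t \<bullet> b) has_derivative (\<lambda>t. (t *\<^sub>R v) \<bullet> b)) (at 0)" for b
    proof -
      have "coordinate b (\<gamma> t) = c t \<bullet> b" for t
        using \<gamma>H[of t] H by (auto simp: coordinate_def c_def)
      moreover have "(\<lambda>t. (t *\<^sub>R v) \<bullet> b) = (*) (v \<bullet> b)" by (simp add: fun_eq_iff)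
      ultimately show ?thesis
        using d[OF coordinate_SF[of b]] by (simp add: D field_op_coordinate has_field_derivative_def o_def)
    qed
    then show ?thesis
      unfolding has_vector_derivative_def by (subst has_derivative_componentwise_within) auto
  qed
  ultimately show "D \<in> field_op ` tangent H"
    unfolding D tangent_def by blast
qed

end

subsection \<open>Isomorphisms of matched pairs\<close>

lemma lie_pair_iso_trans:
  assumes "lie_pair_iso P Q" "lie_pair_iso Q R"
  shows "lie_pair_iso P R"
proof -
  obtain f where f: "bij_betw f (ambient P) (ambient Q)"
    "\<forall>x\<in>ambient P. \<forall>y\<in>ambient P. f (x + y) = f x + f y"
    "\<forall>c. \<forall>x\<in>ambient P. f (c *\<^sub>R x) = c *\<^sub>R f x"
    "\<forall>x\<in>ambient P. \<forall>y\<in>ambient P. f (bracket P x y) = bracket Q (f x) (f y)"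
    "f ` part1 P = part1 Q" "f ` part2 P = part2 Q"
    using assms(1) by (auto simp: lie_pair_iso_def)
  obtain g where g: "bij_betw g (ambient Q) (ambient R)"
    "\<forall>x\<in>ambient Q. \<forall>y\<in>ambient Q. g (x + y) = g x + g y"
    "\<forall>c. \<forall>x\<in>ambient Q. g (c *\<^sub>R x) = c *\<^sub>R g x"
    "\<forall>x\<in>ambient Q. \<forall>y\<in>ambient Q. g (bracket Q x y) = bracket R (g x) (g y)"
    "g ` part1 Q = part1 R" "g ` part2 Q = part2 R"
    using assms(2) by (auto simp: lie_pair_iso_def)
  have fQ: "f x \<in> ambient Q" if "x \<in> ambient P" for x
    using f(1) that bij_betwE by blast
  have "(g \<circ> f) ` part1 P = part1 R" "(g \<circ> f) ` part2 P = part2 R"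
    unfolding image_comp[symmetric] f(5,6) g(5,6) by (rule refl)+
  moreover have "(g \<circ> f) (x + y) = (g \<circ> f) x + (g \<circ> f) y" "(g \<circ> f) (c *\<^sub>R x) = c *\<^sub>R (g \<circ> f) x"
    "(g \<circ> f) (bracket P x y) = bracket R ((g \<circ> f) x) ((g \<circ> f) y)"
    if "x \<in> ambient P" "y \<in> ambient P" for x y c
    using f(2-4) g(2-4) fQ that by simp_all
  ultimately show ?thesis
    unfolding lie_pair_iso_def
    using bij_betw_trans[OF f(1) g(1)] by (intro exI[of _ "g \<circ> f"] conjI ballI allI)
qed

text \<open>Isomorphisms are built from the pair whose ambient space is a whole type, where
  linearity carries no side conditions, and reversed afterwards.\<close>

lemma lie_pair_iso_sym_UNIV:
  assumes iso: "lie_pair_iso P Q" and P: "ambient P = UNIV"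
  shows "lie_pair_iso Q P"
proof -
  obtain f where f: "bij_betw f UNIV (ambient Q)" "\<And>x y. f (x + y) = f x + f y"
    "\<And>c x. f (c *\<^sub>R x) = c *\<^sub>R f x" "\<And>x y. f (bracket P x y) = bracket Q (f x) (f y)"
    "f ` part1 P = part1 Q" "f ` part2 P = part2 Q"
    using iso by (auto simp: lie_pair_iso_def P)
  have inj: "inj f" and Q: "ambient Q = range f"
    using f(1) by (auto simp: bij_betw_def)
  have g: "inv_into UNIV f (f x) = x" for x using inj by simp
  have "inv_into UNIV f ` f ` S = S" for S using inj by (simp add: image_inv_f_f)
  then have "inv_into UNIV f ` part1 Q = part1 P" "inv_into UNIV f ` part2 Q = part2 P"
    by (simp_all flip: f(5,6))
  moreover have "bij_betw (inv_into UNIV f) (ambient Q) (ambient P)"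
    using bij_betw_inv_into[OF f(1)] P by simp
  moreover have "inv_into UNIV f (u + v) = inv_into UNIV f u + inv_into UNIV f v" "inv_into UNIV f (c *\<^sub>R u) = c *\<^sub>R inv_into UNIV f u"
    "inv_into UNIV f (bracket Q u v) = bracket P (inv_into UNIV f u) (inv_into UNIV f v)" if uv: "u \<in> ambient Q" "v \<in> ambient Q" for u v c
  proof -
    obtain x y where "u = f x" "v = f y" using uv Q by blast
    then show "inv_into UNIV f (u + v) = inv_into UNIV f u + inv_into UNIV f v" "inv_into UNIV f (c *\<^sub>R u) = c *\<^sub>R inv_into UNIV f u"
      "inv_into UNIV f (bracket Q u v) = bracket P (inv_into UNIV f u) (inv_into UNIV f v)"
      by (simp_all add: g flip: f(2-4))
  qed
  ultimately show ?thesis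
    unfolding lie_pair_iso_def by (intro exI[of _ "inv_into UNIV f"] conjI ballI allI)
qed

subsection \<open>Exponentiation by Lie groups with a single chart\<close>

lemma at_most_two_components_top_of_set:
  assumes S: "S = A \<union> B" and A: "connected A" and B: "connected B"
  shows "at_most_two_components (top_of_set S)"
proof -
  \<comment> \<open>An empty piece yields an arbitrary set here. This does no harm, as only the
    inclusion of the components in \<open>{f A, f B}\<close> is claimed.\<close>
  define f where "f K = connected_component_of_set (top_of_set S) (SOME x. x \<in> K)" for K
  have *: "connected_component_of_set (top_of_set S) x = f K" if K: "x \<in> K" "connected K" "K \<subseteq> S" for x K
  proof -
    have "connectedin (top_of_set S) K" using K by (simp add: connectedin_subtopology)
    moreover have "(SOME x. x \<in> K) \<in> K" using K(1) by (rule someI)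
    ultimately have "connected_component_of (top_of_set S) x (SOME x. x \<in> K)"
      unfolding connected_component_of_def using K(1) by (intro exI[of _ K] conjI)
    from iffD1[OF connected_component_of_equiv this] show ?thesis
      unfolding f_def by (intro arg_cong[of _ _ Collect]) (elim conjE)
  qed
  have sub: "connected_components_of (top_of_set S) \<subseteq> {f A, f B}"
  proof
    fix C assume "C \<in> connected_components_of (top_of_set S)"
    then obtain x where x: "x \<in> S" "C = connected_component_of_set (top_of_set S) x"
      unfolding connected_components_of_def by auto
    show "C \<in> {f A, f B}"
    proof (cases "x \<in> A")
      case True
      then have "C = f A" unfolding x(2) using A S by (intro *) blast+
      then show ?thesis by simp
    next
      case False
      then have "C = f B" unfolding x(2) using B S x(1) by (intro *) blast+
      then show ?thesis by simp
    qed
  qed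
  have "card (connected_components_of (top_of_set S)) \<le> card {f A, f B}"
    by (rule card_mono[OF _ sub]) simp
  also have "\<dots> \<le> 2" by (cases "f A = f B") simp_all
  finally show ?thesis using finite_subset[OF sub] by (simp add: at_most_two_components_def)
qed

text \<open>The pieces may be empty or overlap, which makes the property stable under continuous
  images and includes the connected sets.\<close>

definition two_pieces :: "'a::topological_space set \<Rightarrow> bool"
  where "two_pieces S \<longleftrightarrow> (\<exists>A B. connected A \<and> connected B \<and> S = A \<union> B)"

lemma two_pieces_image:
  assumes "two_pieces S" "continuous_on S f"
  shows "two_pieces (f ` S)"
proof -
  obtain A B where AB: "connected A" "connected B" "S = A \<union> B"
    using assms(1) two_pieces_def by blast
  have "continuous_on A f" "continuous_on B f"
    using assms(2) AB(3) by (auto intro: continuous_on_subset)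
  then have "connected (f ` A)" "connected (f ` B)"
    using AB by (auto intro: connected_continuous_image)
  moreover have "f ` S = f ` A \<union> f ` B" using AB(3) by (simp add: image_Un)
  ultimately show ?thesis unfolding two_pieces_def by (intro exI[of _ "f ` A"] exI[of _ "f ` B"] conjI)
qed

lemma two_pieces_at_most_two_components:
  "two_pieces S \<Longrightarrow> at_most_two_components (top_of_set S)"
  unfolding two_pieces_def by (elim exE conjE) (rule at_most_two_components_top_of_set)

context chart_group
begin

lemma subgroup_pushed:
  assumes H: "subgroup H G"
  shows "subgroup (\<kappa> ` H) pushed"
proof (rule subgroup.intro)
  show "\<kappa> ` H \<subseteq> carrier pushed" using subgroup.subset[OF H] by auto
  show "x \<otimes>\<^bsub>pushed\<^esub> y \<in> \<kappa> ` H" if "x \<in> \<kappa> ` H" "y \<in> \<kappa> ` H" for x y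
    using that subgroup.m_closed[OF H] by auto
  show "\<one>\<^bsub>pushed\<^esub> \<in> \<kappa> ` H" using subgroup.one_closed[OF H] by auto
  show "inv\<^bsub>pushed\<^esub> x \<in> \<kappa> ` H" if "x \<in> \<kappa> ` H" for x
    using that subgroup.m_inv_closed[OF H] subgroup.mem_carrier[OF H] by (auto simp: inv_pushed)
qed

text \<open>The map \<open>j\<close> has to reverse products; on the opposite of a subgroup the
  inclusion does so.\<close>

definition opposite :: "'p set \<Rightarrow> 'p monoid"
  where "opposite K = \<lparr>carrier = K, mult = (\<lambda>x y. y \<otimes>\<^bsub>pushed\<^esub> x), one = \<one>\<^bsub>pushed\<^esub>\<rparr>"

lemma opposite_simps [simp]:
  "carrier (opposite K) = K" "x \<otimes>\<^bsub>opposite K\<^esub> y = y \<otimes>\<^bsub>pushed\<^esub> x" "\<one>\<^bsub>opposite K\<^esub> = \<one>\<^bsub>pushed\<^esub>"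
  by (simp_all add: opposite_def)

lemma group_opposite:
  assumes K: "subgroup K pushed"
  shows "group (opposite K)"
proof (rule groupI)
  interpret P: group pushed by (rule group_pushed)
  show "x \<otimes>\<^bsub>opposite K\<^esub> y \<in> carrier (opposite K)"
    if "x \<in> carrier (opposite K)" "y \<in> carrier (opposite K)" for x y
    using that subgroup.m_closed[OF K] by simp
  show "\<one>\<^bsub>opposite K\<^esub> \<in> carrier (opposite K)"
    using subgroup.one_closed[OF K] by simp
  show "x \<otimes>\<^bsub>opposite K\<^esub> y \<otimes>\<^bsub>opposite K\<^esub> z = x \<otimes>\<^bsub>opposite K\<^esub> (y \<otimes>\<^bsub>opposite K\<^esub> z)"
    if "x \<in> carrier (opposite K)" "y \<in> carrier (opposite K)" "z \<in> carrier (opposite K)" for x y z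
    unfolding opposite_simps
    by (rule P.m_assoc[symmetric]) (use that subgroup.mem_carrier[OF K] in simp_all)
  show "\<one>\<^bsub>opposite K\<^esub> \<otimes>\<^bsub>opposite K\<^esub> x = x" if "x \<in> carrier (opposite K)" for x
    unfolding opposite_simps by (rule P.r_one) (use that subgroup.mem_carrier[OF K] in simp)
  show "\<exists>y\<in>carrier (opposite K). y \<otimes>\<^bsub>opposite K\<^esub> x = \<one>\<^bsub>opposite K\<^esub>" if x: "x \<in> carrier (opposite K)" for x
    unfolding opposite_simps
    by (rule bexI[of _ "inv\<^bsub>pushed\<^esub> x"])
       (use x subgroup.mem_carrier[OF K] subgroup.m_inv_closed[OF K] in \<open>simp_all del: pushed_simps\<close>)
qed

lemma closedin_pushed:
  assumes "closedin (top_of_set U) H"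
  shows "closedin (top_of_set (\<kappa> ` U)) (\<kappa> ` H)"
proof -
  obtain C where C: "closed C" "H = U \<inter> C" using assms by (auto simp: closedin_closed)
  have "closed (\<kappa>' -` C)"
    using C(1) emb by (auto simp: chart_embedding_def intro: closed_vimage)
  moreover have "\<kappa> ` H = \<kappa> ` U \<inter> \<kappa>' -` C" using C(2) by auto
  ultimately show ?thesis by (simp add: closedin_closed_Int)
qed

lemma matched_pair_groups_pushed:
  assumes H1: "subgroup H1 G" "closedin (top_of_set U) H1"
    and H2: "subgroup H2 G" "closedin (top_of_set U) H2"
    and int: "H1 \<inter> H2 = {\<one>}"
    and prod: "negligible (U - {x \<otimes> y | x y. x \<in> H1 \<and> y \<in> H2})"
  shows "matched_pair_groups pushed mfd (pushed\<lparr>carrier := \<kappa> ` H1\<rparr>) (top_of_set (\<kappa> ` H1)) id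
    (opposite (\<kappa> ` H2)) (top_of_set (\<kappa> ` H2)) id"
proof -
  have sub: "H1 \<subseteq> U" "H2 \<subseteq> U" using H1 H2 subgroup.subset by blast+
  have emb_id: "embedding_map (top_of_set (\<kappa> ` H)) (top_of_set (\<kappa> ` U)) id" if "H \<subseteq> U" for H
  proof -
    have "\<kappa> ` H \<subseteq> \<kappa> ` U" using that by blast
    then have "subtopology (top_of_set (\<kappa> ` U)) (\<kappa> ` H) = top_of_set (\<kappa> ` H)"
      by (simp add: subtopology_subtopology inf.absorb2)
    then show ?thesis
      unfolding embedding_map_def by simp
  qed
  have "\<kappa> ` U - {x \<otimes>\<^bsub>pushed\<^esub> y | x y. x \<in> \<kappa> ` H1 \<and> y \<in> \<kappa> ` H2}
      = \<kappa> ` (U - {x \<otimes> y | x y. x \<in> H1 \<and> y \<in> H2})"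
  proof -
    have "{x \<otimes>\<^bsub>pushed\<^esub> y | x y. x \<in> \<kappa> ` H1 \<and> y \<in> \<kappa> ` H2} = \<kappa> ` {x \<otimes> y | x y. x \<in> H1 \<and> y \<in> H2}"
    proof (rule subset_antisym; rule subsetI)
      fix z assume "z \<in> {x \<otimes>\<^bsub>pushed\<^esub> y | x y. x \<in> \<kappa> ` H1 \<and> y \<in> \<kappa> ` H2}"
      then obtain x y where "x \<in> H1" "y \<in> H2" "z = \<kappa> (x \<otimes> y)" by auto
      then show "z \<in> \<kappa> ` {x \<otimes> y | x y. x \<in> H1 \<and> y \<in> H2}" by blast
    next
      fix z assume "z \<in> \<kappa> ` {x \<otimes> y | x y. x \<in> H1 \<and> y \<in> H2}"
      then obtain x y where "x \<in> H1" "y \<in> H2" "z = \<kappa> x \<otimes>\<^bsub>pushed\<^esub> \<kappa> y" by auto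
      then show "z \<in> {x \<otimes>\<^bsub>pushed\<^esub> y | x y. x \<in> \<kappa> ` H1 \<and> y \<in> \<kappa> ` H2}" by blast
    qed
    then show ?thesis by (simp add: image_set_diff inj_def)
  qed
  then have neg: "negligible (\<kappa>' ` (\<kappa> ` U - {id x \<otimes>\<^bsub>pushed\<^esub> id y | x y. x \<in> \<kappa> ` H1 \<and> y \<in> \<kappa> ` H2}))"
    using prod by (simp add: chart_embedding_image[OF emb])
  have "\<kappa> ` H1 \<inter> \<kappa> ` H2 = {\<kappa> \<one>}" using int by auto
  moreover have "id \<in> hom (pushed\<lparr>carrier := \<kappa> ` H1\<rparr>) pushed"
    using sub by (auto simp: hom_def)
  moreover have "id \<in> antihom (opposite (\<kappa> ` H2)) pushed"
    using sub by (auto simp: antihom_def)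
  ultimately show ?thesis
    unfolding matched_pair_groups_def
    using lie_group_pushed subgroup.subgroup_is_group[OF subgroup_pushed[OF H1(1)] group_pushed]
      group_opposite[OF subgroup_pushed[OF H2(1)]] emb_id[OF sub(1)] emb_id[OF sub(2)]
      closedin_pushed[OF H1(2)] closedin_pushed[OF H2(2)] neg
    by simp
qed

lemma lie_pair_of_groups_pushed_iso:
  fixes P :: "'e lie_pair"
  assumes P: "ambient P = UNIV" and T: "linear T" "bij T"
    and bracket: "\<And>v w. T (bracket P v w) = lie_bracket (T v) (T w)"
    and parts: "T ` part1 P = tangent H1" "T ` part2 P = tangent H2"
    and sub: "H1 \<subseteq> U" "H2 \<subseteq> U"
  shows "lie_pair_iso (lie_pair_of_groups pushed mfd (pushed\<lparr>carrier := \<kappa> ` H1\<rparr>) id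
    (opposite (\<kappa> ` H2)) id) P"
proof (rule lie_pair_iso_sym_UNIV[OF _ P])
  let ?f = "\<lambda>v. field_op (T v)"
  have "bij_betw ?f UNIV (Lie pushed mfd)"
  proof (rule bij_betw_imageI)
    show "inj ?f" using T(2) by (auto simp: inj_def field_op_inject bij_def)
    show "range ?f = Lie pushed mfd"
      using bij_is_surj[OF T(2)] by (simp add: Lie_eq image_image[symmetric])
  qed
  moreover have "?f (v + w) = ?f v + ?f w" "?f (c *\<^sub>R v) = c *\<^sub>R ?f v"
    "?f (bracket P v w) = commutator (?f v) (?f w)" for v w c
    by (simp_all add: linear_add[OF T(1)] linear_cmul[OF T(1)] linear_add[OF linear_field_op]
        linear_cmul[OF linear_field_op] bracket commutator_field_op)
  moreover have "?f ` part1 P = tangent_algebra pushed mfd (\<kappa> ` H1)"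
    "?f ` part2 P = tangent_algebra pushed mfd (\<kappa> ` H2)"
    by (simp_all add: tangent_algebra_pushed[OF sub(1), symmetric] tangent_algebra_pushed[OF sub(2), symmetric]
        image_image[symmetric, of field_op T] parts)
  ultimately show "lie_pair_iso P (lie_pair_of_groups pushed mfd (pushed\<lparr>carrier := \<kappa> ` H1\<rparr>) id
    (opposite (\<kappa> ` H2)) id)"
    unfolding lie_pair_iso_def lie_pair_of_groups_def P
    by (intro exI[of _ ?f]) simp
qed

end

text \<open>Everything about manifolds and operators is discharged here. What each case has to
  supply are two closed subgroups of a one-chart group and a linear identification \<open>T\<close>
  of the pair with the tangent space at the identity.\<close>

lemma exponentiable_le2I:
  fixes P :: "'e::euclidean_space lie_pair" and G :: "'e monoid"
    and \<kappa> :: "'e \<Rightarrow> real \<times> real \<times> real \<times> real"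
  assumes "chart_group G \<kappa> \<kappa>'"
    and H1: "subgroup H1 G" "closedin (top_of_set (carrier G)) H1"
    and H2: "subgroup H2 G" "closedin (top_of_set (carrier G)) H2"
    and int: "H1 \<inter> H2 = {\<one>\<^bsub>G\<^esub>}"
    and prod: "negligible (carrier G - {x \<otimes>\<^bsub>G\<^esub> y | x y. x \<in> H1 \<and> y \<in> H2})"
    and pieces: "two_pieces (carrier G)" "two_pieces H1" "two_pieces H2"
    and P: "ambient P = UNIV" and T: "linear T" "bij T"
    and bracket: "\<And>v w. T (bracket P v w) = chart_group.lie_bracket G (T v) (T w)"
    and parts: "T ` part1 P = chart_group.tangent G H1" "T ` part2 P = chart_group.tangent G H2"
  shows "exponentiable_le2 P"
proof -
  interpret chart_group G \<kappa> \<kappa>' by fact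
  have "continuous_on S \<kappa>" for S
    using emb continuous_on_subset unfolding chart_embedding_def by blast
  then have "at_most_two_components (top_of_set (\<kappa> ` S))" if "two_pieces S" for S
    by (intro two_pieces_at_most_two_components two_pieces_image that)
  then have "at_most_two_components (topo mfd)" "at_most_two_components (top_of_set (\<kappa> ` H1))"
    "at_most_two_components (top_of_set (\<kappa> ` H2))"
    using pieces by simp_all
  moreover have "H1 \<subseteq> U" "H2 \<subseteq> U" using H1 H2 subgroup.subset by blast+
  note lie_pair_of_groups_pushed_iso[OF P T bracket parts this]
  ultimately show ?thesis
    using matched_pair_groups_pushed[OF H1 H2 int prod]
    unfolding exponentiable_le2_def
    by (intro exI[of _ pushed] exI[of _ mfd] exI[of _ "pushed\<lparr>carrier := \<kappa> ` H1\<rparr>"]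
        exI[of _ "top_of_set (\<kappa> ` H1)"] exI[of _ id] exI[of _ "opposite (\<kappa> ` H2)"]
        exI[of _ "top_of_set (\<kappa> ` H2)"] conjI)
qed

subsection \<open>Semidirect products of a vector space by a group of scalars\<close>

text \<open>Pairing with a vector orthogonal to \<open>V\<close> gives the constant function 0, so
  the derivative lies in the double orthogonal complement of \<open>V\<close>.\<close>

lemma has_vector_derivative_in_subspace:
  fixes g :: "real \<Rightarrow> 'a::euclidean_space"
  assumes V: "subspace V" and g: "\<And>t. g t \<in> V" and d: "(g has_vector_derivative d) (at x)"
  shows "d \<in> V"
proof -
  have "orthogonal w d" if w: "w \<in> V\<^sup>\<bottom>" for w
  proof -
    have "w \<bullet> g t = 0" for t
      using w g[of t] by (simp add: orthogonal_comp_def orthogonal_def inner_commute[of w])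
    then have "((\<lambda>t. 0) has_vector_derivative w \<bullet> d) (at x)"
      using bounded_linear.has_vector_derivative[OF bounded_linear_inner_right d, of w] by simp
    then show ?thesis
      unfolding orthogonal_def by (rule vector_derivative_unique_at[OF _ has_vector_derivative_const])
  qed
  then have "d \<in> V\<^sup>\<bottom>\<^sup>\<bottom>" by (simp add: orthogonal_comp_def)
  then show ?thesis by (simp add: orthogonal_comp_self[OF V])
qed

text \<open>\<open>E\<close> is the one-parameter group of linear maps with generator
  \<open>N\<close>. It is characterised by its properties so that each case can give it in closed
  form.\<close>

locale scalar_action =
  fixes E :: "real \<Rightarrow> 'v::euclidean_space \<Rightarrow> 'v" and N :: "'v \<Rightarrow> 'v" and H :: "real set"
  assumes linear_E: "\<And>t. linear (E t)" and E_0: "\<And>v. E 0 v = v"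
    and E_add: "\<And>s t v. E (s + t) v = E s (E t v)"
    and smooth_E: "smooth_on UNIV (\<lambda>z. E (fst z) (snd z))"
    and deriv_E: "\<And>v. ((\<lambda>t. E t v) has_vector_derivative N v) (at 0)"
    and H_cases: "H = {0<..} \<or> H = - {0}"
begin

lemma H: "open H" "1 \<in> H" "s \<in> H \<Longrightarrow> s \<noteq> 0" "s \<in> H \<Longrightarrow> t \<in> H \<Longrightarrow> s * t \<in> H"
  "s \<in> H \<Longrightarrow> inverse s \<in> H" "0 < s \<Longrightarrow> s \<in> H"
  using H_cases by auto

text \<open>The sign makes \<open>\<rho> s\<close> plain multiplication by \<open>s\<close> on an
  eigenvector of \<open>N\<close> with eigenvalue 1, for negative \<open>s\<close> as well. This is
  what lets the cocycle \<open>1 - s\<close> take all values except 1.\<close>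

definition \<rho> :: "real \<Rightarrow> 'v \<Rightarrow> 'v"
  where "\<rho> s v = sgn s *\<^sub>R E (ln \<bar>s\<bar>) v"

lemma linear_\<rho>: "linear (\<rho> s)"
  unfolding \<rho>_def
  by (rule linearI) (simp_all add: linear_add[OF linear_E] linear_cmul[OF linear_E] scaleR_add_right)

lemmas \<rho>_add = linear_add[OF linear_\<rho>] and \<rho>_minus = linear_neg[OF linear_\<rho>]
  and \<rho>_zero = linear_0[OF linear_\<rho>]

lemma \<rho>_one: "\<rho> 1 v = v"
  by (simp add: \<rho>_def E_0)

lemma \<rho>_mult: "s \<in> H \<Longrightarrow> t \<in> H \<Longrightarrow> \<rho> (s * t) v = \<rho> s (\<rho> t v)"
  using H(3)[of s] H(3)[of t]
  by (simp add: \<rho>_def sgn_mult abs_mult ln_mult E_add linear_cmul[OF linear_E])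

lemma \<rho>_inverse: "s \<in> H \<Longrightarrow> \<rho> s (\<rho> (inverse s) v) = v" "s \<in> H \<Longrightarrow> \<rho> (inverse s) (\<rho> s v) = v"
  using \<rho>_mult[of s "inverse s" v] \<rho>_mult[of "inverse s" s v] H(3)[of s] H(5)[of s] by (simp_all add: \<rho>_one)

lemma smooth_on_\<rho>:
  assumes "open S" "smooth_on S f" "smooth_on S g" "\<And>x. x \<in> S \<Longrightarrow> f x \<noteq> 0"
  shows "smooth_on S (\<lambda>x. \<rho> (f x) (g x))"
proof -
  have "smooth_on S (\<lambda>x. E (fst (ln \<bar>f x\<bar>, g x)) (snd (ln \<bar>f x\<bar>, g x)))"
    by (rule smooth_on_compose[OF assms(1) open_UNIV smooth_E])
       (simp_all add: smooth_on_Pair smooth_on_ln_abs_compose assms)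
  then show ?thesis
    unfolding \<rho>_def using assms by (intro smooth_on_scaleR smooth_on_sgn_compose) simp_all
qed

lemma \<rho>_deriv: "((\<lambda>s. \<rho> s v) has_vector_derivative N v) (at 1)"
proof -
  have "(ln has_vector_derivative 1) (at (1::real))"
    by (auto intro!: derivative_eq_intros simp: has_real_derivative_iff_has_vector_derivative[symmetric])
  then have "((\<lambda>t. E t v) \<circ> ln has_vector_derivative 1 *\<^sub>R N v) (at (1::real))"
    by (rule vector_diff_chain_at) (simp add: deriv_E)
  then have "((\<lambda>s. E (ln s) v) has_vector_derivative N v) (at (1::real))"
    by (simp add: o_def)
  then show ?thesis
    by (rule has_vector_derivative_transform_within_open[where S = "{0<..}"]) (simp_all add: \<rho>_def)
qed

definition \<G> :: "('v \<times> real) monoid"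
  where "\<G> = \<lparr>carrier = UNIV \<times> H, mult = (\<lambda>p q. (fst p + \<rho> (snd p) (fst q), snd p * snd q)), one = (0, 1)\<rparr>"

lemma \<G>_simps [simp]: "carrier \<G> = UNIV \<times> H"
  "p \<otimes>\<^bsub>\<G>\<^esub> q = (fst p + \<rho> (snd p) (fst q), snd p * snd q)" "\<one>\<^bsub>\<G>\<^esub> = (0, 1)"
  by (simp_all add: \<G>_def)

lemma group_\<G>: "group \<G>"
proof (rule groupI)
  fix p assume "p \<in> carrier \<G>"
  then show "\<exists>q\<in>carrier \<G>. q \<otimes>\<^bsub>\<G>\<^esub> p = \<one>\<^bsub>\<G>\<^esub>"
    by (intro bexI[of _ "(- \<rho> (inverse (snd p)) (fst p), inverse (snd p))"]) (use H in auto)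
qed (use H in \<open>auto simp: \<rho>_mult \<rho>_add \<rho>_one add.assoc\<close>)

lemma inv_\<G>: "p \<in> carrier \<G> \<Longrightarrow> inv\<^bsub>\<G>\<^esub> p = (- \<rho> (inverse (snd p)) (fst p), inverse (snd p))"
  by (rule group.inv_equality[OF group_\<G>]) (use H in auto)

lemma open_\<G>: "open (carrier \<G>)"
  by (simp add: open_Times H)

definition crossed :: "'v set \<Rightarrow> real set \<Rightarrow> (real \<Rightarrow> 'v) \<Rightarrow> ('v \<times> real) set"
  where "crossed V K c = {(c s + v, s) | s v. s \<in> K \<and> v \<in> V}"

text \<open>For \<open>K = H\<close>, the invariance of \<open>V\<close> and the cocycle identity
  make \<open>crossed V K c\<close> a subgroup. For \<open>K = {1}\<close> the cocycle is only seen
  at 1, where it vanishes; the subgroup is then \<open>V\<close> inside the abelian normal subgroup,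
  and \<open>V\<close> may be any subspace.\<close>

definition crossed_data :: "'v set \<Rightarrow> real set \<Rightarrow> (real \<Rightarrow> 'v) \<Rightarrow> 'v \<Rightarrow> bool"
  where "crossed_data V K c c' \<longleftrightarrow>
    subspace V \<and> (K = {1} \<or> K = H \<and> (\<forall>t. \<forall>v\<in>V. E t v \<in> V)) \<and>
    smooth_on H c \<and> (\<forall>s\<in>H. \<forall>t\<in>H. c (s * t) = c s + \<rho> s (c t)) \<and> (c has_vector_derivative c') (at 1)"

lemma mem_crossed: "p \<in> crossed V K c \<longleftrightarrow> snd p \<in> K \<and> fst p - c (snd p) \<in> V"
proof
  assume *: "snd p \<in> K \<and> fst p - c (snd p) \<in> V"
  have "p = (c (snd p) + (fst p - c (snd p)), snd p)" by simp
  then show "p \<in> crossed V K c" unfolding crossed_def using * by blast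
qed (auto simp: crossed_def)

lemma crossed_data_one:
  assumes "crossed_data V K c c'"
  shows "c 1 = 0"
proof -
  have "c (1 * 1) = c 1 + \<rho> 1 (c 1)" using assms H(2) unfolding crossed_data_def by blast
  then show ?thesis by (simp add: \<rho>_one)
qed

lemma crossed_data_invariant:
  assumes "crossed_data V K c c'" "s \<in> K" "v \<in> V"
  shows "\<rho> s v \<in> V"
  using assms subspace_scale[of V] by (auto simp: crossed_data_def \<rho>_one) (auto simp: \<rho>_def)

lemma crossed_data_subset: "crossed_data V K c c' \<Longrightarrow> K \<subseteq> H"
  using H(2) by (auto simp: crossed_data_def)

lemma crossed_subset: "crossed_data V K c c' \<Longrightarrow> crossed V K c \<subseteq> UNIV \<times> H"
  using crossed_data_subset by (fastforce simp: crossed_def)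

lemma subgroup_crossed:
  assumes d: "crossed_data V K c c'"
  shows "subgroup (crossed V K c) \<G>"
proof (rule group.subgroupI[OF group_\<G>])
  have V: "subspace V" and K: "K = {1} \<or> K = H"
    and c: "\<And>s t. s \<in> H \<Longrightarrow> t \<in> H \<Longrightarrow> c (s * t) = c s + \<rho> s (c t)"
    using d by (auto simp: crossed_data_def)
  have KH: "s \<in> H" if "s \<in> K" for s using that crossed_data_subset[OF d] by blast
  have K_mult: "s * t \<in> K" if "s \<in> K" "t \<in> K" for s t using that K H(4) by auto
  have K_inv: "inverse s \<in> K" if "s \<in> K" for s using that K H(5) by auto
  show "crossed V K c \<subseteq> carrier \<G>" using crossed_subset[OF d] by simp
  have "1 \<in> K" using K H(2) by auto
  then have "(0, 1) \<in> crossed V K c"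
    using subspace_0[OF V] by (simp add: mem_crossed crossed_data_one[OF d])
  then show "crossed V K c \<noteq> {}" by blast
  show "p \<otimes>\<^bsub>\<G>\<^esub> q \<in> crossed V K c" if pq: "p \<in> crossed V K c" "q \<in> crossed V K c" for p q
  proof -
    have 1: "snd p \<in> K" "snd q \<in> K" "fst p - c (snd p) \<in> V" "fst q - c (snd q) \<in> V"
      using pq by (simp_all add: mem_crossed)
    have 2: "fst p + \<rho> (snd p) (fst q) - c (snd p * snd q) =
        (fst p - c (snd p)) + \<rho> (snd p) (fst q - c (snd q))"
      by (simp add: c[OF KH KH] 1 linear_diff[OF linear_\<rho>])
    have "fst p + \<rho> (snd p) (fst q) - c (snd p * snd q) \<in> V"
      unfolding 2 by (rule subspace_add[OF V 1(3) crossed_data_invariant[OF d 1(1) 1(4)]])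
    then show ?thesis
      using 1 K_mult by (simp add: mem_crossed)
  qed
  show "inv\<^bsub>\<G>\<^esub> p \<in> crossed V K c" if p: "p \<in> crossed V K c" for p
  proof -
    have 1: "snd p \<in> K" "fst p - c (snd p) \<in> V" using p by (simp_all add: mem_crossed)
    have sH: "snd p \<in> H" by (rule KH[OF 1(1)])
    have "0 = c (inverse (snd p)) + \<rho> (inverse (snd p)) (c (snd p))"
      using c[OF H(5)[OF sH] sH] H(3)[OF sH] crossed_data_one[OF d] by simp
    then have "- \<rho> (inverse (snd p)) (fst p) - c (inverse (snd p)) =
        - \<rho> (inverse (snd p)) (fst p - c (snd p))"
      by (simp add: linear_diff[OF linear_\<rho>] eq_neg_iff_add_eq_0 neg_eq_iff_add_eq_0)
    then show ?thesis
      using 1 K_inv subspace_neg[OF V crossed_data_invariant[OF d K_inv[OF 1(1)] 1(2)]] sH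
      by (simp add: mem_crossed inv_\<G> mem_Times_iff)
  qed
qed

lemma closedin_crossed:
  assumes d: "crossed_data V K c c'"
  shows "closedin (top_of_set (carrier \<G>)) (crossed V K c)"
proof -
  have "continuous_on (UNIV \<times> H) (\<lambda>p :: 'v \<times> real. c (snd p))"
    using d by (intro continuous_on_compose2[OF smooth_on_imp_continuous_on, of H c] continuous_intros)
      (auto simp: crossed_data_def)
  then have cont: "continuous_on (UNIV \<times> H) (\<lambda>p. fst p - c (snd p))"
    by (intro continuous_intros)
  have V: "closed V" using d by (simp add: crossed_data_def closed_subspace)
  have "closedin (top_of_set (UNIV \<times> H)) ((UNIV \<times> H) \<inter> (\<lambda>p. fst p - c (snd p)) -` V)"
    by (rule continuous_closedin_preimage[OF cont V])
  moreover have "closedin (top_of_set (UNIV \<times> H)) ((UNIV \<times> H) \<inter> (UNIV \<times> K) :: ('v \<times> real) set)"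
  proof (cases "K = {1}")
    case True
    then have "closed (UNIV \<times> K :: ('v \<times> real) set)" by (simp add: closed_Times)
    then show ?thesis by (rule closedin_closed_Int)
  next
    case False
    then have "K = H" using d by (auto simp: crossed_data_def)
    then show ?thesis by simp
  qed
  ultimately have "closedin (top_of_set (UNIV \<times> H))
      (((UNIV \<times> H) \<inter> (\<lambda>p. fst p - c (snd p)) -` V) \<inter> ((UNIV \<times> H) \<inter> (UNIV \<times> K)))"
    by (rule closedin_Int)
  moreover have "((UNIV \<times> H) \<inter> (\<lambda>p. fst p - c (snd p)) -` V) \<inter> ((UNIV \<times> H) \<inter> (UNIV \<times> K)) = crossed V K c"
    using crossed_data_subset[OF d] by (auto simp: mem_crossed)
  ultimately show ?thesis by simp
qed

text \<open>The set is a continuous image of \<open>V \<times> K\<close>, which splits by the sign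
  of the scalar; one half may be empty.\<close>

lemma two_pieces_crossed:
  assumes d: "crossed_data V K c c'"
  shows "two_pieces (crossed V K c)"
proof -
  have V: "convex V" using d by (simp add: crossed_data_def subspace_imp_convex)
  have c: "continuous_on H c" using d smooth_on_imp_continuous_on by (auto simp: crossed_data_def)
  have "two_pieces (V \<times> K)"
  proof -
    have "convex (V \<times> {s \<in> K. s > 0})" "convex (V \<times> {s \<in> K. s < 0})"
    proof -
      have "convex {s \<in> K. s > 0}" "convex {s \<in> K. s < 0}"
        using H_cases d by (auto simp: crossed_data_def is_interval_convex_1[symmetric] is_interval_1)
      then show "convex (V \<times> {s \<in> K. s > 0})" "convex (V \<times> {s \<in> K. s < 0})"
        using V by (auto intro: convex_Times)
    qed
    moreover have "V \<times> K = V \<times> {s \<in> K. s > 0} \<union> V \<times> {s \<in> K. s < 0}"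
      using crossed_data_subset[OF d] H(3) by force
    ultimately show ?thesis
      unfolding two_pieces_def using convex_connected by blast
  qed
  moreover have "continuous_on (V \<times> K) (\<lambda>p. (c (snd p) + fst p, snd p))"
    using crossed_data_subset[OF d]
    by (intro continuous_intros continuous_on_compose2[OF c]) auto
  ultimately have "two_pieces ((\<lambda>p. (c (snd p) + fst p, snd p)) ` (V \<times> K))"
    by (rule two_pieces_image)
  moreover have "(\<lambda>p. (c (snd p) + fst p, snd p)) ` (V \<times> K) = crossed V K c"
    by (auto simp: crossed_def image_iff)
  ultimately show ?thesis by simp
qed

lemma two_pieces_\<G>: "two_pieces (carrier \<G>)"
proof -
  have "crossed_data UNIV H (\<lambda>_. 0) 0"
    by (simp add: crossed_data_def \<rho>_zero smooth_on_const H(1))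
  moreover have "crossed UNIV H (\<lambda>_. 0) = carrier \<G>" by (auto simp: mem_crossed)
  ultimately show ?thesis using two_pieces_crossed by fastforce
qed

end

locale scalar_action_chart = scalar_action E N H
  for E :: "real \<Rightarrow> 'v::euclidean_space \<Rightarrow> 'v" and N H +
  fixes \<kappa> :: "'v \<times> real \<Rightarrow> 'p::euclidean_space" and \<kappa>' :: "'p \<Rightarrow> 'v \<times> real"
  assumes embedding: "chart_embedding \<kappa> \<kappa>'"
begin

sublocale chart_group \<G> \<kappa> \<kappa>'
proof (rule chart_group.intro[OF group_\<G>], unfold_locales)
  show "open (carrier \<G>)" by (rule open_\<G>)
  have o: "open (carrier \<G> \<times> carrier \<G>)" using open_\<G> open_Times by blast
  show "smooth_on (carrier \<G> \<times> carrier \<G>) (\<lambda>p. fst p \<otimes>\<^bsub>\<G>\<^esub> snd p)"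
    unfolding \<G>_simps(2)
    by (intro smooth_on_Pair smooth_on_add smooth_on_mult smooth_on_\<rho> smooth_on_fst smooth_on_snd
        smooth_on_ident o) (use H(3) in auto)
  have "smooth_on (carrier \<G>) (\<lambda>p. (- \<rho> (inverse (snd p)) (fst p), inverse (snd p)))"
    by (intro smooth_on_Pair smooth_on_minus smooth_on_inverse_compose smooth_on_\<rho> smooth_on_fst smooth_on_snd
        smooth_on_ident open_\<G>) (use H(3) in auto)
  then show "smooth_on (carrier \<G>) (\<lambda>x. inv\<^bsub>\<G>\<^esub> x)"
    by (rule smooth_on_cong[OF open_\<G>, rotated]) (simp add: inv_\<G>)
qed (rule embedding)

lemma left_field_\<G>: "left_field w p = (\<rho> (snd p) (fst w), snd p * snd w)"
proof -
  have "bounded_linear (\<rho> (snd p))" using linear_\<rho> by (simp add: linear_conv_bounded_linear)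
  note 1 = bounded_linear.has_derivative[OF this has_derivative_fst[OF has_derivative_ident]]
  have "((\<lambda>q. (fst p + \<rho> (snd p) (fst q), snd p * snd q)) has_derivative
      (\<lambda>w. (0 + \<rho> (snd p) (fst w), snd p * snd w))) (at (0, 1))"
    by (intro has_derivative_Pair has_derivative_add has_derivative_const 1 has_derivative_mult_right
        has_derivative_snd has_derivative_ident)
  from frechet_derivative_at[OF this] show ?thesis by (simp add: left_field_def fun_eq_iff)
qed

lemma lie_bracket_\<G>: "lie_bracket v w = (snd v *\<^sub>R N (fst w) - snd w *\<^sub>R N (fst v), 0)"
proof -
  have "frechet_derivative (left_field w) (at (0, 1)) v = (snd v *\<^sub>R N (fst w), snd v * snd w)" for v w
  proof -
    have 1: "(snd has_derivative snd) (at (0 :: 'v, 1 :: real))"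
      by (auto intro!: derivative_eq_intros)
    have 2: "((\<lambda>s. \<rho> s (fst w)) has_derivative (\<lambda>s. s *\<^sub>R N (fst w))) (at (snd (0 :: 'v, 1 :: real)))"
      using \<rho>_deriv by (simp add: has_vector_derivative_def)
    have 3: "((\<lambda>p :: 'v \<times> real. \<rho> (snd p) (fst w)) has_derivative (\<lambda>v. snd v *\<^sub>R N (fst w))) (at (0, 1))"
      using has_derivative_compose[OF 1 2] .
    have "((\<lambda>p :: 'v \<times> real. (\<rho> (snd p) (fst w), snd p * snd w)) has_derivative
        (\<lambda>v. (snd v *\<^sub>R N (fst w), snd v * snd w))) (at (0, 1))"
      by (rule has_derivative_Pair[OF 3 has_derivative_mult_left[OF 1]])
    moreover have "left_field w = (\<lambda>p. (\<rho> (snd p) (fst w), snd p * snd w))"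
      by (rule ext) (rule left_field_\<G>)
    ultimately have "(left_field w has_derivative (\<lambda>v. (snd v *\<^sub>R N (fst w), snd v * snd w))) (at (0, 1))"
      by simp
    from frechet_derivative_at[OF this, symmetric] show ?thesis by simp
  qed
  then show ?thesis by (simp add: lie_bracket_def)
qed

text \<open>Along a curve in the subgroup, \<open>v - c s\<close> stays in \<open>V\<close>, hence
  so does its derivative; this gives the upper bound. The lower bound needs an explicit curve for
  each candidate vector.\<close>

lemma tangent_crossed:
  assumes d: "crossed_data V K c c'"
  shows "tangent (crossed V K c) = {(r *\<^sub>R c' + v, r) | r v. v \<in> V \<and> (K = {1} \<longrightarrow> r = 0)}"
proof (rule subset_antisym; rule subsetI)
  have V: "subspace V" and sm: "smooth_on H c" and c': "(c has_vector_derivative c') (at 1)"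
    and K: "K = {1} \<or> K = H"
    using d by (auto simp: crossed_data_def)
  {
    fix z assume "z \<in> tangent (crossed V K c)"
    then obtain g where g: "range g \<subseteq> crossed V K c" "g 0 = (0, 1)" "(g has_vector_derivative z) (at 0)"
      by (auto simp: tangent_def)
    have s: "((\<lambda>t. snd (g t)) has_vector_derivative snd z) (at 0)"
      using bounded_linear.has_vector_derivative[OF bounded_linear_snd g(3)] .
    have f: "((\<lambda>t. fst (g t)) has_vector_derivative fst z) (at 0)"
      using bounded_linear.has_vector_derivative[OF bounded_linear_fst g(3)] .
    have "(c \<circ> (\<lambda>t. snd (g t)) has_vector_derivative snd z *\<^sub>R c') (at 0)"
      by (rule vector_diff_chain_at[OF s]) (simp add: g(2) c')
    then have *: "((\<lambda>t. fst (g t) - c (snd (g t))) has_vector_derivative fst z - snd z *\<^sub>R c') (at 0)"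
      using f by (intro has_vector_derivative_diff) (simp_all add: o_def)
    have mem: "snd (g t) \<in> K" "fst (g t) - c (snd (g t)) \<in> V" for t
    proof -
      have "g t \<in> crossed V K c" using g(1) by blast
      then show "snd (g t) \<in> K" "fst (g t) - c (snd (g t)) \<in> V" by (simp_all add: mem_crossed)
    qed
    have "fst z - snd z *\<^sub>R c' \<in> V"
      by (rule has_vector_derivative_in_subspace[OF V mem(2) *])
    moreover have "snd z = 0" if "K = {1}"
    proof -
      have "((\<lambda>t. 1) has_vector_derivative snd z) (at (0::real))"
        using s mem(1) that by simp
      then show ?thesis using vector_derivative_unique_at[OF _ has_vector_derivative_const] by blast
    qed
    moreover have "z = (snd z *\<^sub>R c' + (fst z - snd z *\<^sub>R c'), snd z)" by simp
    ultimately show "z \<in> {(r *\<^sub>R c' + v, r) | r v. v \<in> V \<and> (K = {1} \<longrightarrow> r = 0)}" by blast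
  next
    fix z assume "z \<in> {(r *\<^sub>R c' + v, r) | r v. v \<in> V \<and> (K = {1} \<longrightarrow> r = 0)}"
    then obtain r v where z: "z = (r *\<^sub>R c' + v, r)" "v \<in> V" "K = {1} \<longrightarrow> r = 0" by blast
    \<comment> \<open>The exponential keeps the scalar in \<open>H\<close> for all times. When
      \<open>K = {1}\<close>, \<open>r = 0\<close> keeps it equal to 1.\<close>
    define g where "g t = (c (exp (r * t)) + t *\<^sub>R v, exp (r * t))" for t
    have e: "(exp (r * t) :: real) \<in> H" for t by (rule H(6)) simp
    have "smooth_on UNIV g"
      unfolding g_def using e
      by (intro smooth_on_Pair smooth_on_add smooth_on_compose[OF open_UNIV H(1) sm] smooth_on_exp_compose
          smooth_on_mult smooth_on_scaleR smooth_on_const smooth_on_ident open_UNIV)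
    moreover have "range g \<subseteq> crossed V K c"
    proof (rule image_subsetI)
      fix t
      have "exp (r * t) \<in> K" using z(3) K e by auto
      then show "g t \<in> crossed V K c"
        by (simp add: g_def mem_crossed subspace_scale[OF V z(2)])
    qed
    moreover have "g 0 = \<one>\<^bsub>\<G>\<^esub>" by (simp add: g_def crossed_data_one[OF d])
    moreover have "(g has_vector_derivative z) (at 0)"
    proof -
      have e': "((\<lambda>t. exp (r * t)) has_vector_derivative r) (at (0::real))"
        by (auto intro!: derivative_eq_intros simp: has_real_derivative_iff_has_vector_derivative[symmetric])
      have "(c \<circ> (\<lambda>t. exp (r * t)) has_vector_derivative r *\<^sub>R c') (at 0)"
        by (rule vector_diff_chain_at[OF e']) (simp add: c')
      then have "((\<lambda>t. c (exp (r * t)) + t *\<^sub>R v) has_vector_derivative r *\<^sub>R c' + v) (at 0)"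
        by (intro has_vector_derivative_add) (auto simp: o_def intro!: derivative_eq_intros)
      then show ?thesis
        unfolding g_def z(1) using e' by (rule has_vector_derivative_Pair)
    qed
    ultimately show "z \<in> tangent (crossed V K c)"
      unfolding tangent_def by blast
  }
qed

end

text \<open>\<open>Z\<close> is a null set outside which every element factors. It is empty in all
  applications except those with the cocycle \<open>1 - s\<close> in the first coordinate, where it
  is a hyperplane.\<close>

lemma (in scalar_action) exponentiable_crossed:
  fixes P :: "('v \<times> real) lie_pair" and \<kappa> :: "'v \<times> real \<Rightarrow> real \<times> real \<times> real \<times> real"
  assumes \<kappa>: "chart_embedding \<kappa> \<kappa>'"
    and d1: "crossed_data V1 K1 c1 c1'"
    and d2: "crossed_data V2 K2 c2 c2'"
    and int: "crossed V1 K1 c1 \<inter> crossed V2 K2 c2 \<subseteq> {(0, 1)}"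
    and prod: "negligible Z" "\<And>v s. s \<in> H \<Longrightarrow> (v, s) \<notin> Z \<Longrightarrow>
      \<exists>p\<in>crossed V1 K1 c1. \<exists>q\<in>crossed V2 K2 c2. p \<otimes>\<^bsub>\<G>\<^esub> q = (v, s)"
    and P: "ambient P = UNIV" and T: "linear T" "bij T"
    and bracket: "\<And>v w. T (bracket P v w) = (snd (T v) *\<^sub>R N (fst (T w)) - snd (T w) *\<^sub>R N (fst (T v)), 0)"
    and parts: "T ` part1 P = {(r *\<^sub>R c1' + v, r) | r v. v \<in> V1 \<and> (K1 = {1} \<longrightarrow> r = 0)}"
      "T ` part2 P = {(r *\<^sub>R c2' + v, r) | r v. v \<in> V2 \<and> (K2 = {1} \<longrightarrow> r = 0)}"
  shows "exponentiable_le2 P"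
proof -
  interpret scalar_action_chart E N H \<kappa> \<kappa>'
    by unfold_locales (rule \<kappa>)
  have "crossed V1 K1 c1 \<inter> crossed V2 K2 c2 = {\<one>\<^bsub>\<G>\<^esub>}"
    using int subgroup.one_closed[OF subgroup_crossed[OF d1]] subgroup.one_closed[OF subgroup_crossed[OF d2]]
    by auto
  moreover have "negligible (carrier \<G> - {p \<otimes>\<^bsub>\<G>\<^esub> q | p q. p \<in> crossed V1 K1 c1 \<and> q \<in> crossed V2 K2 c2})"
  proof (rule negligible_subset[OF prod(1)], rule subsetI, rule ccontr)
    fix x assume x: "x \<in> carrier \<G> - {p \<otimes>\<^bsub>\<G>\<^esub> q | p q. p \<in> crossed V1 K1 c1 \<and> q \<in> crossed V2 K2 c2}" "x \<notin> Z"
    obtain v s where vs: "x = (v, s)" by (cases x)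
    then obtain p q where "p \<in> crossed V1 K1 c1" "q \<in> crossed V2 K2 c2" "p \<otimes>\<^bsub>\<G>\<^esub> q = x"
      using prod(2)[of s v] x by auto
    then show False using x(1) by blast
  qed
  ultimately show ?thesis
    using parts bracket
    by (intro exponentiable_le2I[OF chart_group_axioms subgroup_crossed[OF d1] closedin_crossed[OF d1]
        subgroup_crossed[OF d2] closedin_crossed[OF d2] _ _ two_pieces_\<G> two_pieces_crossed[OF d1]
        two_pieces_crossed[OF d2] P T])
      (simp_all only: tangent_crossed[OF d1] tangent_crossed[OF d2] lie_bracket_\<G>)
qed

context scalar_action
begin

lemma H_neq: "H \<noteq> {1}"
proof -
  have "2 \<in> H" by (rule H(6)) simp
  then show ?thesis by auto
qed

lemma exponentiable_normal_first:
  fixes P :: "('v \<times> real) lie_pair" and \<kappa> :: "'v \<times> real \<Rightarrow> real \<times> real \<times> real \<times> real"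
  assumes \<kappa>: "chart_embedding \<kappa> \<kappa>'" and P: "ambient P = UNIV" and T: "linear T" "bij T"
    and bracket: "\<And>v w. T (bracket P v w) = (snd (T v) *\<^sub>R N (fst (T w)) - snd (T w) *\<^sub>R N (fst (T v)), 0)"
    and parts: "T ` part1 P = UNIV \<times> {0}" "T ` part2 P = {0} \<times> UNIV"
  shows "exponentiable_le2 P"
proof (rule exponentiable_crossed[OF \<kappa> _ _ _ _ _ P T bracket])
  show "crossed_data UNIV {1} (\<lambda>_. 0) 0" "crossed_data {0} H (\<lambda>_. 0) 0"
    by (simp_all add: crossed_data_def \<rho>_zero smooth_on_const H(1) linear_0[OF linear_E])
  show "crossed UNIV {1} (\<lambda>_. 0) \<inter> crossed {0} H (\<lambda>_. 0) \<subseteq> {(0, 1)}"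
    by (auto simp: mem_crossed)
  show "negligible {}" by simp
  show "\<exists>p\<in>crossed UNIV {1} (\<lambda>_. 0). \<exists>q\<in>crossed {0} H (\<lambda>_. 0). p \<otimes>\<^bsub>\<G>\<^esub> q = (v, s)"
    if "s \<in> H" for v s
    by (rule bexI[of _ "(v, 1)"], rule bexI[of _ "(0, s)"]) (use that in \<open>simp_all add: mem_crossed \<rho>_zero\<close>)
  show "T ` part1 P = {(r *\<^sub>R 0 + v, r) | r v. v \<in> UNIV \<and> (({1} :: real set) = {1} \<longrightarrow> r = 0)}"
    unfolding parts by auto
  show "T ` part2 P = {(r *\<^sub>R 0 + v, r) | r v. v \<in> {0} \<and> (H = {1} \<longrightarrow> r = 0)}"
    unfolding parts using H_neq by auto
qed

text \<open>The case of \<open>A\<close> inside the abelian normal subgroup, where part 1 consists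
  of an invariant complement together with the scalars.\<close>

lemma exponentiable_normal_second:
  fixes P :: "('v \<times> real) lie_pair" and \<kappa> :: "'v \<times> real \<Rightarrow> real \<times> real \<times> real \<times> real"
  assumes \<kappa>: "chart_embedding \<kappa> \<kappa>'" and P: "ambient P = UNIV" and T: "linear T" "bij T"
    and bracket: "\<And>v w. T (bracket P v w) = (snd (T v) *\<^sub>R N (fst (T w)) - snd (T w) *\<^sub>R N (fst (T v)), 0)"
    and parts: "T ` part1 P = V1 \<times> UNIV" "T ` part2 P = V2 \<times> {0}"
    and V: "subspace V1" "subspace V2" "V1 \<inter> V2 \<subseteq> {0}" "\<And>v. \<exists>a\<in>V1. \<exists>b\<in>V2. v = a + b"
    and inv: "\<And>t v. v \<in> V1 \<Longrightarrow> E t v \<in> V1"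
  shows "exponentiable_le2 P"
proof (rule exponentiable_crossed[OF \<kappa> _ _ _ _ _ P T bracket])
  show d: "crossed_data V1 H (\<lambda>_. 0) 0" and "crossed_data V2 {1} (\<lambda>_. 0) 0"
    using V inv by (simp_all add: crossed_data_def \<rho>_zero smooth_on_const H(1))
  show "crossed V1 H (\<lambda>_. 0) \<inter> crossed V2 {1} (\<lambda>_. 0) \<subseteq> {(0, 1)}"
    using V(3) by (auto simp: mem_crossed)
  show "negligible {}" by simp
  show "\<exists>p\<in>crossed V1 H (\<lambda>_. 0). \<exists>q\<in>crossed V2 {1} (\<lambda>_. 0). p \<otimes>\<^bsub>\<G>\<^esub> q = (v, s)"
    if s: "s \<in> H" for v s
  proof -
    \<comment> \<open>In the product the scalar \<open>s\<close> of the left factor acts on the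
      right factor, so \<open>v\<close> is decomposed only after applying the inverse of
      \<open>\<rho> s\<close>.\<close>
    obtain a b where ab: "a \<in> V1" "b \<in> V2" "\<rho> (inverse s) v = a + b" using V(4) by blast
    have "v = \<rho> s a + \<rho> s b"
      using \<rho>_inverse(1)[OF s, of v] by (simp add: ab(3) \<rho>_add)
    then show ?thesis
      using s ab crossed_data_invariant[OF d s ab(1)]
      by (intro bexI[of _ "(\<rho> s a, s)"] bexI[of _ "(b, 1)"]) (simp_all add: mem_crossed)
  qed
  show "T ` part2 P = {(r *\<^sub>R 0 + v, r) | r v. v \<in> V2 \<and> (({1} :: real set) = {1} \<longrightarrow> r = 0)}"
    unfolding parts by auto
  show "T ` part1 P = {(r *\<^sub>R 0 + v, r) | r v. v \<in> V1 \<and> (H = {1} \<longrightarrow> r = 0)}"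
    unfolding parts using H_neq by auto
qed

text \<open>With \<open>r * t = s\<close>, the factorisation must be
  \<open>(v - \<rho> r (c t), r)\<close> times \<open>(c t, t)\<close>. By the cocycle identity
  \<open>\<rho> r (c t)\<close> is \<open>c s - c r\<close>, so the left factor has its vector in
  the kernel of \<open>l\<close> iff \<open>l (c r) = l (c s) - l v\<close>: one real equation for
  \<open>r\<close>.\<close>

lemma exponentiable_cocycle:
  fixes P :: "('v \<times> real) lie_pair" and \<kappa> :: "'v \<times> real \<Rightarrow> real \<times> real \<times> real \<times> real"
  assumes \<kappa>: "chart_embedding \<kappa> \<kappa>'" and P: "ambient P = UNIV" and T: "linear T" "bij T"
    and bracket: "\<And>v w. T (bracket P v w) = (snd (T v) *\<^sub>R N (fst (T w)) - snd (T w) *\<^sub>R N (fst (T v)), 0)"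
    and parts: "T ` part1 P = {v. l v = 0} \<times> UNIV" "T ` part2 P = range (\<lambda>r. (r *\<^sub>R c', r))"
    and l: "linear l" and inv: "\<And>t v. l v = (0::real) \<Longrightarrow> l (E t v) = 0"
    and c: "smooth_on H c" "\<And>s t. s \<in> H \<Longrightarrow> t \<in> H \<Longrightarrow> c (s * t) = c s + \<rho> s (c t)"
      "(c has_vector_derivative c') (at 1)"
    and lc: "\<And>s. s \<in> H \<Longrightarrow> l (c s) = 0 \<Longrightarrow> s = 1"
    and Z: "negligible Z" "\<And>v s. s \<in> H \<Longrightarrow> (v, s) \<notin> Z \<Longrightarrow> \<exists>r\<in>H. l (c r) = l (c s) - l v"
  shows "exponentiable_le2 P"
proof (rule exponentiable_crossed[OF \<kappa> _ _ _ Z(1) _ P T bracket])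
  let ?V = "{v. l v = 0}"
  have "subspace ?V"
    by (simp add: subspace_def linear_0[OF l] linear_add[OF l] linear_cmul[OF l])
  then show "crossed_data ?V H (\<lambda>_. 0) 0"
    using inv by (simp add: crossed_data_def \<rho>_zero smooth_on_const H(1))
  show "crossed_data {0} H c c'"
    using c by (simp add: crossed_data_def linear_0[OF linear_E])
  show "crossed ?V H (\<lambda>_. 0) \<inter> crossed {0} H c \<subseteq> {(0, 1)}"
  proof (rule subsetI)
    fix x assume x: "x \<in> crossed ?V H (\<lambda>_. 0) \<inter> crossed {0} H c"
    obtain v s where vs: "x = (v, s)" by (cases x)
    have "(v, s) \<in> crossed ?V H (\<lambda>_. 0)" using x vs by blast
    then have sl: "s \<in> H" "l v = 0" by (simp_all add: mem_crossed)
    have "(v, s) \<in> crossed {0} H c" using x vs by blast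
    then have v: "v = c s" by (simp add: mem_crossed)
    have "s = 1" by (rule lc[OF sl(1)]) (rule sl(2)[unfolded v])
    moreover have "c 1 = 0" using c(2)[OF H(2) H(2)] by (simp add: \<rho>_one)
    ultimately show "x \<in> {(0, 1)}" using vs v by simp
  qed
  show "\<exists>p\<in>crossed ?V H (\<lambda>_. 0). \<exists>q\<in>crossed {0} H c. p \<otimes>\<^bsub>\<G>\<^esub> q = (v, s)"
    if s: "s \<in> H" and vs: "(v, s) \<notin> Z" for v s
  proof -
    obtain r where r: "r \<in> H" "l (c r) = l (c s) - l v" using Z(2)[OF s vs] by blast
    let ?t = "inverse r * s"
    have t: "?t \<in> H" using r(1) s H(4,5) by blast
    have rt: "r * ?t = s" using H(3)[OF r(1)] by simp
    have "c s = c r + \<rho> r (c ?t)" using c(2)[OF r(1) t] rt by simp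
    then have "l (v - \<rho> r (c ?t)) = 0"
      using r(2) by (simp add: linear_diff[OF l] linear_add[OF l])
    then show ?thesis
      using r(1) t rt by (intro bexI[of _ "(v - \<rho> r (c ?t), r)"] bexI[of _ "(c ?t, ?t)"]) (simp_all add: mem_crossed)
  qed
  show "T ` part1 P = {(r *\<^sub>R 0 + v, r) | r v. v \<in> ?V \<and> (H = {1} \<longrightarrow> r = 0)}"
    unfolding parts using H_neq by auto
  show "T ` part2 P = {(r *\<^sub>R c' + v, r) | r v. v \<in> {0} \<and> (H = {1} \<longrightarrow> r = 0)}"
    unfolding parts using H_neq by auto
qed

end

lemma ex_eq_uminus: "\<exists>y. x = - (y :: real)"
  by (rule exI[of _ "- x"]) simp

subsection \<open>The pairs with a semidirect product as ambient group\<close>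

lemma chart_embedding_2:
  "chart_embedding (\<lambda>p :: real \<times> real. (fst p, snd p, 0 :: real, 0 :: real)) (\<lambda>x. (fst x, fst (snd x)))"
  unfolding chart_embedding_def by (auto intro!: continuous_intros)

lemma chart_embedding_3:
  "chart_embedding (\<lambda>p :: (real \<times> real) \<times> real. (fst (fst p), snd (fst p), snd p, 0 :: real))
    (\<lambda>x. ((fst x, fst (snd x)), fst (snd (snd x))))"
  unfolding chart_embedding_def by (auto intro!: continuous_intros)

definition scaling :: "real \<Rightarrow> real \<Rightarrow> real \<Rightarrow> real"
  where "scaling p t x = exp (p * t) * x"

lemma scalar_action_scaling:
  assumes "H = {0<..} \<or> H = - {0}"
  shows "scalar_action (scaling p) (\<lambda>x. p * x) H"
proof (rule scalar_action.intro)
  show "linear (scaling p t)" for t by (rule linearI) (simp_all add: scaling_def algebra_simps)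
  show "smooth_on UNIV (\<lambda>z. scaling p (fst z) (snd z))"
    unfolding scaling_def
    by (intro smooth_on_mult smooth_on_exp_compose smooth_on_const smooth_on_fst smooth_on_snd smooth_on_ident open_UNIV)
  show "((\<lambda>t. scaling p t v) has_vector_derivative p * v) (at 0)" for v
    unfolding scaling_def by (auto intro!: derivative_eq_intros simp: has_real_derivative_iff_has_vector_derivative[symmetric])
qed (use assms in \<open>simp_all add: scaling_def exp_add algebra_simps\<close>)

text \<open>This is the exponential of \<open>t\<close> times the matrix with diagonal entries
  \<open>p\<close>, \<open>r\<close> and lower entry \<open>q\<close>, provided that
  \<open>q = 0\<close> or \<open>p = r\<close>. In the remaining case a change of basis diagonalises
  the matrix.\<close>

definition triangular :: "real \<Rightarrow> real \<Rightarrow> real \<Rightarrow> real \<Rightarrow> real \<times> real \<Rightarrow> real \<times> real"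
  where "triangular p q r t v = (exp (p * t) * fst v, exp (r * t) * (snd v + q * t * fst v))"

lemma scalar_action_triangular:
  assumes H: "H = {0<..} \<or> H = - {0}" and pqr: "q = 0 \<or> p = r"
  shows "scalar_action (triangular p q r) (\<lambda>v. (p * fst v, q * fst v + r * snd v)) H"
proof (rule scalar_action.intro)
  show "linear (triangular p q r t)" for t by (rule linearI) (simp_all add: triangular_def algebra_simps)
  show "smooth_on UNIV (\<lambda>z. triangular p q r (fst z) (snd z))"
    unfolding triangular_def
    by (intro smooth_on_mult smooth_on_Pair smooth_on_add smooth_on_exp_compose smooth_on_const smooth_on_fst
        smooth_on_snd smooth_on_ident open_UNIV)
  show "((\<lambda>t. triangular p q r t v) has_vector_derivative (p * fst v, q * fst v + r * snd v)) (at 0)" for v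
  proof -
    have "((\<lambda>t. exp (p * t) * fst v) has_vector_derivative p * fst v) (at 0)"
      "((\<lambda>t. exp (r * t) * (snd v + q * t * fst v)) has_vector_derivative q * fst v + r * snd v) (at 0)"
      by (auto intro!: derivative_eq_intros simp: has_real_derivative_iff_has_vector_derivative[symmetric])
    then show ?thesis unfolding triangular_def by (rule has_vector_derivative_Pair)
  qed
  show "triangular p q r (s + t) v = triangular p q r s (triangular p q r t v)" for s t v
    using pqr by (auto simp: triangular_def exp_add algebra_simps)
qed (use H in \<open>simp_all add: triangular_def\<close>)

lemma bij_by_inverse:
  assumes "\<And>x. S (T x) = x" "\<And>y. T (S y) = y"
  shows "bij T"
  using assms by (intro o_bij[of S]) (auto simp: fun_eq_iff)

lemma ambient_pair1 [simp]: "ambient (pair1 b x) = UNIV"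
  and part1_pair1 [simp]: "part1 (pair1 b x) = UNIV \<times> {0}"
  and part2_pair1 [simp]: "part2 (pair1 b x) = {0} \<times> UNIV"
  and bracket_pair1: "bracket (pair1 b x) v w =
    (snd w * (fst v * b) - snd v * (fst w * b), snd w * (fst v * x) - snd v * (fst w * x))"
  by (simp_all add: pair1_def pair_of_def case_prod_beta)

lemma exponentiable_pair1_chi_0: "exponentiable_le2 (pair1 p 0)"
proof -
  \<comment> \<open>\<open>A\<close> acts as \<open>- h\<close>: in the semidirect product the
    bracket of \<open>h\<close> with \<open>v\<close> is \<open>N v\<close>, whereas here
    \<open>\<beta>\<close> is the bracket with \<open>A\<close> on the right.\<close>
  let ?T = "\<lambda>v :: real \<times> real. (fst v, - snd v)"
  interpret scalar_action "scaling p" "\<lambda>x. p * x" "{0<..}" by (rule scalar_action_scaling) simp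
  have lin: "linear ?T" by (rule linearI) auto
  show ?thesis
  proof (rule exponentiable_normal_first[OF chart_embedding_2 ambient_pair1 lin])
    show "bij ?T" by (rule bij_by_inverse[of ?T]) auto
    show "?T ` part1 (pair1 p 0) = UNIV \<times> {0}" by (force simp: image_iff)
    show "?T ` part2 (pair1 p 0) = {0} \<times> UNIV" by (auto simp: image_iff zero_prod_def ex_eq_uminus)
  qed (simp add: bracket_pair1 algebra_simps)
qed

lemma exponentiable_pair1_0_1: "exponentiable_le2 (pair1 0 1)"
proof -
  let ?T = "\<lambda>v :: real \<times> real. (snd v, fst v)"
  interpret scalar_action "scaling 1" "\<lambda>x. 1 * x" "{0<..}" by (rule scalar_action_scaling) simp
  have lin: "linear ?T" by (rule linearI) auto
  show ?thesis
  proof (rule exponentiable_normal_second[OF chart_embedding_2 ambient_pair1 lin])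
    show "bij ?T" by (rule bij_by_inverse[of ?T]) auto
    show "?T ` part1 (pair1 0 1) = {0} \<times> UNIV" by (force simp: image_iff)
    show "?T ` part2 (pair1 0 1) = UNIV \<times> {0}" by (force simp: image_iff)
    show "subspace {0 :: real}" "subspace (UNIV :: real set)" by simp_all
    show "scaling 1 t v \<in> {0}" if "v \<in> {0}" for t v using that by (simp add: scaling_def)
  qed (simp_all add: bracket_pair1 algebra_simps)
qed

lemma negligible_hyperplane_prod:
  "negligible {x :: 'a::euclidean_space \<times> real. fst x \<bullet> a + snd x * b = 0}" if "b \<noteq> 0"
proof -
  have "{x :: 'a \<times> real. fst x \<bullet> a + snd x * b = 0} = {x. (a, b) \<bullet> x = 0}"
    by (auto simp: inner_prod_def inner_commute mult.commute)
  then show ?thesis using negligible_hyperplane[of "(a, b)" 0] that by (simp add: zero_prod_def)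
qed

text \<open>\<open>X + A\<close> is an eigenvector \<open>e\<close> of \<open>X\<close>, so
  \<open>X\<close> and \<open>A\<close> become \<open>h\<close> and \<open>e - h\<close>. The
  cocycle \<open>1 - s\<close> is the coboundary of \<open>e\<close>: the subgroup of
  \<open>A\<close> is the group of scalars conjugated by the translation by \<open>e\<close>. The
  equation for \<open>r\<close> reads \<open>r = s + v\<close>, and \<open>Z\<close> is where this
  vanishes.\<close>

lemma exponentiable_pair1_1_1: "exponentiable_le2 (pair1 1 1)"
proof -
  let ?T = "\<lambda>v :: real \<times> real. (snd v, fst v - snd v)"
  let ?S = "\<lambda>v :: real \<times> real. (fst v + snd v, fst v)"
  interpret scalar_action "scaling 1" "\<lambda>x. 1 * x" "- {0}" by (rule scalar_action_scaling) simp
  have lin: "linear ?T" by (rule linearI) (auto simp: algebra_simps)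
  have \<rho>: "\<rho> s v = s * v" if "s \<noteq> 0" for s v
    using that by (simp add: \<rho>_def scaling_def sgn_mult_abs abs_sgn mult.assoc[symmetric]) (simp add: sgn_if)
  show ?thesis
  proof (rule exponentiable_cocycle[where l = "\<lambda>v. v" and c = "\<lambda>s. 1 - s" and c' = "- 1"
        and Z = "{x. fst x \<bullet> 1 + snd x * 1 = 0}", OF chart_embedding_2 ambient_pair1 lin])
    show "bij ?T" by (rule bij_by_inverse[of ?S]) auto
    show "?T ` part1 (pair1 1 1) = {v. v = 0} \<times> UNIV" by (force simp: image_iff)
    show "?T ` part2 (pair1 1 1) = range (\<lambda>r. (r *\<^sub>R - 1, r))"
      by (auto simp: image_iff intro: exI[of _ "- _"])
    show "smooth_on (- {0}) (\<lambda>s::real. 1 - s)"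
      by (intro smooth_on_diff smooth_on_const smooth_on_ident) auto
    show "((\<lambda>s. 1 - s) has_vector_derivative - 1) (at (1::real))"
      by (auto intro!: derivative_eq_intros)
    show "negligible {x :: real \<times> real. fst x \<bullet> 1 + snd x * 1 = 0}"
      by (rule negligible_hyperplane_prod) simp
    show "\<exists>r\<in>- {0}. 1 - r = 1 - s - v" if "(v, s) \<notin> {x. fst x \<bullet> 1 + snd x * 1 = 0}" for v s :: real
      using that by (intro bexI[of _ "s + v"]) auto
  qed (simp_all add: bracket_pair1 algebra_simps scaling_def \<rho> linearI)
qed

lemma ambient_pair2 [simp]: "ambient (pair2 b X Y x y) = UNIV"
  and part1_pair2 [simp]: "part1 (pair2 b X Y x y) = UNIV \<times> {0}"
  and part2_pair2 [simp]: "part2 (pair2 b X Y x y) = {0} \<times> UNIV"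
  and bracket_pair2: "bracket (pair2 b X Y x y) v w =
    ((fst (fst v) * snd (fst w) - snd (fst v) * fst (fst w)) *\<^sub>R b
      + snd w *\<^sub>R (fst (fst v) *\<^sub>R X + snd (fst v) *\<^sub>R Y) - snd v *\<^sub>R (fst (fst w) *\<^sub>R X + snd (fst w) *\<^sub>R Y),
     snd w * (fst (fst v) * x + snd (fst v) * y) - snd v * (fst (fst w) * x + snd (fst w) * y))"
  by (simp_all add: pair2_def pair_of_def case_prod_beta)

lemma exponentiable_pair2_abelian:
  assumes "q = 0 \<or> p = r"
  shows "exponentiable_le2 (pair2 0 (p, q) (0, r) 0 0)"
proof -
  let ?P = "pair2 0 (p, q) (0, r) 0 0"
  let ?T = "\<lambda>v :: (real \<times> real) \<times> real. (fst v, - snd v)"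
  interpret scalar_action "triangular p q r" "\<lambda>v. (p * fst v, q * fst v + r * snd v)" "{0<..}"
    by (rule scalar_action_triangular) (use assms in simp_all)
  have lin: "linear ?T" by (rule linearI) auto
  show ?thesis
  proof (rule exponentiable_normal_first[OF chart_embedding_3 ambient_pair2 lin])
    show "bij ?T" by (rule bij_by_inverse[of ?T]) auto
    show "?T ` part1 ?P = UNIV \<times> {0}" by (force simp: image_iff)
    show "?T ` part2 ?P = {0} \<times> UNIV" by (auto simp: image_iff zero_prod_def ex_eq_uminus)
  qed (auto simp: bracket_pair2 algebra_simps)
qed

lemma exponentiable_pair2_ideal:
  "exponentiable_le2 (pair2 (0, d) (0, e) 0 f 0)"
proof -
  let ?P = "pair2 (0, d) (0, e) 0 f 0"
  \<comment> \<open>\<open>A = e1 + k e2\<close> and \<open>Y = e2\<close>, where \<open>e1\<close> is an eigenvector of \<open>ad X\<close> unless \<open>d = f\<close>.\<close>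
  define q where "q = (if d = f then e else 0)"
  define k where "k = (if d = f then 0 else e / (d - f))"
  let ?T = "\<lambda>v :: (real \<times> real) \<times> real. ((snd v, snd (fst v) + k * snd v), fst (fst v))"
  let ?S = "\<lambda>v :: (real \<times> real) \<times> real. ((snd v, snd (fst v) - k * fst (fst v)), fst (fst v))"
  \<comment> \<open>The second coordinate of \<open>[X,A] = e Y + f A\<close> once \<open>A\<close>
    is written as \<open>e1 + k e2\<close>.\<close>
  have e: "q + k * d = e + k * f" by (auto simp: q_def k_def field_simps)
  interpret scalar_action "triangular f q d" "\<lambda>v. (f * fst v, q * fst v + d * snd v)" "{0<..}"
    by (rule scalar_action_triangular) (auto simp: q_def)
  have lin: "linear ?T" by (rule linearI) (auto simp: algebra_simps)
  let ?V1 = "{0} \<times> UNIV :: (real \<times> real) set" and ?V2 = "range (\<lambda>x. (x, k * x))"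
  show ?thesis
  proof (rule exponentiable_normal_second[where ?V1.0 = ?V1 and ?V2.0 = ?V2, OF chart_embedding_3 ambient_pair2 lin])
    show "bij ?T" by (rule bij_by_inverse[of ?S]) auto
    show "?T ` part1 ?P = ?V1 \<times> UNIV" by (force simp: image_iff)
    show "?T ` part2 ?P = ?V2 \<times> {0}" by (force simp: image_iff)
    show "subspace ?V1" "subspace ?V2"
      by (auto simp: subspace_def image_iff zero_prod_def distrib_left[symmetric])
    show "?V1 \<inter> ?V2 \<subseteq> {0}" by (auto simp: zero_prod_def)
    show "\<exists>a\<in>?V1. \<exists>b\<in>?V2. v = a + b" for v
      by (intro bexI[of _ "(0, snd v - k * fst v)"] bexI[of _ "(fst v, k * fst v)"]) (auto simp: prod_eq_iff)
    show "triangular f q d t v \<in> ?V1" if "v \<in> ?V1" for t v using that by (auto simp: triangular_def)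
    show "?T (bracket ?P v w) = (snd (?T v) *\<^sub>R (f * fst (fst (?T w)), q * fst (fst (?T w)) + d * snd (fst (?T w)))
      - snd (?T w) *\<^sub>R (f * fst (fst (?T v)), q * fst (fst (?T v)) + d * snd (fst (?T v))), 0)" for v w
    proof -
      obtain x y a x' y' a' where vw: "v = ((x, y), a)" "w = ((x', y'), a')" by (metis prod.exhaust)
      have "d * (x * y' - y * x') + (a' * x - a * x') * e + k * (f * (a' * x - a * x')) =
          x * (q * a' + d * (y' + k * a')) - x' * (q * a + d * (y + k * a))"
      proof -
        have "x * (q * a' + d * (y' + k * a')) - x' * (q * a + d * (y + k * a)) =
            d * (x * y' - y * x') + (a' * x - a * x') * (q + k * d)" by algebra
        also have "\<dots> = d * (x * y' - y * x') + (a' * x - a * x') * (e + k * f)" by (simp only: e)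
        finally show ?thesis by algebra
      qed
      then show ?thesis by (simp add: vw bracket_pair2 algebra_simps)
    qed
  qed
qed

text \<open>Common to \<open>E25\<close> with \<open>p = 0\<close> and \<open>E41\<close> with
  \<open>p = 1\<close>: the vectors \<open>X + A\<close> and \<open>Y\<close> commute and span an
  ideal, while neither \<open>X\<close> nor \<open>A\<close> belongs to it. The two entries differ
  in the cocycle.\<close>

lemma exponentiable_pair2_normal_second:
  fixes c :: "real \<Rightarrow> real \<times> real" and Z :: "((real \<times> real) \<times> real) set"
  assumes H: "H = {0<..} \<or> H = - {0}" and bd: "b = 0 \<or> p = d"
    and c: "smooth_on H c" "\<And>s t. s \<in> H \<Longrightarrow> t \<in> H \<Longrightarrow> c (s * t) = c s + scalar_action.\<rho> (triangular p b d) s (c t)"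
      "(c has_vector_derivative (- 1, 0)) (at 1)"
    and lc: "\<And>s. s \<in> H \<Longrightarrow> fst (c s) = 0 \<Longrightarrow> s = 1"
    and Z: "negligible Z" "\<And>v s. s \<in> H \<Longrightarrow> (v, s) \<notin> Z \<Longrightarrow> \<exists>r\<in>H. fst (c r) = fst (c s) - fst v"
  shows "exponentiable_le2 (pair2 (0, d) (p, b) (0, d) p 0)"
proof -
  let ?P = "pair2 (0, d) (p, b) (0, d) p 0"
  \<comment> \<open>\<open>A = e1 - X\<close>: the one-parameter group of \<open>A\<close> is a graph over the one of \<open>X\<close>.\<close>
  let ?T = "\<lambda>v :: (real \<times> real) \<times> real. ((snd v, snd (fst v)), fst (fst v) - snd v)"
  let ?S = "\<lambda>v :: (real \<times> real) \<times> real. ((snd v + fst (fst v), snd (fst v)), fst (fst v))"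
  interpret scalar_action "triangular p b d" "\<lambda>v. (p * fst v, b * fst v + d * snd v)" H
    by (rule scalar_action_triangular[OF H bd])
  have lin: "linear ?T" by (rule linearI) (auto simp: algebra_simps)
  show ?thesis
  proof (rule exponentiable_cocycle[where l = fst and c = c and c' = "(- 1, 0)" and Z = Z,
      OF chart_embedding_3 ambient_pair2 lin])
    show "bij ?T" by (rule bij_by_inverse[of ?S]) auto
    show "?T ` part1 ?P = {v. fst v = 0} \<times> UNIV" by (force simp: image_iff)
    show "?T ` part2 ?P = range (\<lambda>r. (r *\<^sub>R (- 1, 0), r))"
      by (auto simp: image_iff zero_prod_def ex_eq_uminus)
    show "linear (fst :: real \<times> real \<Rightarrow> real)" by (rule linearI) simp_all
    show "fst (triangular p b d t v) = 0" if "fst v = 0" for t v using that by (simp add: triangular_def)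
    show "?T (bracket ?P v w) = (snd (?T v) *\<^sub>R (p * fst (fst (?T w)), b * fst (fst (?T w)) + d * snd (fst (?T w)))
      - snd (?T w) *\<^sub>R (p * fst (fst (?T v)), b * fst (fst (?T v)) + d * snd (fst (?T v))), 0)" for v w
      by (cases v; cases w) (simp add: bracket_pair2 algebra_simps)
  qed (fact c lc Z)+
qed

text \<open>The positive scalars act trivially on the first coordinate, so a cocycle there is a
  homomorphism, and \<open>- ln\<close> is onto. Every element factors, and connected groups
  suffice.\<close>

lemma exponentiable_E25: "exponentiable_le2 (pair2 (0, 1) (0, 0) (0, 1) 0 0)"
proof (rule exponentiable_pair2_normal_second[where H = "{0<..}" and c = "\<lambda>s. (- ln \<bar>s\<bar>, 0)" and Z = "{}"])
  interpret scalar_action "triangular 0 0 1" "\<lambda>v. (0 * fst v, 0 * fst v + 1 * snd v)" "{0<..}"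
    by (rule scalar_action_triangular) simp_all
  show "(- ln \<bar>s * t\<bar>, 0) = (- ln \<bar>s\<bar>, 0) + \<rho> s (- ln \<bar>t\<bar>, 0)" if "s \<in> {0<..}" "t \<in> {0<..}" for s t
    using that by (simp add: \<rho>_def triangular_def abs_mult ln_mult)
  show "smooth_on {0<..} (\<lambda>s::real. (- ln \<bar>s\<bar>, 0::real))"
    by (intro smooth_on_Pair smooth_on_minus smooth_on_ln_abs_compose smooth_on_const smooth_on_ident) auto
  have "((\<lambda>s::real. - ln s) has_vector_derivative - 1) (at 1)"
    by (auto intro!: derivative_eq_intros simp: has_real_derivative_iff_has_vector_derivative[symmetric])
  then have "((\<lambda>s::real. - ln \<bar>s\<bar>) has_vector_derivative - 1) (at 1)"
    by (rule has_vector_derivative_transform_within_open[where S = "{0<..}"]) auto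
  then show "((\<lambda>s::real. (- ln \<bar>s\<bar>, 0::real)) has_vector_derivative (- 1, 0)) (at 1)"
    by (rule has_vector_derivative_Pair) simp
  show "\<exists>r\<in>{0<..}. fst (- ln \<bar>r\<bar>, 0::real) = fst (- ln \<bar>s\<bar>, 0::real) - fst v" for v :: "real \<times> real" and s
    by (intro bexI[of _ "exp (ln \<bar>s\<bar> + fst v)"]) auto
qed auto

text \<open>The cocycle is the coboundary of \<open>w = (1, - b)\<close>, chosen because
  \<open>N w = (1, 0)\<close> when \<open>b = 0\<close> or \<open>d = 1\<close>; its derivative at 1
  is \<open>- N w\<close>. Its first coordinate is \<open>1 - s\<close>, so again \<open>r\<close>
  is \<open>s + fst v\<close>.\<close>

lemma exponentiable_E41:
  assumes bd: "b = 0 \<or> 1 = d"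
  shows "exponentiable_le2 (pair2 (0, d) (1, b) (0, d) 1 0)"
proof (rule exponentiable_pair2_normal_second[where H = "- {0}" and c = "\<lambda>s. (1, - b) - scalar_action.\<rho> (triangular 1 b d) s (1, - b)"
      and Z = "{x. fst x \<bullet> (1, 0) + snd x * 1 = 0}", OF _ bd])
  interpret scalar_action "triangular 1 b d" "\<lambda>v. (1 * fst v, b * fst v + d * snd v)" "- {0}"
    by (rule scalar_action_triangular) (use bd in auto)
  have fst_\<rho>: "fst (\<rho> s (1, - b)) = s" if "s \<noteq> 0" for s
    using that by (simp add: \<rho>_def triangular_def sgn_mult_abs)
  show "(1, - b) - \<rho> (s * t) (1, - b) = (1, - b) - \<rho> s (1, - b) + \<rho> s ((1, - b) - \<rho> t (1, - b))"
    if "s \<in> - {0}" "t \<in> - {0}" for s t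
    using that by (simp add: \<rho>_mult linear_diff[OF linear_\<rho>])
  show "smooth_on (- {0}) (\<lambda>s. (1, - b) - \<rho> s (1, - b))"
    by (intro smooth_on_diff smooth_on_\<rho> smooth_on_const smooth_on_ident) auto
  have 1: "((\<lambda>s. \<rho> s (1, - b)) has_vector_derivative (1 * fst (1, - b), b * fst (1, - b) + d * snd (1 :: real, - b))) (at 1)"
    using \<rho>_deriv[of "(1, - b)"] .
  have "((\<lambda>s. (1, - b) - \<rho> s (1, - b)) has_vector_derivative 0 - (1 * fst (1, - b), b * fst (1, - b) + d * snd (1 :: real, - b))) (at 1)"
    by (rule has_vector_derivative_diff[OF has_vector_derivative_const 1])
  then show "((\<lambda>s. (1, - b) - \<rho> s (1, - b)) has_vector_derivative (- 1, 0)) (at 1)"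
    using bd by (auto simp: zero_prod_def)
  show "s = 1" if "s \<in> - {0}" "fst ((1, - b) - \<rho> s (1, - b)) = 0" for s
    using that fst_\<rho>[of s] by simp
  show "negligible {x :: (real \<times> real) \<times> real. fst x \<bullet> (1, 0) + snd x * 1 = 0}"
    by (rule negligible_hyperplane_prod) simp
  show "\<exists>r\<in>- {0}. fst ((1, - b) - \<rho> r (1, - b)) = fst ((1, - b) - \<rho> s (1, - b)) - fst v"
    if "s \<in> - {0}" "(v, s) \<notin> {x. fst x \<bullet> (1, 0) + snd x * 1 = 0}" for v s
    using that fst_\<rho>[of s] fst_\<rho>[of "s + fst v"] by (intro bexI[of _ "s + fst v"]) (auto simp: inner_prod_def)
qed auto

subsection \<open>The projective linear group of the plane\<close>

type_synonym point = "(real \<times> real) \<times> real"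

text \<open>Up to a scalar, a matrix \<open>(a, b; c, d)\<close> is the product of \<open>(\<delta>, t; 0, 1)\<close> and of the rotation by
  some \<open>\<theta>\<close>, unique up to \<open>\<pi>\<close>. Its class is the point \<open>((e\<^sup>t cos 2\<theta>, e\<^sup>t sin 2\<theta>), \<delta>)\<close>, and \<open>shift\<close>, \<open>cos2\<close>,
  \<open>sin2\<close> and \<open>snd\<close> recover \<open>t\<close>, \<open>cos 2\<theta>\<close>, \<open>sin 2\<theta>\<close> and \<open>\<delta>\<close>.\<close>

definition shift :: "point \<Rightarrow> real" where "shift p = ln \<bar>(fst (fst p))\<^sup>2 + (snd (fst p))\<^sup>2\<bar> / 2"
definition cos2 :: "point \<Rightarrow> real" where "cos2 p = exp (- shift p) * fst (fst p)"
definition sin2 :: "point \<Rightarrow> real" where "sin2 p = exp (- shift p) * snd (fst p)"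
definition point :: "real \<Rightarrow> real \<Rightarrow> real \<Rightarrow> real \<Rightarrow> point"
  where "point t v u d = ((exp t * v, exp t * u), d)"

definition pgl_carrier :: "point set" where "pgl_carrier = (- {0}) \<times> (- {0})"

lemma mem_pgl: "p \<in> pgl_carrier \<longleftrightarrow> fst p \<noteq> 0 \<and> snd p \<noteq> 0"
  by (cases p) (simp add: pgl_carrier_def)

lemma open_pgl: "open pgl_carrier"
  unfolding pgl_carrier_def by (intro open_Times) auto

lemma norm_sq_pos: "p \<in> pgl_carrier \<Longrightarrow> (fst (fst p))\<^sup>2 + (snd (fst p))\<^sup>2 > 0"
  by (simp add: mem_pgl sum_power2_gt_zero_iff prod_eq_iff)

lemma circle: "p \<in> pgl_carrier \<Longrightarrow> (cos2 p)\<^sup>2 + (sin2 p)\<^sup>2 = 1"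
proof -
  assume "p \<in> pgl_carrier"
  note pos = norm_sq_pos[OF this]
  have "(exp (shift p))\<^sup>2 = exp (2 * shift p)" by (simp add: exp_double)
  also have "\<dots> = (fst (fst p))\<^sup>2 + (snd (fst p))\<^sup>2" using pos by (simp add: shift_def)
  finally have e: "(fst (fst p))\<^sup>2 + (snd (fst p))\<^sup>2 = (exp (shift p))\<^sup>2" by simp
  have "(cos2 p)\<^sup>2 + (sin2 p)\<^sup>2 = (exp (- shift p))\<^sup>2 * ((fst (fst p))\<^sup>2 + (snd (fst p))\<^sup>2)"
    by (simp add: cos2_def sin2_def power_mult_distrib distrib_left)
  also have "\<dots> = (exp (- shift p) * exp (shift p))\<^sup>2" by (simp only: e power_mult_distrib)
  finally show ?thesis by (simp add: exp_minus)
qed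

lemma point_coordinates: "p = point (shift p) (cos2 p) (sin2 p) (snd p)"
  by (simp add: point_def cos2_def sin2_def exp_minus prod_eq_iff)

lemma coordinates_point:
  assumes "v\<^sup>2 + u\<^sup>2 = 1"
  shows "shift (point t v u d) = t" "cos2 (point t v u d) = v" "sin2 (point t v u d) = u" "snd (point t v u d) = d"
proof -
  have "(exp t * v)\<^sup>2 + (exp t * u)\<^sup>2 = (exp t)\<^sup>2 * (v\<^sup>2 + u\<^sup>2)" by (simp add: power_mult_distrib distrib_left)
  then have "(exp t * v)\<^sup>2 + (exp t * u)\<^sup>2 = exp (2 * t)" using assms by (simp add: exp_double)
  then show "shift (point t v u d) = t" by (simp add: shift_def point_def)
  then show "cos2 (point t v u d) = v" "sin2 (point t v u d) = u"
    by (simp_all add: cos2_def sin2_def point_def exp_minus)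
qed (simp add: point_def)

lemma point_mem: "v\<^sup>2 + u\<^sup>2 = 1 \<Longrightarrow> point t v u d \<in> pgl_carrier \<longleftrightarrow> d \<noteq> 0"
  by (auto simp: point_def mem_pgl zero_prod_def)

text \<open>\<open>c\<close> and \<open>d\<close> are sine and cosine of the half angle, the bottom
  row of a rotation. The choice with \<open>d > 0\<close> breaks down at \<open>v = - 1\<close>,
  where \<open>d\<close> would vanish.\<close>

lemma half_angle:
  assumes "v\<^sup>2 + u\<^sup>2 = (1 :: real)"
  obtains c d where "c\<^sup>2 + d\<^sup>2 = 1" "v = d\<^sup>2 - c\<^sup>2" "u = 2 * c * d"
proof (cases "v = - 1")
  case True
  then show ?thesis using assms by (intro that[of 1 0]) auto
next
  case False
  have "v\<^sup>2 \<le> 1" using assms by (smt (verit) zero_le_power2)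
  then have "\<bar>v\<bar> \<le> 1" by (simp add: abs_square_le_1)
  then have pos: "1 + v > 0" using False by linarith
  define d where "d = sqrt ((1 + v) / 2)"
  have d: "d\<^sup>2 = (1 + v) / 2" "d \<noteq> 0" using pos by (simp_all add: d_def)
  have c: "(u / (2 * d))\<^sup>2 = (1 - v) / 2"
  proof -
    have "(u / (2 * d))\<^sup>2 = u\<^sup>2 / (2 * (1 + v))" using pos by (simp add: power_divide power_mult_distrib d(1) field_simps)
    also have "u\<^sup>2 = (1 - v) * (1 + v)" using assms by (simp add: power2_eq_square algebra_simps)
    finally show ?thesis
      using nonzero_mult_divide_mult_cancel_right[of "1 + v" "1 - v" 2] pos by simp
  qed
  show ?thesis
  proof (rule that[of "u / (2 * d)" d])
    show "(u / (2 * d))\<^sup>2 + d\<^sup>2 = 1" "v = d\<^sup>2 - (u / (2 * d))\<^sup>2"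
      unfolding c d(1) by (simp_all add: field_simps)
    show "u = 2 * (u / (2 * d)) * d" using d(2) by simp
  qed
qed

text \<open>The parameters of the product of the rotation part of \<open>p\<close> with the triangular part of \<open>q\<close>; they are
  quadratic in \<open>cos \<theta>\<close> and \<open>sin \<theta>\<close>, hence linear in \<open>cos 2\<theta>\<close> and \<open>sin 2\<theta>\<close>. The denominator \<open>pgl_norm\<close> is the
  square norm of the bottom row.\<close>

definition pgl_norm :: "point \<Rightarrow> point \<Rightarrow> real"
  where "pgl_norm p q =
    (((snd q)\<^sup>2 + (shift q)\<^sup>2) * (1 - cos2 p) + 2 * shift q * sin2 p + (1 + cos2 p)) / 2"
definition pgl_shift :: "point \<Rightarrow> point \<Rightarrow> real"
  where "pgl_shift p q = (((snd q)\<^sup>2 + (shift q)\<^sup>2) * sin2 p + 2 * shift q * cos2 p - sin2 p) / (2 * pgl_norm p q)"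
definition pgl_cos :: "point \<Rightarrow> point \<Rightarrow> real"
  where "pgl_cos p q =
    (((shift q)\<^sup>2 - (snd q)\<^sup>2) * (1 - cos2 p) + 2 * shift q * sin2 p + (1 + cos2 p)) / (2 * pgl_norm p q)"
definition pgl_sin :: "point \<Rightarrow> point \<Rightarrow> real"
  where "pgl_sin p q = snd q * (shift q * (1 - cos2 p) + sin2 p) / pgl_norm p q"

text \<open>Write \<open>p\<close> and \<open>q\<close> as triangular times rotation. The two inner
  factors are rewritten as triangular times rotation up to a scalar; the triangular parts then
  multiply, and the doubled angles add.\<close>

definition pgl_mult :: "point \<Rightarrow> point \<Rightarrow> point"
  where "pgl_mult p q = point (shift p + snd p * pgl_shift p q)
    (pgl_cos p q * cos2 q - pgl_sin p q * sin2 q) (pgl_cos p q * sin2 q + pgl_sin p q * cos2 q)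
    (snd p * snd q / pgl_norm p q)"

text \<open>The formulas are homogeneous of degree 0 in the four entries, so this is a function of
  the class of the matrix and no quotient has to be formed. The bottom row gives the
  rotation.\<close>

definition of_matrix :: "real \<Rightarrow> real \<Rightarrow> real \<Rightarrow> real \<Rightarrow> point"
  where "of_matrix a b c d = point ((a * c + b * d) / (c\<^sup>2 + d\<^sup>2)) ((d\<^sup>2 - c\<^sup>2) / (c\<^sup>2 + d\<^sup>2))
    (2 * c * d / (c\<^sup>2 + d\<^sup>2)) ((a * d - b * c) / (c\<^sup>2 + d\<^sup>2))"

lemma row_pos: "a * d - b * c \<noteq> 0 \<Longrightarrow> c\<^sup>2 + d\<^sup>2 > (0 :: real)"
  by (auto simp: sum_power2_gt_zero_iff)

lemma coordinates_of_matrix: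
  assumes "a * d - b * c \<noteq> 0"
  shows "shift (of_matrix a b c d) = (a * c + b * d) / (c\<^sup>2 + d\<^sup>2)"
    "cos2 (of_matrix a b c d) = (d\<^sup>2 - c\<^sup>2) / (c\<^sup>2 + d\<^sup>2)"
    "sin2 (of_matrix a b c d) = 2 * c * d / (c\<^sup>2 + d\<^sup>2)"
    "snd (of_matrix a b c d) = (a * d - b * c) / (c\<^sup>2 + d\<^sup>2)"
    "of_matrix a b c d \<in> pgl_carrier"
proof -
  have "(d\<^sup>2 - c\<^sup>2)\<^sup>2 + (2 * c * d)\<^sup>2 = (c\<^sup>2 + d\<^sup>2)\<^sup>2" by algebra
  then have 1: "((d\<^sup>2 - c\<^sup>2) / (c\<^sup>2 + d\<^sup>2))\<^sup>2 + (2 * c * d / (c\<^sup>2 + d\<^sup>2))\<^sup>2 = 1"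
    using row_pos[OF assms]
    by (simp add: power_divide add_divide_distrib[symmetric] del: sum_power2_eq_zero_iff)
  show "shift (of_matrix a b c d) = (a * c + b * d) / (c\<^sup>2 + d\<^sup>2)"
    "cos2 (of_matrix a b c d) = (d\<^sup>2 - c\<^sup>2) / (c\<^sup>2 + d\<^sup>2)"
    "sin2 (of_matrix a b c d) = 2 * c * d / (c\<^sup>2 + d\<^sup>2)"
    "snd (of_matrix a b c d) = (a * d - b * c) / (c\<^sup>2 + d\<^sup>2)"
    unfolding of_matrix_def by (simp_all only: coordinates_point[OF 1])
  show "of_matrix a b c d \<in> pgl_carrier"
    unfolding of_matrix_def using point_mem[OF 1] assms row_pos[OF assms]
    by (simp del: sum_power2_eq_zero_iff)
qed

lemma of_matrix_surj:
  assumes "p \<in> pgl_carrier"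
  obtains a b c d where "a * d - b * c \<noteq> 0" "p = of_matrix a b c d"
proof -
  obtain c d where cd: "c\<^sup>2 + d\<^sup>2 = 1" "cos2 p = d\<^sup>2 - c\<^sup>2" "sin2 p = 2 * c * d"
    using half_angle[OF circle[OF assms]] by blast
  \<comment> \<open>The top row of \<open>(\<delta>, t; 0, 1)\<close> times the rotation
    \<open>(d, - c; c, d)\<close>.\<close>
  define a b where "a = snd p * d + shift p * c" and "b = shift p * d - snd p * c"
  have det: "a * d - b * c = snd p"
    using cd(1) unfolding a_def b_def by algebra
  have tr: "a * c + b * d = shift p"
    using cd(1) unfolding a_def b_def by algebra
  show ?thesis
  proof (rule that[of a d b c])
    show "a * d - b * c \<noteq> 0" using assms det by (simp add: mem_pgl)
    show "p = of_matrix a b c d"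
      unfolding of_matrix_def det tr cd(1) using point_coordinates[of p] cd by simp
  qed
qed

text \<open>This and the next three lemmas isolate the divisions that occur in
  \<open>of_matrix_mult\<close>, so that only polynomial identities remain there.\<close>

lemma divide_by_scaled:
  fixes k m W X Y z :: real
  assumes "k > 0" "m > 0" "W > 0" "z > 0" "k * m * X = z * Y"
  shows "X / (z * (W / k)) = Y / (m * W)"
proof -
  have "X / (z * (W / k)) = (k * m * X) / (z * (m * W))" using assms(1-4) by (simp add: field_simps)
  also have "\<dots> = Y / (m * W)" unfolding assms(5) using assms(4) by simp
  finally show ?thesis .
qed

lemma add_divide_scaled:
  fixes M W x y z R :: real
  assumes "M > 0" "W > 0" "x * W + y * z = M * R"
  shows "x / M + y / M * (z / W) = R / W"
proof -
  have "x / M + y / M * (z / W) = (x * W + y * z) / (M * W)" using assms(1,2) by (simp add: field_simps)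
  then show ?thesis unfolding assms(3) using assms(1) by simp
qed

lemma add_divide_scaled2:
  fixes m W X Y x y R :: real
  assumes "m > 0" "W > 0" "X * x + Y * y = m\<^sup>2 * R"
  shows "X / (m * W) * (x / m) + Y / (m * W) * (y / m) = R / W"
proof -
  have "X / (m * W) * (x / m) + Y / (m * W) * (y / m) = (X * x + Y * y) / (m\<^sup>2 * W)"
    using assms(1,2) by (simp add: field_simps power2_eq_square)
  then show ?thesis unfolding assms(3) using assms(1) by simp
qed

lemma diff_divide_scaled2:
  fixes m W X Y x y R :: real
  assumes "m > 0" "W > 0" "X * x - Y * y = m\<^sup>2 * R"
  shows "X / (m * W) * (x / m) - Y / (m * W) * (y / m) = R / W"
  using add_divide_scaled2[of m W X x "- Y" y R] assms by simp

text \<open>Through this identity the group axioms for \<open>pgl_mult\<close> are inherited from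
  matrices. \<open>C\<close> and \<open>D\<close> form the bottom row of the product, and its square
  norm \<open>W\<close> is the common denominator after cancelling those of the factors.\<close>

lemma of_matrix_mult:
  assumes 1: "a * d - b * c \<noteq> 0" and 2: "a' * d' - b' * c' \<noteq> 0"
  shows "pgl_mult (of_matrix a b c d) (of_matrix a' b' c' d') =
    of_matrix (a * a' + b * c') (a * b' + b * d') (c * a' + d * c') (c * b' + d * d')"
proof -
  define M M' where "M = c\<^sup>2 + d\<^sup>2" and "M' = c'\<^sup>2 + d'\<^sup>2"
  define C D where "C = c * a' + d * c'" and "D = c * b' + d * d'"
  have pos: "M > 0" "M' > 0" using row_pos[OF 1] row_pos[OF 2] by (simp_all add: M_def M'_def)
  let ?p = "of_matrix a b c d" and ?q = "of_matrix a' b' c' d'"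
  note co1 = coordinates_of_matrix[OF 1, folded M_def] and co2 = coordinates_of_matrix[OF 2, folded M'_def]
  define s t where "s = a' * d' - b' * c'" and "t = a' * c' + b' * d'"
  \<comment> \<open>Lagrange's identity for the two rows, \<open>s\<close> being their determinant
    and \<open>t\<close> their inner product.\<close>
  have st: "s\<^sup>2 + t\<^sup>2 = (a'\<^sup>2 + b'\<^sup>2) * M'" unfolding s_def t_def M'_def by algebra
  have sq: "snd ?q = s / M'" "shift ?q = t / M'" by (simp_all add: co2 s_def t_def)
  have SS: "(snd ?q)\<^sup>2 + (shift ?q)\<^sup>2 = (a'\<^sup>2 + b'\<^sup>2) / M'"
    using st pos by (simp add: sq power_divide add_divide_distrib[symmetric] power2_eq_square)
  have m: "1 - cos2 ?p = 2 * c\<^sup>2 / M" "1 + cos2 ?p = 2 * d\<^sup>2 / M"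
    using pos by (simp_all add: co1 field_simps) (simp_all add: M_def)
  have det: "(a * a' + b * c') * D - (a * b' + b * d') * C = (a * d - b * c) * s"
    unfolding C_def D_def s_def by algebra
  define W where "W = C\<^sup>2 + D\<^sup>2"
  have CD: "W = c\<^sup>2 * (a'\<^sup>2 + b'\<^sup>2) + 2 * c * d * t + d\<^sup>2 * M'"
    unfolding W_def C_def D_def t_def M'_def by algebra
  have ne: "(a * a' + b * c') * D - (a * b' + b * d') * C \<noteq> 0"
    using 1 2 by (simp add: det s_def)
  have CDpos: "W > 0" using row_pos[OF ne] by (simp add: W_def)
  have n: "pgl_norm ?p ?q = W / (M * M')"
    unfolding pgl_norm_def SS m CD using pos by (simp add: co1 sq field_simps)
  have "M * M' * (((snd ?q)\<^sup>2 + (shift ?q)\<^sup>2) * sin2 ?p + 2 * shift ?q * cos2 ?p - sin2 ?p) =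
      2 * (c * d * (a'\<^sup>2 + b'\<^sup>2) + t * (d\<^sup>2 - c\<^sup>2) - c * d * M')"
    unfolding SS using pos by (simp add: co1 sq field_simps)
  then have sh: "pgl_shift ?p ?q = (c * d * (a'\<^sup>2 + b'\<^sup>2) + t * (d\<^sup>2 - c\<^sup>2) - c * d * M') / W"
    unfolding pgl_shift_def n
    using divide_by_scaled[of "M * M'" 1 W 2, OF _ _ CDpos] pos by simp
  have "M * M'\<^sup>2 * (((shift ?q)\<^sup>2 - (snd ?q)\<^sup>2) * (1 - cos2 ?p) + 2 * shift ?q * sin2 ?p + (1 + cos2 ?p)) =
      2 * (c\<^sup>2 * (t\<^sup>2 - s\<^sup>2) + 2 * c * d * t * M' + d\<^sup>2 * M'\<^sup>2)"
    unfolding m using pos by (simp add: co1 sq power_divide power2_eq_square field_simps)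
  then have co': "pgl_cos ?p ?q = (c\<^sup>2 * (t\<^sup>2 - s\<^sup>2) + 2 * c * d * t * M' + d\<^sup>2 * M'\<^sup>2) / (M' * W)"
    unfolding pgl_cos_def n using pos
    by (intro divide_by_scaled[OF _ _ CDpos]) (simp_all add: power2_eq_square mult.assoc)
  have "M * M'\<^sup>2 * (snd ?q * (shift ?q * (1 - cos2 ?p) + sin2 ?p)) = 2 * s * c * (t * c + d * M')"
    unfolding m using pos by (simp add: co1 sq power2_eq_square field_simps)
  then have si': "pgl_sin ?p ?q = 2 * s * c * (t * c + d * M') / (M' * W)"
    unfolding pgl_sin_def n using pos
    by (intro divide_by_scaled[where z = 1, unfolded mult_1, OF _ _ CDpos zero_less_one])
       (simp_all add: power2_eq_square mult.assoc)
  have A: "shift ?p + snd ?p * pgl_shift ?p ?q = ((a * a' + b * c') * C + (a * b' + b * d') * D) / W"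
  proof -
    have "(a * c + b * d) * W + (a * d - b * c) * (c * d * (a'\<^sup>2 + b'\<^sup>2) + t * (d\<^sup>2 - c\<^sup>2) - c * d * M')
        = M * ((a * a' + b * c') * C + (a * b' + b * d') * D)"
      unfolding CD unfolding C_def D_def t_def M_def M'_def by algebra
    then show ?thesis
      unfolding sh co1 using pos by (intro add_divide_scaled CDpos)
  qed
  have B: "pgl_cos ?p ?q * cos2 ?q - pgl_sin ?p ?q * sin2 ?q = (D\<^sup>2 - C\<^sup>2) / W"
  proof -
    have "(c\<^sup>2 * (t\<^sup>2 - s\<^sup>2) + 2 * c * d * t * M' + d\<^sup>2 * M'\<^sup>2) * (d'\<^sup>2 - c'\<^sup>2) - 2 * s * c * (t * c + d * M') * (2 * c' * d')
        = M'\<^sup>2 * (D\<^sup>2 - C\<^sup>2)"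
      unfolding C_def D_def t_def s_def M'_def by algebra
    then show ?thesis
      unfolding co' si' co2 by (intro diff_divide_scaled2[OF pos(2) CDpos])
  qed
  have B': "pgl_cos ?p ?q * sin2 ?q + pgl_sin ?p ?q * cos2 ?q = 2 * C * D / W"
  proof -
    have "(c\<^sup>2 * (t\<^sup>2 - s\<^sup>2) + 2 * c * d * t * M' + d\<^sup>2 * M'\<^sup>2) * (2 * c' * d') + 2 * s * c * (t * c + d * M') * (d'\<^sup>2 - c'\<^sup>2)
        = M'\<^sup>2 * (2 * C * D)"
      unfolding C_def D_def t_def s_def M'_def by algebra
    then show ?thesis
      unfolding co' si' co2 by (intro add_divide_scaled2[OF pos(2) CDpos])
  qed
  have E: "snd ?p * snd ?q / pgl_norm ?p ?q = ((a * a' + b * c') * D - (a * b' + b * d') * C) / W"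
    unfolding n sq co1 det using pos CDpos by simp
  show ?thesis
    unfolding pgl_mult_def A B B' E unfolding of_matrix_def W_def C_def D_def by (rule refl)
qed

definition PGL :: "point monoid"
  where "PGL = \<lparr>carrier = pgl_carrier, mult = pgl_mult, one = point 0 1 0 1\<rparr>"

lemma PGL_simps [simp]: "carrier PGL = pgl_carrier" "p \<otimes>\<^bsub>PGL\<^esub> q = pgl_mult p q" "\<one>\<^bsub>PGL\<^esub> = point 0 1 0 1"
  by (simp_all add: PGL_def)

lemma one_of_matrix: "point 0 1 0 1 = of_matrix 1 0 0 1"
  by (simp add: of_matrix_def)

lemma of_matrix_scalar: "e \<noteq> 0 \<Longrightarrow> of_matrix e 0 0 e = point 0 1 0 1"
  by (simp add: of_matrix_def power2_eq_square)

lemma det_mult: "(a * a' + b * c') * (c * b' + d * d') - (a * b' + b * d') * (c * a' + d * c') =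
    (a * d - b * c) * (a' * d' - b' * c')" for a b c d :: real
  by algebra

lemma group_PGL: "group PGL"
proof (rule groupI)
  fix x y z assume x: "x \<in> carrier PGL" and y: "y \<in> carrier PGL" and z: "z \<in> carrier PGL"
  obtain a b c d where m: "a * d - b * c \<noteq> 0" "x = of_matrix a b c d"
    by (rule of_matrix_surj[OF x[unfolded PGL_simps]])
  obtain a' b' c' d' where m': "a' * d' - b' * c' \<noteq> 0" "y = of_matrix a' b' c' d'"
    by (rule of_matrix_surj[OF y[unfolded PGL_simps]])
  obtain a'' b'' c'' d'' where m'': "a'' * d'' - b'' * c'' \<noteq> 0" "z = of_matrix a'' b'' c'' d''"
    by (rule of_matrix_surj[OF z[unfolded PGL_simps]])
  have 1: "(a * a' + b * c') * (c * b' + d * d') - (a * b' + b * d') * (c * a' + d * c') \<noteq> 0"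
    using m m' by (simp only: det_mult) simp
  have 2: "(a' * a'' + b' * c'') * (c' * b'' + d' * d'') - (a' * b'' + b' * d'') * (c' * a'' + d' * c'') \<noteq> 0"
    using m' m'' by (simp only: det_mult) simp
  show "x \<otimes>\<^bsub>PGL\<^esub> y \<in> carrier PGL"
    unfolding PGL_simps m(2) m'(2) of_matrix_mult[OF m(1) m'(1)] by (rule coordinates_of_matrix[OF 1])
  show "x \<otimes>\<^bsub>PGL\<^esub> y \<otimes>\<^bsub>PGL\<^esub> z = x \<otimes>\<^bsub>PGL\<^esub> (y \<otimes>\<^bsub>PGL\<^esub> z)"
    unfolding PGL_simps m(2) m'(2) m''(2) of_matrix_mult[OF m(1) m'(1)] of_matrix_mult[OF m'(1) m''(1)]
      of_matrix_mult[OF 1 m''(1)] of_matrix_mult[OF m(1) 2]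
    by (simp add: algebra_simps)
next
  fix x assume x: "x \<in> carrier PGL"
  obtain a b c d where m: "a * d - b * c \<noteq> 0" "x = of_matrix a b c d"
    by (rule of_matrix_surj[OF x[unfolded PGL_simps]])
  show "\<one>\<^bsub>PGL\<^esub> \<otimes>\<^bsub>PGL\<^esub> x = x"
    unfolding PGL_simps m(2) one_of_matrix by (subst of_matrix_mult) (use m(1) in simp_all)
  \<comment> \<open>The adjugate serves as inverse: its product with the matrix is the determinant
    times the identity matrix, hence the identity class.\<close>
  have "d * a - (- b) * (- c) \<noteq> 0" using m(1) by (simp add: mult.commute)
  note of_matrix_mult[OF this m(1)]
  also have "of_matrix (d * a + - b * c) (d * b + - b * d) (- c * a + a * c) (- c * b + a * d) =
      of_matrix (a * d - b * c) 0 0 (a * d - b * c)"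
    by (simp add: mult.commute)
  also have "\<dots> = point 0 1 0 1" by (rule of_matrix_scalar[OF m(1)])
  finally show "\<exists>y\<in>carrier PGL. y \<otimes>\<^bsub>PGL\<^esub> x = \<one>\<^bsub>PGL\<^esub>"
    unfolding PGL_simps m(2)
    by (intro bexI[of _ "of_matrix d (- b) (- c) a"])
       (use coordinates_of_matrix(5)[of d a "- b" "- c"] m(1) in \<open>simp_all add: mult.commute\<close>)
qed (simp add: one_of_matrix coordinates_of_matrix(5))

lemma pgl_norm_pos:
  assumes "p \<in> pgl_carrier" "q \<in> pgl_carrier"
  shows "pgl_norm p q > 0"
proof -
  obtain c d where cd: "c\<^sup>2 + d\<^sup>2 = 1" "cos2 p = d\<^sup>2 - c\<^sup>2" "sin2 p = 2 * c * d"
    using half_angle[OF circle[OF assms(1)]] by blast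
  have cd': "1 - cos2 p = 2 * c\<^sup>2" "1 + cos2 p = 2 * d\<^sup>2" using cd by simp_all
  \<comment> \<open>The row \<open>(c, d)\<close> times \<open>(\<delta>, t; 0, 1)\<close> is
    \<open>(c \<delta>, c t + d)\<close>.\<close>
  have eq: "pgl_norm p q = (c * snd q)\<^sup>2 + (c * shift q + d)\<^sup>2"
    unfolding pgl_norm_def cd' cd(3) by (simp add: power2_eq_square algebra_simps)
  show ?thesis
  proof (cases "c = 0")
    case True
    then show ?thesis using cd(1) eq by simp
  next
    case False
    then have "(c * snd q)\<^sup>2 > 0" using assms(2) by (simp add: mem_pgl)
    then show ?thesis unfolding eq by (simp add: add_pos_nonneg)
  qed
qed

lemma smooth_on_shift [smooth_intros]:
  assumes "open S" "smooth_on S f" "\<And>x. x \<in> S \<Longrightarrow> f x \<in> pgl_carrier"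
  shows "smooth_on S (\<lambda>x. shift (f x))"
  unfolding shift_def
  by (intro smooth_on_divide smooth_on_ln_abs_compose smooth_on_add smooth_on_power smooth_on_const
      smooth_on_fst smooth_on_snd assms(1,2)) (use norm_sq_pos[OF assms(3)] in \<open>force+\<close>)

lemma smooth_on_cos2 [smooth_intros]:
  assumes "open S" "smooth_on S f" "\<And>x. x \<in> S \<Longrightarrow> f x \<in> pgl_carrier"
  shows "smooth_on S (\<lambda>x. cos2 (f x))"
  unfolding cos2_def
  by (intro smooth_on_mult smooth_on_exp_compose smooth_on_minus smooth_on_shift
      smooth_on_fst smooth_on_snd assms)

lemma smooth_on_sin2 [smooth_intros]:
  assumes "open S" "smooth_on S f" "\<And>x. x \<in> S \<Longrightarrow> f x \<in> pgl_carrier"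
  shows "smooth_on S (\<lambda>x. sin2 (f x))"
  unfolding sin2_def
  by (intro smooth_on_mult smooth_on_exp_compose smooth_on_minus smooth_on_shift
      smooth_on_fst smooth_on_snd assms)

lemma smooth_on_point [smooth_intros]:
  "open S \<Longrightarrow> smooth_on S t \<Longrightarrow> smooth_on S v \<Longrightarrow> smooth_on S u \<Longrightarrow> smooth_on S d
    \<Longrightarrow> smooth_on S (\<lambda>x. point (t x) (v x) (u x) (d x))"
  unfolding point_def by (intro smooth_on_Pair smooth_on_mult smooth_on_exp_compose)

lemma smooth_on_pgl_mult [smooth_intros]:
  assumes S: "open S" and f: "smooth_on S f" "\<And>x. x \<in> S \<Longrightarrow> f x \<in> pgl_carrier"
    and g: "smooth_on S g" "\<And>x. x \<in> S \<Longrightarrow> g x \<in> pgl_carrier"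
  shows "smooth_on S (\<lambda>x. pgl_mult (f x) (g x))"
proof -
  note b = S smooth_on_shift[OF S f] smooth_on_shift[OF S g] smooth_on_cos2[OF S f] smooth_on_cos2[OF S g]
    smooth_on_sin2[OF S f] smooth_on_sin2[OF S g] smooth_on_snd[OF S f(1)] smooth_on_snd[OF S g(1)]
  have n: "smooth_on S (\<lambda>x. pgl_norm (f x) (g x))"
    unfolding pgl_norm_def
    by (intro smooth_on_divide smooth_on_add smooth_on_mult smooth_on_diff smooth_on_power smooth_on_const b) simp_all
  have ne: "pgl_norm (f x) (g x) \<noteq> 0" if "x \<in> S" for x
    using pgl_norm_pos[OF f(2)[OF that] g(2)[OF that]] by simp
  have "smooth_on S (\<lambda>x. pgl_shift (f x) (g x))"
    unfolding pgl_shift_def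
    by (intro smooth_on_divide smooth_on_add smooth_on_mult smooth_on_diff smooth_on_power smooth_on_const b n)
       (simp_all add: ne)
  moreover have "smooth_on S (\<lambda>x. pgl_cos (f x) (g x))"
    unfolding pgl_cos_def
    by (intro smooth_on_divide smooth_on_add smooth_on_mult smooth_on_diff smooth_on_power smooth_on_const b n)
       (simp_all add: ne)
  moreover have "smooth_on S (\<lambda>x. pgl_sin (f x) (g x))"
    unfolding pgl_sin_def
    by (intro smooth_on_divide smooth_on_add smooth_on_mult smooth_on_diff smooth_on_power smooth_on_const b n)
       (simp_all add: ne)
  ultimately show ?thesis
    unfolding pgl_mult_def
    by (intro smooth_on_point smooth_on_divide smooth_on_add smooth_on_mult smooth_on_diff b n) (simp_all add: ne)
qed

lemma pgl_mult_affine: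
  assumes "v\<^sup>2 + u\<^sup>2 = 1"
  shows "pgl_mult (point t 1 0 d) (point t' v u d') = point (t + d * t') v u (d * d')"
proof -
  note c = coordinates_point[OF assms] coordinates_point[of 1 0]
  have n: "pgl_norm (point t 1 0 d) (point t' v u d') = 1" by (simp add: pgl_norm_def c)
  show ?thesis by (simp add: pgl_mult_def pgl_shift_def pgl_cos_def pgl_sin_def n c)
qed

lemma pgl_mult_rotation:
  assumes "v\<^sup>2 + u\<^sup>2 = 1"
  shows "pgl_mult (point 0 v (- u) 1) (point 0 v u 1) = point 0 1 0 1"
proof -
  have a': "v\<^sup>2 + (- u)\<^sup>2 = 1" using assms by simp
  note c = coordinates_point[OF assms] coordinates_point[OF a']
  have n: "pgl_norm (point 0 v (- u) 1) (point 0 v u 1) = 1" by (simp add: pgl_norm_def c)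
  have "v * v + u * u = 1" using assms by (simp add: power2_eq_square)
  then show ?thesis by (simp add: pgl_mult_def pgl_shift_def pgl_cos_def pgl_sin_def n c)
qed

text \<open>The inverse rotation times the inverse triangular matrix. Expressed in the doubled angle
  it involves no choice of a half angle, so smoothness of inversion can be read off.\<close>

lemma inv_PGL:
  assumes "p \<in> pgl_carrier"
  shows "inv\<^bsub>PGL\<^esub> p = pgl_mult (point 0 (cos2 p) (- sin2 p) 1) (point (- (shift p / snd p)) 1 0 (1 / snd p))"
proof -
  interpret group PGL by (rule group_PGL)
  let ?a = "point (shift p) 1 0 (snd p)" and ?k = "point 0 (cos2 p) (sin2 p) 1"
  let ?a' = "point (- (shift p / snd p)) 1 0 (1 / snd p)" and ?k' = "point 0 (cos2 p) (- sin2 p) 1"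
  have d: "snd p \<noteq> 0" using assms by (simp add: mem_pgl)
  note c = circle[OF assms]
  have mem: "?a \<in> carrier PGL" "?k \<in> carrier PGL" "?a' \<in> carrier PGL" "?k' \<in> carrier PGL"
    using d c by (simp_all add: point_mem)
  have "p = ?a \<otimes>\<^bsub>PGL\<^esub> ?k"
    using pgl_mult_affine[OF c, of "shift p" "snd p" 0 1] point_coordinates[of p] by simp
  moreover have "inv\<^bsub>PGL\<^esub> ?a = ?a'"
    using d mem pgl_mult_affine[of 1 0 "- (shift p / snd p)" "1 / snd p" "shift p" "snd p"]
    by (intro inv_equality) simp_all
  moreover have "inv\<^bsub>PGL\<^esub> ?k = ?k'"
    using mem pgl_mult_rotation[OF c] by (intro inv_equality) simp_all
  ultimately show ?thesis using inv_mult_group[OF mem(1,2)] by simp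
qed

lemma smooth_on_inv_PGL: "smooth_on (carrier PGL) (\<lambda>p. inv\<^bsub>PGL\<^esub> p)"
proof -
  have 1: "point 0 (cos2 p) (- sin2 p) 1 \<in> pgl_carrier" if "p \<in> pgl_carrier" for p
    using circle[OF that] by (simp add: point_mem)
  have 2: "snd p \<noteq> 0" if "p \<in> pgl_carrier" for p
    using that by (simp add: mem_pgl)
  have 3: "point (- (shift p / snd p)) 1 0 (1 / snd p) \<in> pgl_carrier" if "p \<in> pgl_carrier" for p
    using 2[OF that] by (simp add: point_mem)
  have "smooth_on pgl_carrier (\<lambda>p. pgl_mult (point 0 (cos2 p) (- sin2 p) 1)
    (point (- (shift p / snd p)) 1 0 (1 / snd p)))"
    by (intro smooth_on_pgl_mult smooth_on_point smooth_on_divide smooth_on_minus smooth_on_cos2 smooth_on_sin2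
        smooth_on_shift smooth_on_snd smooth_on_const smooth_on_ident open_pgl)
       (simp_all add: 1 2 3)
  then show ?thesis
    unfolding PGL_simps(1) by (rule smooth_on_cong[OF open_pgl, rotated]) (simp add: inv_PGL)
qed

lemma chart_group_PGL:
  assumes "chart_embedding \<kappa> \<kappa>'"
  shows "chart_group PGL \<kappa> \<kappa>'"
proof (rule chart_group.intro[OF group_PGL], unfold_locales)
  show "smooth_on (carrier PGL \<times> carrier PGL) (\<lambda>p. fst p \<otimes>\<^bsub>PGL\<^esub> snd p)"
    unfolding PGL_simps
    by (intro smooth_on_pgl_mult smooth_on_fst smooth_on_snd smooth_on_ident open_Times open_pgl) auto
  show "smooth_on (carrier PGL) (\<lambda>p. inv\<^bsub>PGL\<^esub> p)" by (rule smooth_on_inv_PGL)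
qed (simp_all add: open_pgl assms)

section \<open>The Lie algebra of the projective linear group\<close>

lemma has_derivative_shift:
  "(shift has_derivative (\<lambda>w. fst (fst w))) (at (point 0 1 0 1))"
proof -
  have "((\<lambda>p :: point. ln ((fst (fst p))\<^sup>2 + (snd (fst p))\<^sup>2) / 2) has_derivative (\<lambda>w. fst (fst w)))
      (at (point 0 1 0 1))"
    by (auto intro!: derivative_eq_intros simp: point_def)
  moreover have "shift = (\<lambda>p. ln ((fst (fst p))\<^sup>2 + (snd (fst p))\<^sup>2) / 2)"
    by (rule ext) (simp add: shift_def)
  ultimately show ?thesis by simp
qed

lemma coordinates_one: "shift (point 0 1 0 1) = 0" "cos2 (point 0 1 0 1) = 1" "sin2 (point 0 1 0 1) = 0"
  "snd (point 0 1 0 1) = 1" "fst (fst (point 0 1 0 1)) = 1" "snd (fst (point 0 1 0 1)) = 0"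
  by (simp_all add: coordinates_point) (simp_all add: point_def)

lemma has_derivative_cos2: "(cos2 has_derivative (\<lambda>w. 0)) (at (point 0 1 0 1))"
  unfolding cos2_def[abs_def]
  by (auto intro!: derivative_eq_intros has_derivative_shift simp: coordinates_one)

lemma has_derivative_sin2: "(sin2 has_derivative (\<lambda>w. snd (fst w))) (at (point 0 1 0 1))"
  unfolding sin2_def[abs_def]
  by (auto intro!: derivative_eq_intros has_derivative_shift simp: coordinates_one)

lemma has_derivative_snd_point: "(snd has_derivative snd) (at (p :: point))"
  by (rule bounded_linear_imp_has_derivative) (rule bounded_linear_snd)

lemmas has_derivative_coordinates =
  has_derivative_shift has_derivative_cos2 has_derivative_sin2 has_derivative_snd_point

text \<open>The left-invariant field with value \<open>w\<close> at the identity. \<open>dt\<close>,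
  \<open>dn\<close>, \<open>dv\<close> and \<open>du\<close> are the derivatives of the shift of the
  product, of \<open>pgl_norm\<close>, and of the cosine and sine of the doubled angle of the
  product.\<close>

definition pgl_field :: "point \<Rightarrow> point \<Rightarrow> point"
  where "pgl_field w p =
    (let dt = snd p * (snd w * sin2 p + fst (fst w) * cos2 p);
         dn = snd w * (1 - cos2 p) + fst (fst w) * sin2 p;
         dv = fst (fst w) * sin2 p - snd w * (1 - cos2 p) - cos2 p * dn - snd (fst w) * sin2 p;
         du = snd w * sin2 p + fst (fst w) * (1 - cos2 p) - sin2 p * dn + snd (fst w) * cos2 p
     in ((exp (shift p) * (dt * cos2 p + dv), exp (shift p) * (dt * sin2 p + du)), snd p * (snd w - dn)))"

lemma has_derivative_pgl_mult:
  "((\<lambda>q. pgl_mult p q) has_derivative (\<lambda>w. pgl_field w p)) (at (point 0 1 0 1))"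
proof -
  let ?e = "point 0 1 0 1"
  have n1: "pgl_norm p ?e = 1" by (simp add: pgl_norm_def coordinates_one)
  have n: "((\<lambda>q. pgl_norm p q) has_derivative (\<lambda>w. snd w * (1 - cos2 p) + fst (fst w) * sin2 p)) (at ?e)"
    unfolding pgl_norm_def
    by (auto intro!: derivative_eq_intros has_derivative_coordinates simp: coordinates_one fun_eq_iff field_simps)
  have t: "((\<lambda>q. pgl_shift p q) has_derivative (\<lambda>w. snd w * sin2 p + fst (fst w) * cos2 p)) (at ?e)"
    unfolding pgl_shift_def
    by (auto intro!: derivative_eq_intros has_derivative_coordinates n simp: coordinates_one n1 algebra_simps)
  have v: "((\<lambda>q. pgl_cos p q) has_derivative (\<lambda>w. fst (fst w) * sin2 p - snd w * (1 - cos2 p)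
      - cos2 p * (snd w * (1 - cos2 p) + fst (fst w) * sin2 p))) (at ?e)"
    unfolding pgl_cos_def
    by (auto intro!: derivative_eq_intros has_derivative_coordinates n
        simp: coordinates_one n1 fun_eq_iff field_simps)
  have u: "((\<lambda>q. pgl_sin p q) has_derivative (\<lambda>w. snd w * sin2 p + fst (fst w) * (1 - cos2 p)
      - sin2 p * (snd w * (1 - cos2 p) + fst (fst w) * sin2 p))) (at ?e)"
    unfolding pgl_sin_def
    by (auto intro!: derivative_eq_intros has_derivative_coordinates n simp: coordinates_one n1 algebra_simps)
  have vals: "pgl_shift p ?e = 0" "pgl_cos p ?e = cos2 p" "pgl_sin p ?e = sin2 p"
    by (simp_all add: pgl_shift_def pgl_cos_def pgl_sin_def n1 coordinates_one)
  have T: "((\<lambda>q. shift p + snd p * pgl_shift p q) has_derivative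
      (\<lambda>w. snd p * (snd w * sin2 p + fst (fst w) * cos2 p))) (at ?e)"
    by (auto intro!: derivative_eq_intros t)
  have V: "((\<lambda>q. pgl_cos p q * cos2 q - pgl_sin p q * sin2 q) has_derivative
      (\<lambda>w. fst (fst w) * sin2 p - snd w * (1 - cos2 p)
        - cos2 p * (snd w * (1 - cos2 p) + fst (fst w) * sin2 p) - snd (fst w) * sin2 p)) (at ?e)"
    by (auto intro!: derivative_eq_intros has_derivative_coordinates v u simp: coordinates_one vals algebra_simps)
  have W: "((\<lambda>q. pgl_cos p q * sin2 q + pgl_sin p q * cos2 q) has_derivative
      (\<lambda>w. snd w * sin2 p + fst (fst w) * (1 - cos2 p)
        - sin2 p * (snd w * (1 - cos2 p) + fst (fst w) * sin2 p) + snd (fst w) * cos2 p)) (at ?e)"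
    by (auto intro!: derivative_eq_intros has_derivative_coordinates v u simp: coordinates_one vals algebra_simps)
  have D: "((\<lambda>q. snd p * snd q / pgl_norm p q) has_derivative
      (\<lambda>w. snd p * (snd w - (snd w * (1 - cos2 p) + fst (fst w) * sin2 p)))) (at ?e)"
    by (auto intro!: derivative_eq_intros has_derivative_coordinates n simp: coordinates_one n1 algebra_simps)
  show ?thesis
    unfolding pgl_mult_def point_def[of "shift p + _"] pgl_field_def Let_def
    by (rule has_derivative_eq_rhs[OF has_derivative_Pair[OF has_derivative_Pair[OF
          has_derivative_mult[OF has_derivative_exp[OF T] V] has_derivative_mult[OF has_derivative_exp[OF T] W]] D]])
       (simp add: fun_eq_iff vals coordinates_one algebra_simps)
qed

lemma has_derivative_pgl_field:
  "((\<lambda>p. pgl_field w p) has_derivative (\<lambda>z.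
    ((fst (fst z) * fst (fst w) + snd z * fst (fst w) + snd (fst z) * snd w - snd (fst z) * snd (fst w),
      fst (fst z) * snd (fst w) + fst (fst w) * snd (fst z) + snd (fst z) * snd w),
     snd z * snd w - snd (fst z) * fst (fst w)))) (at (point 0 1 0 1))"
  unfolding pgl_field_def Let_def
  by (intro has_derivative_Pair)
     (auto intro!: derivative_eq_intros has_derivative_coordinates simp: coordinates_one algebra_simps)

text \<open>At the identity the three coordinates of a tangent vector are the variations of the
  shift, of the doubled angle and of the diagonal entry \<open>\<delta>\<close>. The bracket
  antisymmetrises the derivative of \<open>pgl_field\<close>.\<close>

lemma lie_bracket_PGL:
  assumes "chart_embedding \<kappa> (\<kappa>' :: 'p::euclidean_space \<Rightarrow> point)"
  shows "chart_group.lie_bracket PGL z w =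
    ((snd z * fst (fst w) - snd w * fst (fst z) + snd (fst z) * snd w - snd (fst w) * snd z,
      snd (fst z) * snd w - snd (fst w) * snd z),
     snd (fst w) * fst (fst z) - snd (fst z) * fst (fst w))"
proof -
  interpret chart_group PGL \<kappa> \<kappa>' by (rule chart_group_PGL[OF assms])
  have "left_field w p = pgl_field w p" for w p
    using fun_cong[OF frechet_derivative_at[OF has_derivative_pgl_mult[of p]], of w] by (simp add: left_field_def)
  then have "left_field w = pgl_field w" for w by (intro ext)
  moreover note frechet_derivative_at[OF has_derivative_pgl_field, symmetric]
  ultimately show ?thesis by (simp add: lie_bracket_def)
qed

section \<open>The triangular subgroup and its complements in the projective linear group\<close>

lemma inv_of_matrix:
  assumes "a * d - b * c \<noteq> 0"
  shows "inv\<^bsub>PGL\<^esub> (of_matrix a b c d) = of_matrix d (- b) (- c) a"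
proof (rule group.inv_equality[OF group_PGL])
  have 1: "d * a - (- b) * (- c) \<noteq> 0" using assms by (simp add: mult.commute)
  show "of_matrix a b c d \<in> carrier PGL" "of_matrix d (- b) (- c) a \<in> carrier PGL"
    using coordinates_of_matrix(5)[OF assms] coordinates_of_matrix(5)[OF 1] by simp_all
  have "pgl_mult (of_matrix d (- b) (- c) a) (of_matrix a b c d) =
      of_matrix (a * d - b * c) 0 0 (a * d - b * c)"
    unfolding of_matrix_mult[OF 1 assms] by (simp add: mult.commute)
  also have "\<dots> = point 0 1 0 1" by (rule of_matrix_scalar[OF assms])
  finally show "of_matrix d (- b) (- c) a \<otimes>\<^bsub>PGL\<^esub> of_matrix a b c d = \<one>\<^bsub>PGL\<^esub>" by simp
qed

text \<open>Positivity selects \<open>cos 2\<theta> = 1\<close> among the two angles with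
  \<open>sin 2\<theta> = 0\<close>; the other one belongs to the rotation by a right angle.\<close>

definition borel_part :: "point set"
  where "borel_part = {p \<in> pgl_carrier. snd (fst p) = 0 \<and> fst (fst p) > 0}"

lemma mem_borel_part: "p \<in> borel_part \<longleftrightarrow> (\<exists>t d. d \<noteq> 0 \<and> p = point t 1 0 d)"
proof
  assume p: "p \<in> borel_part"
  then have "p = point (ln (fst (fst p))) 1 0 (snd p)" "snd p \<noteq> 0"
    by (simp_all add: borel_part_def point_def prod_eq_iff mem_pgl)
  then show "\<exists>t d. d \<noteq> 0 \<and> p = point t 1 0 d" by (intro exI conjI)
next
  assume "\<exists>t d. d \<noteq> 0 \<and> p = point t 1 0 d"
  then obtain t d where "d \<noteq> 0" "p = point t 1 0 d" by (elim exE conjE)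
  then show "p \<in> borel_part" by (simp add: borel_part_def point_mem) (simp add: point_def)
qed

lemma point_borel_part: "d \<noteq> 0 \<Longrightarrow> point t 1 0 d \<in> borel_part"
  unfolding mem_borel_part by (intro exI[of _ t] exI[of _ d] conjI refl)

lemma subgroup_borel_part: "subgroup borel_part PGL"
proof (rule group.subgroupI[OF group_PGL])
  show "borel_part \<subseteq> carrier PGL" by (auto simp: borel_part_def)
  show "borel_part \<noteq> {}" using point_borel_part[of 1] by auto
  show "p \<otimes>\<^bsub>PGL\<^esub> q \<in> borel_part" if pq: "p \<in> borel_part" "q \<in> borel_part" for p q
  proof -
    obtain t d t' d' where "d \<noteq> 0" "p = point t 1 0 d" "d' \<noteq> 0" "q = point t' 1 0 d'"
      using pq unfolding mem_borel_part by (elim exE conjE)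
    then show ?thesis by (simp add: pgl_mult_affine point_borel_part)
  qed
  show "inv\<^bsub>PGL\<^esub> p \<in> borel_part" if p: "p \<in> borel_part" for p
  proof -
    obtain t d where td: "d \<noteq> 0" "p = point t 1 0 d" using p unfolding mem_borel_part by (elim exE conjE)
    have "p \<in> pgl_carrier" using p by (simp add: borel_part_def)
    then have "inv\<^bsub>PGL\<^esub> p = point (- (t / d)) 1 0 (1 / d)"
      using pgl_mult_affine[of 1 0 0 1 "- (t / d)" "1 / d"] by (simp add: inv_PGL td(2) coordinates_point)
    then show ?thesis using td(1) by (simp add: point_borel_part)
  qed
qed

lemma closedin_borel_part: "closedin (top_of_set pgl_carrier) borel_part"
proof -
  \<comment> \<open>The weak inequality makes the set closed. Within \<open>pgl_carrier\<close> it
    is the same as the strict one, because the two coordinates cannot vanish together.\<close>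
  have "closed {p :: point. snd (fst p) = 0 \<and> fst (fst p) \<ge> 0}"
    by (intro closed_Collect_conj closed_Collect_eq closed_Collect_le continuous_intros)
  from closedin_closed_Int[OF this, of pgl_carrier]
  show ?thesis
    by (rule back_subst) (auto simp: borel_part_def mem_pgl zero_prod_def)
qed

text \<open>The units of the algebra of matrices \<open>(x, a y; y, x)\<close>: modulo scalars a
  split torus, a unipotent group or the rotations for \<open>a = 1, 0, -1\<close>. For a normalised
  bottom row the determinant \<open>x x - a y y\<close> and the shift \<open>(1 + a) x y\<close> are
  affine in \<open>cos 2\<theta>\<close> and \<open>sin 2\<theta>\<close>. The equations show
  closedness, the parametrisation \<open>torus_eq\<close> the group property.\<close>

definition torus :: "real \<Rightarrow> point set"
  where "torus a = {p \<in> pgl_carrier. snd p = ((1 + cos2 p) - a * (1 - cos2 p)) / 2 \<and> shift p = (1 + a) * sin2 p / 2}"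

lemma torus_of_matrix:
  assumes "x * x - a * y * y \<noteq> 0"
  shows "of_matrix x (a * y) y x \<in> torus a"
proof -
  define N where "N = y\<^sup>2 + x\<^sup>2"
  have N: "N > 0" unfolding N_def using row_pos[OF assms] .
  let ?p = "of_matrix x (a * y) y x"
  note co = coordinates_of_matrix[OF assms, folded N_def]
  have 1: "1 + cos2 ?p = 2 * x\<^sup>2 / N" "1 - cos2 ?p = 2 * y\<^sup>2 / N"
    using N by (simp_all add: co(2) field_simps) (simp_all add: N_def)
  have "snd ?p = ((1 + cos2 ?p) - a * (1 - cos2 ?p)) / 2"
    unfolding 1 co(4) by (simp add: diff_divide_distrib power2_eq_square)
  moreover have "shift ?p = (1 + a) * sin2 ?p / 2"
    unfolding co by (simp add: algebra_simps add_divide_distrib)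
  ultimately show ?thesis by (simp add: torus_def co(5))
qed

lemma torus_eq: "torus a = (\<lambda>z. of_matrix (fst z) (a * snd z) (snd z) (fst z)) `
    {z. fst z * fst z - a * snd z * snd z \<noteq> 0}"
proof (rule subset_antisym; rule subsetI)
  fix p assume p: "p \<in> torus a"
  then have pm: "p \<in> pgl_carrier" by (simp add: torus_def)
  obtain c d where cd: "c\<^sup>2 + d\<^sup>2 = 1" "cos2 p = d\<^sup>2 - c\<^sup>2" "sin2 p = 2 * c * d"
    using half_angle[OF circle[OF pm]] by blast
  have cd': "1 - cos2 p = 2 * c\<^sup>2" "1 + cos2 p = 2 * d\<^sup>2" using cd by simp_all
  have det: "snd p = d * d - a * c * c"
    using p unfolding torus_def by (simp add: cd' power2_eq_square)
  have sh: "shift p = d * c + a * c * d"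
    using p unfolding torus_def by (simp add: cd(3) algebra_simps)
  have "p = of_matrix d (a * c) c d"
    unfolding of_matrix_def cd(1) using point_coordinates[of p] cd det sh by simp
  moreover have "d * d - a * c * c \<noteq> 0" using det pm by (simp add: mem_pgl)
  ultimately show "p \<in> (\<lambda>z. of_matrix (fst z) (a * snd z) (snd z) (fst z)) `
      {z. fst z * fst z - a * snd z * snd z \<noteq> 0}"
    by (intro image_eqI[of _ _ "(d, c)"]) simp_all
qed (auto simp: torus_of_matrix)

lemma subgroup_torus: "subgroup (torus a) PGL"
proof (rule group.subgroupI[OF group_PGL])
  show "torus a \<subseteq> carrier PGL" by (auto simp: torus_def)
  show "torus a \<noteq> {}" using torus_of_matrix[of 1 a 0] by auto
  show "p \<otimes>\<^bsub>PGL\<^esub> q \<in> torus a" if pq: "p \<in> torus a" "q \<in> torus a" for p q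
  proof -
    obtain x y where p: "x * x - a * y * y \<noteq> 0" "p = of_matrix x (a * y) y x"
      using pq(1) unfolding torus_eq by auto
    obtain x' y' where q: "x' * x' - a * y' * y' \<noteq> 0" "q = of_matrix x' (a * y') y' x'"
      using pq(2) unfolding torus_eq by auto
    have "(x * x' + a * y * y') * (x * x' + a * y * y') - a * (y * x' + x * y') * (y * x' + x * y') =
        (x * x - a * y * y) * (x' * x' - a * y' * y')" by algebra
    then have "(x * x' + a * y * y') * (x * x' + a * y * y') - a * (y * x' + x * y') * (y * x' + x * y') \<noteq> 0"
      using p(1) q(1) by simp
    from torus_of_matrix[OF this] show ?thesis
      unfolding PGL_simps p(2) q(2) of_matrix_mult[OF p(1) q(1)] by (simp add: algebra_simps)
  qed
  show "inv\<^bsub>PGL\<^esub> p \<in> torus a" if p: "p \<in> torus a" for p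
  proof -
    obtain x y where p: "x * x - a * y * y \<noteq> 0" "p = of_matrix x (a * y) y x"
      using p unfolding torus_eq by auto
    then show ?thesis
      unfolding p(2) inv_of_matrix[OF p(1)] using torus_of_matrix[of x a "- y"] by simp
  qed
qed

lemma continuous_on_coordinates:
  "continuous_on pgl_carrier shift" "continuous_on pgl_carrier cos2" "continuous_on pgl_carrier sin2"
  by (rule smooth_on_imp_continuous_on smooth_on_shift smooth_on_cos2 smooth_on_sin2 smooth_on_ident open_pgl
      | assumption)+

lemma closedin_torus: "closedin (top_of_set pgl_carrier) (torus a)"
proof -
  let ?F = "\<lambda>p. (snd p - ((1 + cos2 p) - a * (1 - cos2 p)) / 2, shift p - (1 + a) * sin2 p / 2)"
  have "continuous_on pgl_carrier ?F"
    by (intro continuous_intros continuous_on_coordinates) auto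
  then have "closedin (top_of_set pgl_carrier) (pgl_carrier \<inter> ?F -` {(0, 0)})"
    by (rule continuous_closedin_preimage) simp
  moreover have "torus a = pgl_carrier \<inter> ?F -` {(0, 0)}" by (auto simp: torus_def)
  ultimately show ?thesis by simp
qed

lemma borel_part_torus: "borel_part \<inter> torus a = {point 0 1 0 1}"
proof (rule subset_antisym; rule subsetI)
  fix p assume "p \<in> borel_part \<inter> torus a"
  then obtain t d where td: "p = point t 1 0 d" "p \<in> torus a"
    unfolding Int_iff mem_borel_part by (elim exE conjE)
  then have "d = 1" "t = 0" by (simp_all add: torus_def coordinates_point)
  then show "p \<in> {point 0 1 0 1}" using td by simp
next
  fix p assume "p \<in> {point 0 1 0 1}"
  then show "p \<in> borel_part \<inter> torus a"
    using torus_of_matrix[of 1 a 0] point_borel_part[of 1 0] by (simp add: one_of_matrix[symmetric])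
qed

text \<open>The triangular group acts on the left without changing the angle, simply transitively on
  the points with a given angle. So an angle is missed only where the torus has no point, that is
  where \<open>d\<close> vanishes: at \<open>cos 2\<theta> = 0\<close> for \<open>a = 1\<close>, at
  \<open>cos 2\<theta> = - 1\<close> for \<open>a = 0\<close>, nowhere for
  \<open>a = -1\<close>.\<close>

lemma negligible_borel_part_torus:
  assumes a: "a \<in> {1, 0, -1}"
  shows "negligible (pgl_carrier - {p \<otimes>\<^bsub>PGL\<^esub> q | p q. p \<in> borel_part \<and> q \<in> torus a})"
proof (rule negligible_subset)
  let ?Z = "{p :: point. fst (fst p) = 0} \<union> {p. snd (fst p) = 0}"
  have "{p :: point. fst (fst p) = 0} = {p. ((1, 0), 0) \<bullet> p = 0}" "{p :: point. snd (fst p) = 0} = {p. ((0, 1), 0) \<bullet> p = 0}"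
    by (auto simp: inner_prod_def)
  moreover have "negligible {p :: point. ((1, 0), 0) \<bullet> p = 0}" "negligible {p :: point. ((0, 1), 0) \<bullet> p = 0}"
    by (intro negligible_hyperplane; simp add: zero_prod_def)+
  ultimately show "negligible ?Z" by (simp add: negligible_Un)
  show "pgl_carrier - {p \<otimes>\<^bsub>PGL\<^esub> q | p q. p \<in> borel_part \<and> q \<in> torus a} \<subseteq> ?Z"
  proof (rule subsetI, rule ccontr)
    fix p assume p: "p \<in> pgl_carrier - {p \<otimes>\<^bsub>PGL\<^esub> q | p q. p \<in> borel_part \<and> q \<in> torus a}" and "p \<notin> ?Z"
    then have pm: "p \<in> pgl_carrier" and ne: "cos2 p \<noteq> 0" "sin2 p \<noteq> 0" by (simp_all add: cos2_def sin2_def)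
    note c = circle[OF pm]
    have "cos2 p \<noteq> - 1" using c ne(2) by auto
    define d where "d = ((1 + cos2 p) - a * (1 - cos2 p)) / 2"
    have d: "d \<noteq> 0" using a ne(1) \<open>cos2 p \<noteq> - 1\<close> by (auto simp: d_def)
    define t where "t = (1 + a) * sin2 p / 2"
    let ?q = "point t (cos2 p) (sin2 p) d" and ?p = "point (shift p - snd p / d * t) 1 0 (snd p / d)"
    have "?q \<in> torus a" using d c by (simp add: torus_def point_mem coordinates_point d_def t_def)
    moreover have "?p \<in> borel_part" using d pm by (intro point_borel_part) (simp add: mem_pgl)
    moreover have "?p \<otimes>\<^bsub>PGL\<^esub> ?q = p"
      using d point_coordinates[of p] by (simp add: pgl_mult_affine[OF c])
    ultimately have "p \<in> {p \<otimes>\<^bsub>PGL\<^esub> q | p q. p \<in> borel_part \<and> q \<in> torus a}"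
      by (intro CollectI exI[of _ ?p] exI[of _ ?q] conjI) simp_all
    then show False using p by simp
  qed
qed

lemma two_piecesI: "connected A \<Longrightarrow> connected B \<Longrightarrow> S = A \<union> B \<Longrightarrow> two_pieces S"
  unfolding two_pieces_def by (intro exI conjI)

lemma two_pieces_pgl: "two_pieces pgl_carrier"
proof (rule two_piecesI)
  have "connected (- {0 :: real \<times> real})"
    by (rule connected_punctured_universe) simp
  then show "connected ((- {0 :: real \<times> real}) \<times> {0 :: real<..})" "connected ((- {0 :: real \<times> real}) \<times> {..< 0 :: real})"
    by (auto intro!: connected_Times)
  show "pgl_carrier = (- {0}) \<times> {0<..} \<union> (- {0}) \<times> {..<0}"
    by (auto simp: pgl_carrier_def)
qed

lemma two_pieces_borel_part: "two_pieces borel_part"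
proof (rule two_piecesI)
  show "connected (({0 :: real<..} \<times> {0 :: real}) \<times> {0 :: real<..})" "connected (({0 :: real<..} \<times> {0 :: real}) \<times> {..< 0 :: real})"
    by (auto intro!: connected_Times)
  show "borel_part = ({0<..} \<times> {0}) \<times> {0<..} \<union> ({0<..} \<times> {0}) \<times> {..<0}"
    by (auto simp: borel_part_def mem_pgl zero_prod_def)
qed

lemma continuous_on_torus_param:
  "continuous_on {z. fst z * fst z - a * snd z * snd z \<noteq> 0}
    (\<lambda>z. of_matrix (fst z) (a * snd z) (snd z) (fst z))"
proof -
  have ne: "\<forall>z\<in>{z. fst z * fst z - a * snd z * snd z \<noteq> 0}. (snd z)\<^sup>2 + (fst z)\<^sup>2 \<noteq> 0"
  proof
    fix z assume "z \<in> {z. fst z * fst z - a * snd z * snd z \<noteq> 0}"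
    then have "fst z * fst z - a * snd z * snd z \<noteq> 0" by simp
    from row_pos[OF this] show "(snd z)\<^sup>2 + (fst z)\<^sup>2 \<noteq> 0" by (rule less_imp_neq[symmetric])
  qed
  show ?thesis
    unfolding of_matrix_def point_def by (intro continuous_intros ne)
qed

text \<open>A matrix and its negative have the same class, so half of the parameter plane suffices.
  For \<open>a = 1\<close> the four sectors cut out by the diagonals become two, for
  \<open>a = 0\<close> the two half planes become one, and for \<open>a = -1\<close> the punctured
  plane is connected already.\<close>

lemma two_pieces_torus:
  assumes a: "a \<in> {1, 0, -1}"
  shows "two_pieces (torus a)"
proof -
  let ?Q = "\<lambda>z. of_matrix (fst z) (a * snd z) (snd z) (fst z)"
  let ?S = "{z. fst z * fst z - a * snd z * snd z \<noteq> 0}"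
  have sub: "two_pieces (torus a)" if "two_pieces A" "A \<subseteq> ?S" "\<And>z. z \<in> ?S \<Longrightarrow> z \<in> A \<or> - z \<in> A" for A
  proof -
    have "two_pieces (?Q ` A)"
      by (rule two_pieces_image[OF that(1) continuous_on_subset[OF continuous_on_torus_param that(2)]])
    moreover have "?Q ` A = ?Q ` ?S"
    proof (rule subset_antisym[OF image_mono[OF that(2)]], rule image_subsetI)
      fix z assume "z \<in> ?S"
      moreover have "?Q (- z) = ?Q z" by (simp add: of_matrix_def)
      ultimately show "?Q z \<in> ?Q ` A" using that(3)[of z] by (auto intro: rev_image_eqI)
    qed
    ultimately show ?thesis by (simp add: torus_eq)
  qed
  consider "a = 1" | "a = 0" | "a = - 1" using a by auto
  then show ?thesis
  proof cases
    case 1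
    have "convex {z :: real \<times> real. (1, 1) \<bullet> z > 0 \<and> (1, - 1) \<bullet> z > 0}"
      "convex {z :: real \<times> real. (1, 1) \<bullet> z > 0 \<and> (1, - 1) \<bullet> z < 0}"
      unfolding Collect_conj_eq by (intro convex_Int convex_halfspace_gt convex_halfspace_lt)+
    then have "two_pieces ({z :: real \<times> real. (1, 1) \<bullet> z > 0 \<and> (1, - 1) \<bullet> z > 0} \<union>
        {z. (1, 1) \<bullet> z > 0 \<and> (1, - 1) \<bullet> z < 0})"
      by (intro two_piecesI[OF _ _ refl] convex_connected)
    moreover have "fst z * fst z - a * snd z * snd z = ((1, 1) \<bullet> z) * ((1, - 1) \<bullet> z)" for z
      by (simp add: 1 inner_prod_def algebra_simps)
    ultimately show ?thesis
      by (intro sub[where A = "{z :: real \<times> real. (1, 1) \<bullet> z > 0 \<and> (1, - 1) \<bullet> z > 0} \<union>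
        {z. (1, 1) \<bullet> z > 0 \<and> (1, - 1) \<bullet> z < 0}"]) (auto simp: inner_prod_def)
  next
    case 2
    have "convex {z :: real \<times> real. (1, 0) \<bullet> z > 0}" by (rule convex_halfspace_gt)
    then have "two_pieces {z :: real \<times> real. (1, 0) \<bullet> z > 0}"
      by (intro two_piecesI[where A = "{z. (1, 0) \<bullet> z > 0}" and B = "{}"] convex_connected) auto
    then show ?thesis by (rule sub) (auto simp: 2 inner_prod_def)
  next
    case 3
    have "connected (- {0 :: real \<times> real})" by (rule connected_punctured_universe) simp
    then have "two_pieces (- {0 :: real \<times> real})"
      by (intro two_piecesI[where A = "- {0}" and B = "{}"]) auto
    then show ?thesis
      by (rule sub) (auto simp: 3 zero_prod_def sum_squares_eq_zero_iff)
  qed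
qed

context
  fixes \<kappa> :: "point \<Rightarrow> 'p::euclidean_space" and \<kappa>' :: "'p \<Rightarrow> point"
  assumes \<kappa>: "chart_embedding \<kappa> \<kappa>'"
begin

interpretation chart_group PGL \<kappa> \<kappa>' by (rule chart_group_PGL[OF \<kappa>])

lemma tangent_borel_part: "tangent borel_part = {z. snd (fst z) = 0}"
proof (rule subset_antisym; rule subsetI)
  fix z assume "z \<in> tangent borel_part"
  then obtain g where g: "range g \<subseteq> borel_part" "(g has_vector_derivative z) (at 0)"
    unfolding tangent_def mem_Collect_eq by (elim exE conjE)
  have "((\<lambda>t. snd (fst (g t))) has_vector_derivative snd (fst z)) (at 0)"
    by (intro bounded_linear.has_vector_derivative[OF bounded_linear_snd]
        bounded_linear.has_vector_derivative[OF bounded_linear_fst] g(2))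
  moreover have "snd (fst (g t)) \<in> {0}" for t
  proof -
    have "g t \<in> borel_part" using g(1) by blast
    then show ?thesis by (simp add: borel_part_def)
  qed
  ultimately have "snd (fst z) \<in> {0}"
    by (rule has_vector_derivative_in_subspace[OF subspace_single_0, rotated])
  then show "z \<in> {z. snd (fst z) = 0}" by simp
next
  fix z :: point assume "z \<in> {z. snd (fst z) = 0}"
  then have "z = ((fst (fst z), 0), snd z)" by (simp add: prod_eq_iff)
  then obtain r s where z: "z = ((r, 0), s)" by (rule that)
  define g :: "real \<Rightarrow> point" where "g t = ((exp (r * t), 0), exp (s * t))" for t
  have "smooth_on UNIV g"
    unfolding g_def by (intro smooth_on_Pair smooth_on_exp_compose smooth_on_mult smooth_on_const smooth_on_ident open_UNIV)
  moreover have "range g \<subseteq> borel_part"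
    by (rule image_subsetI) (simp add: g_def borel_part_def mem_pgl zero_prod_def)
  moreover have "g 0 = \<one>\<^bsub>PGL\<^esub>" by (simp add: g_def point_def)
  moreover have "(g has_vector_derivative z) (at 0)"
  proof -
    have "((\<lambda>t. exp (c * t)) has_vector_derivative c) (at (0::real))" for c :: real
      by (auto intro!: derivative_eq_intros simp: has_real_derivative_iff_has_vector_derivative[symmetric])
    then show ?thesis
      unfolding g_def z by (intro has_vector_derivative_Pair has_vector_derivative_const)
  qed
  ultimately show "z \<in> tangent borel_part"
    unfolding tangent_def by (intro CollectI exI[of _ g] conjI)
qed

lemma has_vector_derivative_along:
  assumes "(f has_derivative f') (at (point 0 1 0 1))" "(g has_vector_derivative z) (at (0::real))" "g 0 = point 0 1 0 1"
  shows "((\<lambda>t. f (g t)) has_vector_derivative f' z) (at 0)"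
proof -
  have "((\<lambda>t. f (g t)) has_derivative (\<lambda>t. f' (t *\<^sub>R z))) (at 0)"
    using has_derivative_compose[of g "\<lambda>t. t *\<^sub>R z" 0 UNIV f f'] assms by (simp add: has_vector_derivative_def)
  then show ?thesis
    unfolding has_vector_derivative_def by (simp add: linear_cmul[OF has_derivative_linear[OF assms(1)]])
qed

text \<open>One inclusion differentiates the two defining equations along a curve. For the other,
  the curve in the parameter \<open>y\<close> has speed \<open>r / 2\<close> at 0, since the chart
  sees the doubled angle.\<close>

lemma tangent_torus:
  assumes a: "a \<in> {1, 0, -1}"
  shows "tangent (torus a) = range (\<lambda>r. ((r * ((1 + a) / 2), r), 0))"
proof (rule subset_antisym; rule subsetI)
  fix z assume "z \<in> tangent (torus a)"
  then obtain g where g: "range g \<subseteq> torus a" "g 0 = point 0 1 0 1" "(g has_vector_derivative z) (at 0)"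
    unfolding tangent_def PGL_simps mem_Collect_eq by (elim exE conjE)
  let ?F = "\<lambda>p. (snd p - ((1 + cos2 p) - a * (1 - cos2 p)) / 2, shift p - (1 + a) * sin2 p / 2)"
  have "(?F has_derivative (\<lambda>w. (snd w, fst (fst w) - (1 + a) * snd (fst w) / 2))) (at (point 0 1 0 1))"
    by (intro has_derivative_Pair) (auto intro!: derivative_eq_intros has_derivative_coordinates)
  from has_vector_derivative_along[OF this g(3,2)]
  have "((\<lambda>t. ?F (g t)) has_vector_derivative (snd z, fst (fst z) - (1 + a) * snd (fst z) / 2)) (at 0)" .
  moreover have "?F (g t) \<in> {0}" for t
  proof -
    have "g t \<in> torus a" using g(1) by blast
    then show ?thesis by (simp add: torus_def zero_prod_def)
  qed
  ultimately have "(snd z, fst (fst z) - (1 + a) * snd (fst z) / 2) \<in> {0}"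
    by (rule has_vector_derivative_in_subspace[OF subspace_single_0, rotated])
  then have "z = ((snd (fst z) * ((1 + a) / 2), snd (fst z)), 0)"
    by (simp add: zero_prod_def prod_eq_iff)
  then show "z \<in> range (\<lambda>r. ((r * ((1 + a) / 2), r), 0))" by (rule range_eqI)
next
  fix z assume "z \<in> range (\<lambda>r. ((r * ((1 + a) / 2), r), 0 :: real))"
  then obtain r where z: "z = ((r * ((1 + a) / 2), r), 0)" by blast
  \<comment> \<open>The parameter \<open>y\<close> stays in \<open>[-1/4, 1/4]\<close>, so that the curve does not leave \<open>torus 1\<close>.\<close>
  define y where "y t = (r / 2) * t / (1 + (r * t)\<^sup>2)" for t
  define g where "g t = of_matrix 1 (a * y t) (y t) 1" for t
  have den: "1 + (r * t)\<^sup>2 > 0" for t by (simp add: add_pos_nonneg)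
  have den_ne: "1 + (r * t)\<^sup>2 \<noteq> 0" for t using den[of t] by linarith
  have "\<bar>y t\<bar> < 1" for t
  proof -
    have "\<bar>(r / 2) * t\<bar> < 1 + (r * t)\<^sup>2"
    proof -
      have "0 \<le> (\<bar>r * t\<bar> - 1)\<^sup>2" by simp
      then have "2 * \<bar>r * t\<bar> \<le> 1 + (r * t)\<^sup>2" by (simp add: power2_eq_square algebra_simps)
      then show ?thesis using den[of t] by (simp add: abs_mult)
    qed
    then show ?thesis using den[of t] by (simp add: y_def abs_divide)
  qed
  then have y2: "(y t)\<^sup>2 < 1" for t by (simp add: abs_square_less_1)
  have det: "1 * 1 - a * y t * y t \<noteq> 0" for t
  proof -
    have "a * (y t)\<^sup>2 \<le> 1 * (y t)\<^sup>2" using a by (intro mult_right_mono) auto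
    moreover have "a * y t * y t = a * (y t)\<^sup>2" by (simp add: power2_eq_square)
    ultimately show ?thesis using y2[of t] by linarith
  qed
  have smooth_y: "smooth_on UNIV y"
    unfolding y_def
    by (intro smooth_on_divide smooth_on_mult smooth_on_add smooth_on_power smooth_on_const smooth_on_ident open_UNIV)
       (rule den_ne)
  have pos: "(y t)\<^sup>2 + 1\<^sup>2 \<noteq> 0" for t by (smt (verit) zero_le_power2 one_power2)
  have "smooth_on UNIV g"
    unfolding g_def of_matrix_def using pos
    by (intro smooth_on_point smooth_on_divide smooth_on_add smooth_on_diff smooth_on_mult smooth_on_power
        smooth_on_const smooth_y open_UNIV) auto
  moreover have "range g \<subseteq> torus a"
    unfolding g_def by (rule image_subsetI) (rule torus_of_matrix[OF det])
  moreover have y0: "y 0 = 0" by (simp add: y_def)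
  then have "g 0 = \<one>\<^bsub>PGL\<^esub>" by (simp add: g_def one_of_matrix)
  moreover have "(g has_vector_derivative z) (at 0)"
  proof -
    have y': "(y has_real_derivative r / 2) (at 0)"
      unfolding y_def by (auto intro!: derivative_eq_intros simp: field_simps)
    have 1: "((\<lambda>t. (1 * y t + a * y t * 1) / ((y t)\<^sup>2 + 1\<^sup>2)) has_real_derivative r * ((1 + a) / 2)) (at 0)"
      by (auto intro!: derivative_eq_intros y' simp: y0 field_simps)
    have 2: "((\<lambda>t. (1\<^sup>2 - (y t)\<^sup>2) / ((y t)\<^sup>2 + 1\<^sup>2)) has_real_derivative 0) (at 0)"
      by (auto intro!: derivative_eq_intros y' simp: y0)
    have 3: "((\<lambda>t. 2 * y t * 1 / ((y t)\<^sup>2 + 1\<^sup>2)) has_real_derivative r) (at 0)"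
      by (auto intro!: derivative_eq_intros y' simp: y0)
    have 4: "((\<lambda>t. (1 * 1 - a * y t * y t) / ((y t)\<^sup>2 + 1\<^sup>2)) has_real_derivative 0) (at 0)"
      by (auto intro!: derivative_eq_intros y' simp: y0)
    have 5: "((\<lambda>t. exp ((1 * y t + a * y t * 1) / ((y t)\<^sup>2 + 1\<^sup>2)) * ((1\<^sup>2 - (y t)\<^sup>2) / ((y t)\<^sup>2 + 1\<^sup>2)))
        has_real_derivative r * ((1 + a) / 2)) (at 0)"
      by (rule DERIV_cong[OF DERIV_mult[OF DERIV_chain2[OF DERIV_exp 1] 2]]) (simp add: y0)
    have 6: "((\<lambda>t. exp ((1 * y t + a * y t * 1) / ((y t)\<^sup>2 + 1\<^sup>2)) * (2 * y t * 1 / ((y t)\<^sup>2 + 1\<^sup>2)))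
        has_real_derivative r) (at 0)"
      by (rule DERIV_cong[OF DERIV_mult[OF DERIV_chain2[OF DERIV_exp 1] 3]]) (simp add: y0)
    show ?thesis
      unfolding g_def of_matrix_def point_def z
      by (intro has_vector_derivative_Pair
          5[unfolded has_real_derivative_iff_has_vector_derivative]
          6[unfolded has_real_derivative_iff_has_vector_derivative]
          4[unfolded has_real_derivative_iff_has_vector_derivative])
  qed
  ultimately show "z \<in> tangent (torus a)"
    unfolding tangent_def by (intro CollectI exI[of _ g] conjI)
qed

end

lemma exponentiable_E43:
  assumes a: "a \<in> {1, 0, -1}"
  shows "exponentiable_le2 (pair2 (0, - 1) (0, a) (1, 0) 1 0)"
proof -
  let ?P = "pair2 (0, - 1) (0, a) (1, 0) 1 0"
  let ?k = "(1 + a) / 2"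
  \<comment> \<open>\<open>X\<close>, \<open>Y\<close> and \<open>A\<close> go to minus the diagonal
    generator, the upper unipotent generator and minus the generator of the torus. The signs come
    from \<open>[X,Y] = - Y\<close> and \<open>[Y,A] = X\<close>, and \<open>?k\<close> is the slope
    of the torus at the identity.\<close>
  let ?T = "\<lambda>v :: point. ((snd (fst v) - snd v * ?k, - snd v), - fst (fst v))"
  let ?S = "\<lambda>v :: point. ((- snd v, fst (fst v) - snd (fst v) * ?k), - snd (fst v))"
  have lin: "linear ?T" by (rule linearI) (auto simp: field_simps)
  show ?thesis
  proof (rule exponentiable_le2I[OF chart_group_PGL[OF chart_embedding_3] subgroup_borel_part _ subgroup_torus
      _ _ _ _ two_pieces_borel_part two_pieces_torus[OF a] ambient_pair2 lin])
    show "closedin (top_of_set (carrier PGL)) borel_part" "closedin (top_of_set (carrier PGL)) (torus a)"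
      using closedin_borel_part closedin_torus by simp_all
    show "borel_part \<inter> torus a = {\<one>\<^bsub>PGL\<^esub>}" by (simp add: borel_part_torus)
    show "negligible (carrier PGL - {x \<otimes>\<^bsub>PGL\<^esub> y | x y. x \<in> borel_part \<and> y \<in> torus a})"
      using negligible_borel_part_torus[OF a] by simp
    show "two_pieces (carrier PGL)" by (simp add: two_pieces_pgl)
    show "bij ?T" by (rule bij_by_inverse[of ?S]) auto
    show "?T (bracket ?P v w) = chart_group.lie_bracket PGL (?T v) (?T w)" for v w
      unfolding lie_bracket_PGL[OF chart_embedding_3] bracket_pair2 by (simp add: field_simps)
    show "?T ` part1 ?P = chart_group.tangent PGL borel_part"
      unfolding tangent_borel_part[OF chart_embedding_3] part1_pair2
    proof (rule subset_antisym; rule subsetI)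
      show "z \<in> ?T ` (UNIV \<times> {0})" if "z \<in> {z. snd (fst z) = 0}" for z
        using that by (intro image_eqI[of _ _ "((- snd z, fst (fst z)), 0)"]) (simp_all add: prod_eq_iff)
    qed auto
    show "?T ` part2 ?P = chart_group.tangent PGL (torus a)"
      unfolding tangent_torus[OF chart_embedding_3 a] part2_pair2
    proof (rule subset_antisym; rule subsetI)
      show "z \<in> range (\<lambda>r. ((r * ?k, r), 0))" if "z \<in> ?T ` ({0} \<times> UNIV)" for z
        using that by (auto intro: range_eqI[of _ _ "snd (fst z)"])
      show "z \<in> ?T ` ({0} \<times> UNIV)" if "z \<in> range (\<lambda>r. ((r * ?k, r), 0))" for z
        using that by (intro image_eqI[of _ _ "(0, - snd (fst z))"]) auto
    qed
  qed
qed

subsection \<open>Matched pairs in coordinates\<close>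

lemma dim_first_factor: "dim (UNIV \<times> {0} :: ('v::euclidean_space \<times> real) set) = DIM('v)"
proof -
  have "linear (\<lambda>x :: 'v. (x, 0 :: real))" by (rule linearI) simp_all
  then have "dim ((\<lambda>x :: 'v. (x, 0 :: real)) ` UNIV) = dim (UNIV :: 'v set)"
    by (rule dim_image_eq) (simp add: inj_on_def)
  moreover have "(\<lambda>x :: 'v. (x, 0 :: real)) ` UNIV = UNIV \<times> {0}" by auto
  ultimately show ?thesis by simp
qed

lemma dim_second_factor: "dim ({0} \<times> UNIV :: ('v::euclidean_space \<times> real) set) = 1"
proof -
  have "linear (\<lambda>x :: real. (0 :: 'v, x))" by (rule linearI) simp_all
  then have "dim ((\<lambda>x :: real. (0 :: 'v, x)) ` UNIV) = dim (UNIV :: real set)"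
    by (rule dim_image_eq) (simp add: inj_on_def)
  moreover have "(\<lambda>x :: real. (0 :: 'v, x)) ` UNIV = {0} \<times> UNIV" by auto
  ultimately show ?thesis by simp
qed

lemma subspace_factors: "subspace (UNIV \<times> {0} :: ('v::real_vector \<times> real) set)"
  "subspace ({0} \<times> UNIV :: ('v::real_vector \<times> real) set)"
  by (simp_all add: subspace_def zero_prod_def)

lemma factors_sum: "(UNIV :: ('v::real_vector \<times> real) set) = {x + y | x y. x \<in> UNIV \<times> {0} \<and> y \<in> {0} \<times> UNIV}"
proof -
  have "\<exists>x y. z = x + y \<and> x \<in> UNIV \<times> {0} \<and> y \<in> {0} \<times> UNIV" for z :: "'v \<times> real"
    by (rule exI[of _ "(fst z, 0)"], rule exI[of _ "(0, snd z)"]) (simp add: prod_eq_iff)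
  then show ?thesis by simp
qed

lemma matched_pair_pair1: "matched_pair_dim (pair1 b x) 1 1"
proof -
  have "lie_algebra UNIV (bracket (pair1 b x))"
    unfolding lie_algebra_def by (simp add: bracket_pair1 prod_eq_iff algebra_simps)
  moreover have "lie_subalgebra (UNIV \<times> {0}) UNIV (bracket (pair1 b x))"
    "lie_subalgebra ({0} \<times> UNIV) UNIV (bracket (pair1 b x))"
    by (auto simp: lie_subalgebra_def subspace_factors bracket_pair1)
  moreover have "UNIV \<times> {0} \<inter> {0} \<times> UNIV = {0 :: real \<times> real}" by (auto simp: zero_prod_def)
  ultimately show ?thesis
    using factors_sum dim_first_factor[where 'v = real] dim_second_factor[where 'v = real]
    by (simp add: matched_pair_dim_def matched_pair_def)
qed

text \<open>The cyclic sum in the Jacobi identity is trilinear and alternating, hence in dimension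
  three a multiple of the determinant \<open>D\<close>. The hypotheses say that its coefficients
  vanish.\<close>

lemma matched_pair_pair2:
  assumes jac: "c1 * (h + d) = 0" "(c2 + b1) * d = h * c2 + d * c2"
  shows "matched_pair_dim (pair2 (0, d) (b1, b2) (c1, c2) h 0) 2 1"
proof -
  let ?P = "pair2 (0, d) (b1, b2) (c1, c2) h 0"
  have "bracket ?P x (bracket ?P y z) + bracket ?P y (bracket ?P z x) + bracket ?P z (bracket ?P x y) = 0" for x y z
  proof -
    obtain x1 x2 x3 y1 y2 y3 z1 z2 z3 where xyz: "x = ((x1, x2), x3)" "y = ((y1, y2), y3)" "z = ((z1, z2), z3)"
      by (cases x, cases y, cases z) auto
    define D where "D = x1 * (y2 * z3 - y3 * z2) - x2 * (y1 * z3 - y3 * z1) + x3 * (y1 * z2 - y2 * z1)"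
    have "fst (fst (bracket ?P x (bracket ?P y z) + bracket ?P y (bracket ?P z x) + bracket ?P z (bracket ?P x y)))
        = - D * (c1 * (h + d))"
      unfolding xyz D_def by (simp add: bracket_pair2) algebra
    moreover have "snd (fst (bracket ?P x (bracket ?P y z) + bracket ?P y (bracket ?P z x) + bracket ?P z (bracket ?P x y)))
        = D * ((c2 + b1) * d - (h * c2 + d * c2))"
      unfolding xyz D_def by (simp add: bracket_pair2) algebra
    moreover have "snd (bracket ?P x (bracket ?P y z) + bracket ?P y (bracket ?P z x) + bracket ?P z (bracket ?P x y)) = 0"
      unfolding xyz by (simp add: bracket_pair2) algebra
    ultimately show ?thesis
      unfolding jac by (simp add: prod_eq_iff)
  qed
  note jacobi = this
  have "lie_algebra UNIV (bracket ?P)"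
    unfolding lie_algebra_def
  proof (intro conjI ballI allI)
    show "bracket ?P x (bracket ?P y z) + bracket ?P y (bracket ?P z x) + bracket ?P z (bracket ?P x y) = 0" for x y z
      by (rule jacobi)
  qed (simp_all add: bracket_pair2 prod_eq_iff algebra_simps)
  moreover have "lie_subalgebra (UNIV \<times> {0}) UNIV (bracket ?P)" "lie_subalgebra ({0} \<times> UNIV) UNIV (bracket ?P)"
    unfolding lie_subalgebra_def using subspace_factors[where 'v = "real \<times> real"]
    by (auto simp: bracket_pair2 zero_prod_def)
  moreover have "UNIV \<times> {0} \<inter> {0} \<times> UNIV = {0 :: (real \<times> real) \<times> real}" by (auto simp: prod_eq_iff)
  moreover have "dim (UNIV \<times> {0} :: ((real \<times> real) \<times> real) set) = 2"
    using dim_first_factor[where 'v = "real \<times> real"] by simp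
  ultimately show ?thesis
    unfolding matched_pair_dim_def matched_pair_def ambient_pair2 part1_pair2 part2_pair2
    by (intro conjI factors_sum dim_second_factor)
qed

lemma listed2_eq:
  "listed2 E11 = pair2 (0, 0) (0, 0) (0, 0) 0 0"
  "listed2 E12 = pair2 (0, 1) (0, 0) (0, 0) 0 0"
  "listed2 (E21 r) = pair2 (0, 0) (1, 0) (0, r) 0 0"
  "listed2 E22 = pair2 (0, 0) (1, 1) (0, 1) 0 0"
  "listed2 E23 = pair2 (0, 0) (0, 1) (0, 0) 0 0"
  "listed2 E24 = pair2 (0, 1) (0, 1) (0, 0) 0 0"
  "listed2 E25 = pair2 (0, 1) (0, 0) (0, 1) 0 0"
  "listed2 (E3a a) = pair2 (0, a) (0, 0) (0, 0) 1 0"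
  "listed2 (E41 d b) = pair2 (0, d) (1, b) (0, d) 1 0"
  "listed2 (E42 d) = pair2 (0, d) (0, 1) (0, 0) 1 0"
  "listed2 (E43 a) = pair2 (0, - 1) (0, a) (1, 0) 1 0"
  by (simp_all add: zero_prod_def)

lemma matched_pair_listed2: "matched_pair_dim (listed2 e) 2 1"
  by (cases e; simp only: listed2_eq; rule matched_pair_pair2) (simp_all add: algebra_simps)

lemma exponentiable_listed2:
  assumes "admissible e"
  shows "exponentiable_le2 (listed2 e)"
proof (cases e)
  case (E41 d b)
  then have "b = 0 \<or> 1 = d" using assms by auto
  then show ?thesis unfolding E41 listed2_eq by (rule exponentiable_E41)
next
  case (E43 a)
  then have "a \<in> {1, 0, -1}" using assms by simp
  then show ?thesis unfolding E43 listed2_eq by (rule exponentiable_E43)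
next
  case E11
  show ?thesis unfolding E11 listed2_eq by (rule exponentiable_pair2_abelian[unfolded zero_prod_def]) simp
next
  case (E21 r)
  show ?thesis unfolding E21 listed2_eq by (rule exponentiable_pair2_abelian[unfolded zero_prod_def]) simp
next
  case E22
  show ?thesis unfolding E22 listed2_eq by (rule exponentiable_pair2_abelian[unfolded zero_prod_def]) simp
next
  case E23
  show ?thesis unfolding E23 listed2_eq by (rule exponentiable_pair2_abelian[unfolded zero_prod_def]) simp
next
  case E12
  show ?thesis unfolding E12 listed2_eq by (rule exponentiable_pair2_ideal[unfolded zero_prod_def])
next
  case E24
  show ?thesis unfolding E24 listed2_eq by (rule exponentiable_pair2_ideal[unfolded zero_prod_def])
next
  case E3a
  show ?thesis unfolding E3a listed2_eq by (rule exponentiable_pair2_ideal[unfolded zero_prod_def])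
next
  case E42
  show ?thesis unfolding E42 listed2_eq by (rule exponentiable_pair2_ideal[unfolded zero_prod_def])
next
  case E25
  show ?thesis unfolding E25 listed2_eq by (rule exponentiable_E25)
qed

subsection \<open>Isomorphisms in coordinates\<close>

lemma lie_pair_iso_UNIV_E:
  assumes "lie_pair_iso P Q" "ambient P = UNIV" "ambient Q = UNIV"
  obtains f where "bij f" "\<And>x y. f (x + y) = f x + f y" "\<And>c x. f (c *\<^sub>R x) = c *\<^sub>R f x"
    "\<And>v w. f (bracket P v w) = bracket Q (f v) (f w)" "f ` part1 P = part1 Q" "f ` part2 P = part2 Q"
    "\<And>v. f v = 0 \<Longrightarrow> v = 0"
proof -
  obtain f where f: "bij f" "\<And>x y. f (x + y) = f x + f y" "\<And>c x. f (c *\<^sub>R x) = c *\<^sub>R f x"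
    "\<And>v w. f (bracket P v w) = bracket Q (f v) (f w)" "f ` part1 P = part1 Q" "f ` part2 P = part2 Q"
    using assms(1) by (auto simp: lie_pair_iso_def assms(2,3))
  have f0: "f 0 = 0" using f(3)[of 0 0] by simp
  have "v = 0" if "f v = 0" for v
    using injD[OF bij_is_inj[OF f(1)], of v 0] that f0 by simp
  with f show ?thesis by (rule that)
qed

lemma lie_pair_iso_pair1D:
  assumes "lie_pair_iso (pair1 b x) (pair1 b' x')"
  shows "\<exists>u l. u \<noteq> 0 \<and> l \<noteq> 0 \<and> b = l * b' \<and> x = u * x'"
proof -
  obtain f where f: "bij f" "\<And>x y. f (x + y) = f x + f y" "\<And>c x. f (c *\<^sub>R x) = c *\<^sub>R f x"
    "\<And>v w. f (bracket (pair1 b x) v w) = bracket (pair1 b' x') (f v) (f w)"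
    "f ` part1 (pair1 b x) = part1 (pair1 b' x')" "f ` part2 (pair1 b x) = part2 (pair1 b' x')"
    and inj: "\<And>v. f v = 0 \<Longrightarrow> v = 0"
    by (rule lie_pair_iso_UNIV_E[OF assms ambient_pair1 ambient_pair1], rule that)
  have "f (1, 0) \<in> f ` (UNIV \<times> {0})" by (rule imageI) simp
  also have "\<dots> = UNIV \<times> {0}" using f(5) by simp
  finally have "f (1, 0) \<in> UNIV \<times> {0}" .
  then obtain u where u: "f (1, 0) = (u, 0)" by auto
  have "f (0, 1) \<in> f ` ({0} \<times> UNIV)" by (rule imageI) simp
  also have "\<dots> = {0} \<times> UNIV" using f(6) by simp
  finally have "f (0, 1) \<in> {0} \<times> UNIV" .
  then obtain l where l: "f (0, 1) = (0, l)" by auto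
  have "u \<noteq> 0" using inj[of "(1, 0)"] u by (auto simp: zero_prod_def)
  moreover have "l \<noteq> 0" using inj[of "(0, 1)"] l by (auto simp: zero_prod_def)
  moreover have "f (b, x) = (b * u, x * l)"
    using f(2)[of "b *\<^sub>R (1, 0)" "x *\<^sub>R (0, 1)"] unfolding f(3) u l by simp
  then have "b * u = u * b' * l" "x * l = l * (u * x')"
    using f(4)[of "(1, 0)" "(0, 1)"] by (simp_all add: bracket_pair1 u l mult.commute mult.left_commute)
  ultimately show ?thesis by (intro exI[of _ u] exI[of _ l]) (simp add: mult.commute[of _ l])
qed

text \<open>\<open>X' = p X + q Y\<close>, \<open>Y' = r X + s Y\<close>, \<open>A' = l A\<close> is a basis in which a pair with structure constants
  \<open>e' b' c' h' k'\<close> has the structure constants \<open>e b c h k\<close>.\<close>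

definition pair2_change ::
    "real \<Rightarrow> real \<Rightarrow> real \<Rightarrow> real \<Rightarrow> real \<Rightarrow> real \<times> real \<Rightarrow> real \<times> real \<Rightarrow> real \<times> real \<Rightarrow> real \<Rightarrow> real
      \<Rightarrow> real \<times> real \<Rightarrow> real \<times> real \<Rightarrow> real \<times> real \<Rightarrow> real \<Rightarrow> real \<Rightarrow> bool"
  where "pair2_change p q r s l e b c h k e' b' c' h' k' \<longleftrightarrow>
    p * s - q * r \<noteq> 0 \<and> l \<noteq> 0 \<and>
    fst e * p + snd e * r = (p * s - q * r) * fst e' \<and> fst e * q + snd e * s = (p * s - q * r) * snd e' \<and>
    fst b * p + snd b * r = l * (p * fst b' + q * fst c') \<and> fst b * q + snd b * s = l * (p * snd b' + q * snd c') \<and>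
    fst c * p + snd c * r = l * (r * fst b' + s * fst c') \<and> fst c * q + snd c * s = l * (r * snd b' + s * snd c') \<and>
    h = p * h' + q * k' \<and> k = r * h' + s * k'"

lemma lie_pair_iso_pair2D:
  assumes "lie_pair_iso (pair2 e b c h k) (pair2 e' b' c' h' k')"
  shows "\<exists>p q r s l. pair2_change p q r s l e b c h k e' b' c' h' k'"
proof -
  let ?P = "pair2 e b c h k" and ?Q = "pair2 e' b' c' h' k'"
  obtain f where f: "bij f" "\<And>x y. f (x + y) = f x + f y" "\<And>c x. f (c *\<^sub>R x) = c *\<^sub>R f x"
    "\<And>v w. f (bracket ?P v w) = bracket ?Q (f v) (f w)"
    "f ` part1 ?P = part1 ?Q" "f ` part2 ?P = part2 ?Q" and inj: "\<And>v. f v = 0 \<Longrightarrow> v = 0"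
    by (rule lie_pair_iso_UNIV_E[OF assms ambient_pair2 ambient_pair2], rule that)
  let ?X = "((1, 0), 0) :: (real \<times> real) \<times> real" and ?Y = "((0, 1), 0) :: (real \<times> real) \<times> real"
    and ?A = "((0, 0), 1) :: (real \<times> real) \<times> real"
  have "f ?X \<in> f ` (UNIV \<times> {0})" "f ?Y \<in> f ` (UNIV \<times> {0})" by (rule imageI; simp)+
  then have "f ?X \<in> UNIV \<times> {0}" "f ?Y \<in> UNIV \<times> {0}"
    unfolding f(5)[unfolded part1_pair2] .
  then obtain p q r s where X: "f ?X = ((p, q), 0)" and Y: "f ?Y = ((r, s), 0)" by auto
  have "?A \<in> {0} \<times> UNIV" by (simp add: zero_prod_def)
  then have "f ?A \<in> f ` ({0} \<times> UNIV)" by (rule imageI)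
  then have "f ?A \<in> {0} \<times> UNIV" unfolding f(6)[unfolded part2_pair2] .
  then obtain l where A: "f ?A = ((0, 0), l)" by (auto simp: zero_prod_def)
  have fv: "f ((x, y), a) = ((x * p + y * r, x * q + y * s), a * l)" for x y a
  proof -
    have "((x, y), a) = (x *\<^sub>R ?X + y *\<^sub>R ?Y) + a *\<^sub>R ?A" by simp
    then have "f ((x, y), a) = (x *\<^sub>R f ?X + y *\<^sub>R f ?Y) + a *\<^sub>R f ?A" by (simp only: f(2,3))
    then show ?thesis by (simp add: X Y A)
  qed
  have "p * s - q * r \<noteq> 0"
  proof
    assume 0: "p * s - q * r = 0"
    \<comment> \<open>A singular matrix annihilates these rows of its adjugate. Injectivity then
      makes all four entries vanish.\<close>
    have "f ((s, - q), 0) = 0" and "f ((r, - p), 0) = 0"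
      using 0 by (simp_all add: fv zero_prod_def algebra_simps)
    from inj[OF this(1)] inj[OF this(2)]
    have "f ?X = 0" by (simp add: X zero_prod_def)
    then show False using inj[of ?X] by (simp add: zero_prod_def)
  qed
  moreover have "l \<noteq> 0" using inj[of ?A] A by (auto simp: zero_prod_def)
  moreover have "f ((fst e, snd e), 0) = bracket ?Q (f ?X) (f ?Y)"
    using f(4)[of ?X ?Y] by (simp add: bracket_pair2)
  moreover have "f ((fst b, snd b), h) = bracket ?Q (f ?X) (f ?A)"
    using f(4)[of ?X ?A] by (simp add: bracket_pair2)
  moreover have "f ((fst c, snd c), k) = bracket ?Q (f ?Y) (f ?A)"
    using f(4)[of ?Y ?A] by (simp add: bracket_pair2)
  ultimately have "pair2_change p q r s l e b c h k e' b' c' h' k'"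
    unfolding pair2_change_def fv X Y A by (auto simp: bracket_pair2 prod_eq_iff)
  then show ?thesis by (intro exI)
qed

lemma lie_pair_iso_pair2I:
  assumes "pair2_change p q r s l e b c h k e' b' c' h' k'"
  shows "lie_pair_iso (pair2 e' b' c' h' k') (pair2 e b c h k)"
proof (rule lie_pair_iso_sym_UNIV[OF _ ambient_pair2])
  let ?D = "p * s - q * r"
  have D: "?D \<noteq> 0" and l: "l \<noteq> 0"
    and e: "fst e * p + snd e * r = ?D * fst e'" "fst e * q + snd e * s = ?D * snd e'"
    and b: "fst b * p + snd b * r = l * (p * fst b' + q * fst c')" "fst b * q + snd b * s = l * (p * snd b' + q * snd c')"
    and c: "fst c * p + snd c * r = l * (r * fst b' + s * fst c')" "fst c * q + snd c * s = l * (r * snd b' + s * snd c')"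
    and hk: "h = p * h' + q * k'" "k = r * h' + s * k'"
    using assms by (simp_all add: pair2_change_def)
  let ?f = "\<lambda>v :: (real \<times> real) \<times> real.
    ((fst (fst v) * p + snd (fst v) * r, fst (fst v) * q + snd (fst v) * s), snd v * l)"
  let ?g = "\<lambda>v :: (real \<times> real) \<times> real.
    (((fst (fst v) * s - snd (fst v) * r) / ?D, (snd (fst v) * p - fst (fst v) * q) / ?D), snd v / l)"
  have "?f (?g v) = v" for v
  proof -
    have "(fst (fst v) * s - snd (fst v) * r) * p + (snd (fst v) * p - fst (fst v) * q) * r = fst (fst v) * ?D"
      "(fst (fst v) * s - snd (fst v) * r) * q + (snd (fst v) * p - fst (fst v) * q) * s = snd (fst v) * ?D"
      by algebra+
    then show ?thesis using D l by (simp add: prod_eq_iff add_divide_distrib[symmetric])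
  qed
  note fg = this
  have "?g (?f v) = v" for v
  proof -
    have "(fst (fst v) * p + snd (fst v) * r) * s - (fst (fst v) * q + snd (fst v) * s) * r = fst (fst v) * ?D"
      "(fst (fst v) * q + snd (fst v) * s) * p - (fst (fst v) * p + snd (fst v) * r) * q = snd (fst v) * ?D"
      by algebra+
    then show ?thesis using D l by (simp add: prod_eq_iff)
  qed
  note gf = this
  have "bij ?f" using fg gf by (intro o_bij[of ?g]) (simp_all add: fun_eq_iff)
  moreover have "?f (v + w) = ?f v + ?f w" "?f (t *\<^sub>R v) = t *\<^sub>R ?f v" for v w t
    by (simp_all add: algebra_simps)
  moreover have "?f (bracket (pair2 e b c h k) v w) = bracket (pair2 e' b' c' h' k') (?f v) (?f w)" for v w
  proof -
    obtain x y a x' y' a' where vw: "v = ((x, y), a)" "w = ((x', y'), a')" by (cases v, cases w) auto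
    have 1: "(x * y' - y * x') * (?D * t) = ((x * p + y * r) * (x' * q + y' * s) - (x * q + y * s) * (x' * p + y' * r)) * t" for t
      by algebra
    have "fst (fst (?f (bracket (pair2 e b c h k) v w))) = (x * y' - y * x') * (fst e * p + snd e * r)
        + (a' * x - a * x') * (fst b * p + snd b * r) + (a' * y - a * y') * (fst c * p + snd c * r)"
      by (simp add: vw bracket_pair2 algebra_simps)
    also have "\<dots> = fst (fst (bracket (pair2 e' b' c' h' k') (?f v) (?f w)))"
      unfolding e b c 1 by (simp add: vw bracket_pair2 algebra_simps)
    finally have 2: "fst (fst (?f (bracket (pair2 e b c h k) v w))) = fst (fst (bracket (pair2 e' b' c' h' k') (?f v) (?f w)))" .
    have "snd (fst (?f (bracket (pair2 e b c h k) v w))) = (x * y' - y * x') * (fst e * q + snd e * s)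
        + (a' * x - a * x') * (fst b * q + snd b * s) + (a' * y - a * y') * (fst c * q + snd c * s)"
      by (simp add: vw bracket_pair2 algebra_simps)
    also have "\<dots> = snd (fst (bracket (pair2 e' b' c' h' k') (?f v) (?f w)))"
      unfolding e b c 1 by (simp add: vw bracket_pair2 algebra_simps)
    finally have 3: "snd (fst (?f (bracket (pair2 e b c h k) v w))) = snd (fst (bracket (pair2 e' b' c' h' k') (?f v) (?f w)))" .
    have 4: "snd (?f (bracket (pair2 e b c h k) v w)) = snd (bracket (pair2 e' b' c' h' k') (?f v) (?f w))"
      unfolding hk by (simp add: vw bracket_pair2 algebra_simps)
    show ?thesis using 2 3 4 by (intro prod_eqI)
  qed
  moreover have "?f ` (UNIV \<times> {0}) = UNIV \<times> {0}"
  proof (rule subset_antisym; rule subsetI)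
    show "v \<in> ?f ` (UNIV \<times> {0})" if "v \<in> UNIV \<times> {0}" for v
      by (rule image_eqI[of v ?f "?g v", OF fg[of v, symmetric]]) (use that in auto)
  qed auto
  moreover have "?f ` ({0} \<times> UNIV) = {0} \<times> UNIV"
  proof (rule subset_antisym; rule subsetI)
    show "v \<in> ?f ` ({0} \<times> UNIV)" if "v \<in> {0} \<times> UNIV" for v
      by (rule image_eqI[of v ?f "?g v", OF fg[of v, symmetric]]) (use that in \<open>auto simp: zero_prod_def\<close>)
  qed (auto simp: zero_prod_def)
  ultimately show "lie_pair_iso (pair2 e b c h k) (pair2 e' b' c' h' k')"
    unfolding lie_pair_iso_def ambient_pair2 part1_pair2 part2_pair2
    by (intro exI[of _ ?f] conjI ballI allI)
qed

subsection \<open>The lists have no repetitions\<close>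

lemma listed1_pairwise_non_isomorphic: "lie_pair_iso (listed1 e) (listed1 e') \<Longrightarrow> e = e'"
  by (cases e; cases e') (auto dest!: lie_pair_iso_pair1D)

text \<open>The functional \<open>chi\<close> is intrinsic, since rescaling \<open>A\<close> does
  not affect it. Its kernel is the line of \<open>Y\<close>, so \<open>X\<close> goes to
  \<open>X + q Y\<close> and \<open>Y\<close> to \<open>s Y\<close>; in particular \<open>d\<close>
  is an invariant.\<close>

lemma pair2_iso_chi:
  assumes "lie_pair_iso (pair2 (0, d) (b1, b2) (c1, c2) 1 0) (pair2 (0, d') (b1', b2') (c1', c2') 1 0)"
  shows "d = d' \<and> (\<exists>q s l. s \<noteq> 0 \<and> l \<noteq> 0 \<and> b1 = l * (b1' + q * c1') \<and> b1 * q + b2 * s = l * (b2' + q * c2')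
    \<and> c1 = l * s * c1' \<and> c1 * q + c2 * s = l * s * c2')"
proof -
  obtain p q r s l where ch: "pair2_change p q r s l (0, d) (b1, b2) (c1, c2) 1 0 (0, d') (b1', b2') (c1', c2') 1 0"
    using lie_pair_iso_pair2D[OF assms] by (elim exE)
  then have "p = 1" "r = 0" by (simp_all add: pair2_change_def)
  with ch have "d = d'" "s \<noteq> 0" "l \<noteq> 0" "b1 = l * (b1' + q * c1')" "b1 * q + b2 * s = l * (b2' + q * c2')"
    "c1 = l * s * c1'" "c1 * q + c2 * s = l * s * c2'"
    by (auto simp: pair2_change_def mult.assoc)
  then show ?thesis by (intro conjI exI[of _ q] exI[of _ s] exI[of _ l])
qed

lemma pair2_iso_chi_no_chi:
  "\<not> lie_pair_iso (pair2 (0, d) b c 0 0) (pair2 (0, d') b' c' 1 0)"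
  "\<not> lie_pair_iso (pair2 (0, d) b c 1 0) (pair2 (0, d') b' c' 0 0)"
proof
  assume "lie_pair_iso (pair2 (0, d) b c 0 0) (pair2 (0, d') b' c' 1 0)"
  from lie_pair_iso_pair2D[OF this]
  obtain p q r s l where ch: "pair2_change p q r s l (0, d) b c 0 0 (0, d') b' c' 1 0" by (elim exE)
  then have "p = 0" "r = 0" by (simp_all add: pair2_change_def)
  with ch show False by (simp add: pair2_change_def)
next
  show "\<not> lie_pair_iso (pair2 (0, d) b c 1 0) (pair2 (0, d') b' c' 0 0)"
  proof
    assume "lie_pair_iso (pair2 (0, d) b c 1 0) (pair2 (0, d') b' c' 0 0)"
    from lie_pair_iso_pair2D[OF this] show False by (auto simp: pair2_change_def)
  qed
qed

text \<open>The line of \<open>Y\<close> is the derived algebra of part 1 and is preserved, which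
  gives \<open>r = 0\<close>; the relation \<open>[X,Y] = Y\<close> then forces
  \<open>p = 1\<close>.\<close>

lemma pair2_iso_nonabelian:
  assumes "lie_pair_iso (pair2 (0, 1) (b1, b2) (c1, c2) 0 0) (pair2 (0, 1) (b1', b2') (c1', c2') 0 0)"
  shows "\<exists>q s l. s \<noteq> 0 \<and> l \<noteq> 0 \<and> b1 = l * (b1' + q * c1') \<and> b1 * q + b2 * s = l * (b2' + q * c2')
    \<and> c1 = l * s * c1' \<and> c1 * q + c2 * s = l * s * c2'"
proof -
  obtain p q r s l where ch: "pair2_change p q r s l (0, 1) (b1, b2) (c1, c2) 0 0 (0, 1) (b1', b2') (c1', c2') 0 0"
    using lie_pair_iso_pair2D[OF assms] by (elim exE)
  then have r: "r = 0" by (simp add: pair2_change_def)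
  with ch have "p = 1" by (auto simp: pair2_change_def)
  with ch r have "s \<noteq> 0" "l \<noteq> 0" "b1 = l * (b1' + q * c1')" "b1 * q + b2 * s = l * (b2' + q * c2')"
    "c1 = l * s * c1'" "c1 * q + c2 * s = l * s * c2'"
    by (auto simp: pair2_change_def mult.assoc)
  then show ?thesis by (intro conjI exI[of _ q] exI[of _ s] exI[of _ l])
qed

lemma pair2_iso_abelian_nonabelian:
  "\<not> lie_pair_iso (pair2 (0, 0) b c 0 0) (pair2 (0, 1) b' c' 0 0)"
  "\<not> lie_pair_iso (pair2 (0, 1) b c 0 0) (pair2 (0, 0) b' c' 0 0)"
proof -
  show "\<not> lie_pair_iso (pair2 (0, 0) b c 0 0) (pair2 (0, 1) b' c' 0 0)"
  proof
    assume "lie_pair_iso (pair2 (0, 0) b c 0 0) (pair2 (0, 1) b' c' 0 0)"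
    from lie_pair_iso_pair2D[OF this] show False by (auto simp: pair2_change_def)
  qed
  show "\<not> lie_pair_iso (pair2 (0, 1) b c 0 0) (pair2 (0, 0) b' c' 0 0)"
  proof
    assume "lie_pair_iso (pair2 (0, 1) b c 0 0) (pair2 (0, 0) b' c' 0 0)"
    from lie_pair_iso_pair2D[OF this] show False by (auto simp: pair2_change_def)
  qed
qed

lemma pair2_iso_abelian:
  assumes "lie_pair_iso (pair2 (0, 0) (b1, b2) (c1, c2) 0 0) (pair2 (0, 0) (b1', b2') (c1', c2') 0 0)"
  shows "\<exists>p q r s l. p * s \<noteq> q * r \<and> l \<noteq> 0 \<and>
    b1 * p + b2 * r = l * (p * b1' + q * c1') \<and> b1 * q + b2 * s = l * (p * b2' + q * c2') \<and>
    c1 * p + c2 * r = l * (r * b1' + s * c1') \<and> c1 * q + c2 * s = l * (r * b2' + s * c2')"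
  using lie_pair_iso_pair2D[OF assms] by (simp add: pair2_change_def)

text \<open>Only the eigenvalues of \<open>\<beta>\<close> up to a common factor \<open>l\<close>
  are invariant. Either both 1s correspond and \<open>l = 1\<close>, or the eigenvalues are
  exchanged and \<open>t * t' = 1\<close>, which in the given range leaves
  \<open>t = t'\<close>.\<close>

lemma diagonal_iso:
  assumes "lie_pair_iso (pair2 (0, 0) (1, 0) (0, t) 0 0) (pair2 (0, 0) (1, 0) (0, t') 0 0)"
    and t: "- 1 \<le> t" "t \<le> 1" "- 1 \<le> t'" "t' \<le> 1"
  shows "t = t'"
proof -
  obtain p q r s l where D: "p * s \<noteq> q * r" and e': "1 * p + 0 * r = l * (p * 1 + q * 0)"
    "1 * q + 0 * s = l * (p * 0 + q * t')" "0 * p + t * r = l * (r * 1 + s * 0)" "0 * q + t * s = l * (r * 0 + s * t')"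
    using pair2_iso_abelian[OF assms(1)] by (elim exE conjE)
  have e: "p = l * p" "q = l * (q * t')" "t * r = l * r" "t * s = l * (s * t')"
    using e' by simp_all
  show ?thesis
  proof (cases "p = 0")
    case False
    then have l: "l = 1" using e(1) by simp
    show ?thesis
    proof (cases "s = 0")
      case False
      then show ?thesis using e(4) l by simp
    next
      case True
      then have "q \<noteq> 0" "r \<noteq> 0" using D by auto
      then show ?thesis using e(2,3) l by simp
    qed
  next
    case True
    then have "q \<noteq> 0" "r \<noteq> 0" using D by auto
    then have l: "l = t" "1 = t * t'" using e(2,3) by auto
    \<comment> \<open>Since \<open>t * t' = 1\<close>, these products are \<open>t' - t\<close> and
      \<open>t - t'\<close>.\<close>
    have "0 \<le> (1 - t) * (1 + t')" "0 \<le> (1 + t) * (1 - t')"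
      using t by simp_all
    then show ?thesis using l(2) by (simp add: algebra_simps)
  qed
qed

text \<open>The remaining changes of basis multiply \<open>a\<close> by a square, so its sign is an
  invariant: it tells whether \<open>A\<close> is hyperbolic, nilpotent or elliptic.\<close>

lemma E43_iso:
  assumes "lie_pair_iso (listed2 (E43 a)) (listed2 (E43 a'))" "a \<in> {1, 0, -1}" "a' \<in> {1, 0, -1}"
  shows "a = a'"
proof -
  obtain q s l where e: "s \<noteq> 0" "l \<noteq> 0" "0 = l * (0 + q * 1)" "0 * q + a * s = l * (a' + q * 0)" "1 = l * s * 1"
    using pair2_iso_chi[OF assms(1)[unfolded listed2_eq]] by (elim conjE exE)
  have "a * s = l * a'" "l * s = 1" using e(4,5) by simp_all
  then have "a = l * l * a'" by algebra
  moreover have "l * l > 0" using e(2) by (simp add: zero_less_mult_iff) linarith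
  ultimately show ?thesis using assms(2,3) by auto
qed

text \<open>For \<open>d = 1\<close> the equations reduce to \<open>b * s = b'\<close> with
  \<open>s\<close> free and nonzero, so only the vanishing of \<open>b\<close> survives. This is the
  source of the exception in the conclusion.\<close>

lemma E41_iso:
  assumes "lie_pair_iso (listed2 (E41 d b)) (listed2 (E41 d' b'))"
    and "admissible (E41 d b)" "admissible (E41 d' b')"
  shows "E41 d b = E41 d' b' \<or> (b \<noteq> 0 \<and> b' \<noteq> 0 \<and> d = 1 \<and> d' = 1)"
proof -
  obtain q s l where e: "d = d'" "s \<noteq> 0" "1 = l * (1 + q * 0)" "1 * q + b * s = l * (b' + q * d')"
    using pair2_iso_chi[OF assms(1)[unfolded listed2_eq]] by (elim conjE exE)
  show ?thesis
  proof (cases "d = 1")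
    case True
    then have "b * s = b'" using e by simp
    then show ?thesis using e True by auto
  next
    case False
    then show ?thesis using assms(2,3) e(1) by simp
  qed
qed

definition kind :: "entry2 \<Rightarrow> nat"
  where "kind e = (case e of E11 \<Rightarrow> 0 | E12 \<Rightarrow> 1 | E21 _ \<Rightarrow> 2 | E22 \<Rightarrow> 3 | E23 \<Rightarrow> 4 | E24 \<Rightarrow> 5 | E25 \<Rightarrow> 6
    | E3a _ \<Rightarrow> 7 | E41 _ _ \<Rightarrow> 8 | E42 _ \<Rightarrow> 9 | E43 _ \<Rightarrow> 10)"

text \<open>The vanishing of \<open>chi\<close> separates most pairs of constructors, and for
  \<open>chi = 0\<close> so does commutativity of part 1. Within each of these groups the equations
  for a change of basis are contradictory.\<close>

lemma kind_iso: "lie_pair_iso (listed2 e) (listed2 e') \<Longrightarrow> kind e = kind e'"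
  by (cases e; cases e'; hypsubst; unfold listed2_eq kind_def entry2.case;
      ((rule refl)
        | (erule notE[OF pair2_iso_chi_no_chi(1)])
        | (erule notE[OF pair2_iso_chi_no_chi(2)])
        | (erule notE[OF pair2_iso_abelian_nonabelian(1)])
        | (erule notE[OF pair2_iso_abelian_nonabelian(2)])
        | (drule pair2_iso_chi; force)
        | (drule pair2_iso_nonabelian; force)
        | (drule pair2_iso_abelian; force)))

lemma listed2_pairwise_non_isomorphic:
  assumes "admissible e" "admissible e'" and iso: "lie_pair_iso (listed2 e) (listed2 e')"
  shows "e = e' \<or> (\<exists>b b'. b \<noteq> 0 \<and> b' \<noteq> 0 \<and> e = E41 1 b \<and> e' = E41 1 b')"
proof -
  have k: "kind e = kind e'" by (rule kind_iso[OF iso])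
  consider (same) "e = e'" | (diag) t t' where "e = E21 t" "e' = E21 t'"
    | (ideal) a a' where "e = E3a a" "e' = E3a a'" | (E41) d b d' b' where "e = E41 d b" "e' = E41 d' b'"
    | (E42) d d' where "e = E42 d" "e' = E42 d'" | (E43) a a' where "e = E43 a" "e' = E43 a'"
    using k by (cases e; cases e') (simp_all add: kind_def)
  then show ?thesis
  proof cases
    case same
    then show ?thesis by (rule disjI1)
  next
    case diag
    have "t = t'"
      by (rule diagonal_iso[OF iso[unfolded diag listed2_eq]]) (use assms(1,2) diag in simp_all)
    then show ?thesis using diag by simp
  next
    case ideal
    then show ?thesis using pair2_iso_chi[OF iso[unfolded ideal listed2_eq]] by simp
  next
    case E41
    then show ?thesis using E41_iso[of d b d' b'] assms by simp
  next
    case E42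
    then show ?thesis using pair2_iso_chi[OF iso[unfolded E42 listed2_eq]] by simp
  next
    case E43
    then show ?thesis using E43_iso[of a a'] assms by simp
  qed
qed

subsection \<open>Coordinates on an abstract matched pair\<close>

lemma lie_bracket_expand:
  assumes L: "lie_algebra L br" and mem: "X \<in> L" "Y \<in> L" "A \<in> L"
  shows "br (x *\<^sub>R X + y *\<^sub>R Y + a *\<^sub>R A) (x' *\<^sub>R X + y' *\<^sub>R Y + a' *\<^sub>R A) =
    (x * y' - y * x') *\<^sub>R br X Y + (x * a' - a * x') *\<^sub>R br X A + (y * a' - a * y') *\<^sub>R br Y A"
proof -
  have sub: "subspace L" using L by (simp add: lie_algebra_def)
  have add: "br (u + v) w = br u w + br v w" "br w (u + v) = br w u + br w v"
    if "u \<in> L" "v \<in> L" "w \<in> L" for u v w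
    using L that by (auto simp: lie_algebra_def)
  have scale: "br (c *\<^sub>R u) v = c *\<^sub>R br u v" "br v (c *\<^sub>R u) = c *\<^sub>R br v u" if "u \<in> L" "v \<in> L" for c u v
    using L that by (auto simp: lie_algebra_def)
  have alt: "br u u = 0" if "u \<in> L" for u using L that by (simp add: lie_algebra_def)
  have anti: "br v u = - br u v" if "u \<in> L" "v \<in> L" for u v
  proof -
    have "br (u + v) (u + v) = (br u u + br u v) + (br v u + br v v)"
      using that subspace_add[OF sub] by (simp add: add)
    then have "br u v + br v u = 0" using that alt subspace_add[OF sub] by simp
    then show ?thesis by (simp add: eq_neg_iff_add_eq_0 add.commute)
  qed
  note mems = mem subspace_scale[OF sub] subspace_add[OF sub]
  have "br (x *\<^sub>R X + y *\<^sub>R Y + a *\<^sub>R A) (x' *\<^sub>R X + y' *\<^sub>R Y + a' *\<^sub>R A) =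
    (x * y') *\<^sub>R br X Y + (x * a') *\<^sub>R br X A + (y * x') *\<^sub>R br Y X + (y * a') *\<^sub>R br Y A
    + (a * x') *\<^sub>R br A X + (a * y') *\<^sub>R br A Y"
    by (simp add: add scale alt mems scaleR_add_right) (simp add: algebra_simps)
  then show ?thesis
    by (simp add: anti[OF mem(1,2)] anti[OF mem(1,3)] anti[OF mem(2,3)] algebra_simps)
qed

lemma matched_pairD:
  assumes "matched_pair P"
  shows "lie_algebra (ambient P) (bracket P)" "part1 P \<inter> part2 P = {0}"
    "ambient P = {x + y | x y. x \<in> part1 P \<and> y \<in> part2 P}"
proof -
  show "lie_algebra (ambient P) (bracket P)" using assms unfolding matched_pair_def by (elim conjE)
  show "part1 P \<inter> part2 P = {0}" using assms unfolding matched_pair_def by (elim conjE)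
  show "ambient P = {x + y | x y. x \<in> part1 P \<and> y \<in> part2 P}"
    using assms unfolding matched_pair_def by (elim conjE)
qed

lemma matched_pair_decomposition:
  assumes P: "matched_pair P"
  shows "part1 P \<subseteq> ambient P" "part2 P \<subseteq> ambient P" "subspace (part1 P)" "subspace (part2 P)"
    "\<And>u v. u \<in> part1 P \<Longrightarrow> v \<in> part2 P \<Longrightarrow> u + v = 0 \<Longrightarrow> u = 0 \<and> v = 0"
proof -
  show 1: "part1 P \<subseteq> ambient P" "part2 P \<subseteq> ambient P" "subspace (part1 P)" "subspace (part2 P)"
    using P by (auto simp: matched_pair_def lie_subalgebra_def)
  fix u v assume uv: "u \<in> part1 P" "v \<in> part2 P" "u + v = 0"
  then have "u = - v" by (simp add: eq_neg_iff_add_eq_0)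
  then have "u \<in> part1 P \<inter> part2 P" using uv subspace_neg[OF 1(4)] by simp
  then have "u = 0" unfolding matched_pairD(2)[OF P] by simp
  then show "u = 0 \<and> v = 0" using uv by simp
qed

lemma lie_pair_iso_pair1_coordinates:
  assumes P: "matched_pair P" and X: "X \<noteq> 0" "part1 P = span {X}" and A: "A \<noteq> 0" "part2 P = span {A}"
    and XA: "bracket P X A = b *\<^sub>R X + x *\<^sub>R A"
  shows "lie_pair_iso P (pair1 b x)"
proof (rule lie_pair_iso_sym_UNIV[OF _ ambient_pair1])
  note dec = matched_pair_decomposition[OF P]
  let ?f = "\<lambda>v :: real \<times> real. fst v *\<^sub>R X + snd v *\<^sub>R A"
  have mem: "X \<in> ambient P" "A \<in> ambient P"
    using dec(1,2) X(2) A(2) span_base[of X "{X}"] span_base[of A "{A}"] by auto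
  have lin: "?f (v + w) = ?f v + ?f w" "?f (c *\<^sub>R v) = c *\<^sub>R ?f v" for v w c
    by (simp_all add: scaleR_add_left scaleR_add_right)
  have L: "lie_algebra (ambient P) (bracket P)" by (rule matched_pairD(1)[OF P])
  have br: "?f (bracket (pair1 b x) v w) = bracket P (?f v) (?f w)" for v w
    using lie_bracket_expand[OF L mem(1,1,2), of "fst v" 0 "snd v" "fst w" 0 "snd w"]
    by (simp add: bracket_pair1 XA algebra_simps)
  have "inj ?f"
  proof (rule injI)
    fix v w assume "?f v = ?f w"
    then have "(fst v - fst w) *\<^sub>R X + (snd v - snd w) *\<^sub>R A = 0" by (simp add: algebra_simps)
    moreover have "(fst v - fst w) *\<^sub>R X \<in> part1 P" "(snd v - snd w) *\<^sub>R A \<in> part2 P"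
      unfolding X(2) A(2) by (intro span_scale span_base; simp)+
    ultimately have "(fst v - fst w) *\<^sub>R X = 0" "(snd v - snd w) *\<^sub>R A = 0"
      using dec(5)[of "(fst v - fst w) *\<^sub>R X" "(snd v - snd w) *\<^sub>R A"] by simp_all
    then show "v = w" using X(1) A(1) by (simp add: prod_eq_iff)
  qed
  moreover have "range ?f = ambient P"
  proof -
    have "ambient P = {u + v | u v. u \<in> part1 P \<and> v \<in> part2 P}" by (rule matched_pairD(3)[OF P])
    also have "\<dots> = range ?f"
    proof (rule subset_antisym; rule subsetI)
      fix w assume "w \<in> {u + v | u v. u \<in> part1 P \<and> v \<in> part2 P}"
      then obtain s t where "w = s *\<^sub>R X + t *\<^sub>R A" unfolding X(2) A(2) span_singleton by auto
      then show "w \<in> range ?f" by (intro image_eqI[of _ _ "(s, t)"]) simp_all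
    next
      fix w assume "w \<in> range ?f"
      then obtain v where v: "w = ?f v" by (elim rangeE)
      show "w \<in> {u + v | u v. u \<in> part1 P \<and> v \<in> part2 P}"
        unfolding v X(2) A(2)
        by (intro CollectI exI[of _ "fst v *\<^sub>R X"] exI[of _ "snd v *\<^sub>R A"] conjI refl span_scale span_base singletonI)
    qed
    finally show ?thesis by (rule sym)
  qed
  ultimately have "bij_betw ?f UNIV (ambient P)" by (simp add: bij_betw_def)
  moreover have "?f ` (UNIV \<times> {0}) = part1 P" "?f ` ({0} \<times> UNIV) = part2 P"
    unfolding X(2) A(2) span_singleton by (auto simp: image_iff)
  ultimately show "lie_pair_iso (pair1 b x) P"
    unfolding lie_pair_iso_def ambient_pair1 part1_pair1 part2_pair1
    using lin br by (intro exI[of _ ?f] conjI ballI allI)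
qed

lemma span_pair: "span {X, Y} = {x *\<^sub>R X + y *\<^sub>R Y | x y. True}"
proof (rule subset_antisym; rule subsetI)
  fix v assume "v \<in> span {X, Y}"
  from iffD1[OF span_breakdown_eq this] obtain x where "v - x *\<^sub>R X \<in> span {Y}" by (elim exE)
  then obtain y where "v - x *\<^sub>R X = y *\<^sub>R Y" unfolding span_singleton by (elim rangeE)
  then have "v = x *\<^sub>R X + y *\<^sub>R Y" by (simp add: algebra_simps)
  then show "v \<in> {x *\<^sub>R X + y *\<^sub>R Y | x y. True}" by (intro CollectI exI conjI TrueI)
next
  fix v assume "v \<in> {x *\<^sub>R X + y *\<^sub>R Y | x y. True}"
  then obtain x y where "v = x *\<^sub>R X + y *\<^sub>R Y" unfolding mem_Collect_eq by (elim exE conjE)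
  then show "v \<in> span {X, Y}" by (simp add: span_add span_scale span_base)
qed

lemma lie_pair_iso_pair2_coordinates:
  assumes P: "matched_pair P" and ind: "\<And>x y. x *\<^sub>R X + y *\<^sub>R Y = 0 \<Longrightarrow> x = 0 \<and> y = 0"
    and part1: "part1 P = {x *\<^sub>R X + y *\<^sub>R Y | x y. True}" and A: "A \<noteq> 0" "part2 P = span {A}"
    and XY: "bracket P X Y = fst e *\<^sub>R X + snd e *\<^sub>R Y"
    and XA: "bracket P X A = fst b *\<^sub>R X + snd b *\<^sub>R Y + h *\<^sub>R A"
    and YA: "bracket P Y A = fst c *\<^sub>R X + snd c *\<^sub>R Y + k *\<^sub>R A"
  shows "lie_pair_iso (pair2 e b c h k) P"
proof -
  note dec = matched_pair_decomposition[OF P]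
  let ?f = "\<lambda>v :: (real \<times> real) \<times> real. fst (fst v) *\<^sub>R X + snd (fst v) *\<^sub>R Y + snd v *\<^sub>R A"
  have mem1: "x *\<^sub>R X + y *\<^sub>R Y \<in> part1 P" for x y unfolding part1 by blast
  have mem2: "a *\<^sub>R A \<in> part2 P" for a unfolding A(2) by (intro span_scale span_base) simp
  have mem: "X \<in> ambient P" "Y \<in> ambient P" "A \<in> ambient P"
    using dec(1,2) mem1[of 1 0] mem1[of 0 1] mem2[of 1] by auto
  have lin: "?f (v + w) = ?f v + ?f w" "?f (t *\<^sub>R v) = t *\<^sub>R ?f v" for v w t
    by (simp_all add: scaleR_add_left scaleR_add_right)
  have L: "lie_algebra (ambient P) (bracket P)" by (rule matched_pairD(1)[OF P])
  have br: "?f (bracket (pair2 e b c h k) v w) = bracket P (?f v) (?f w)" for v w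
    unfolding lie_bracket_expand[OF L mem] XY XA YA by (simp add: bracket_pair2 algebra_simps)
  have "inj ?f"
  proof (rule injI)
    fix v w assume "?f v = ?f w"
    then have "((fst (fst v) - fst (fst w)) *\<^sub>R X + (snd (fst v) - snd (fst w)) *\<^sub>R Y) + (snd v - snd w) *\<^sub>R A = 0"
      by (simp add: algebra_simps)
    from dec(5)[OF mem1 mem2 this] ind
    have "fst (fst v) - fst (fst w) = 0 \<and> snd (fst v) - snd (fst w) = 0" "(snd v - snd w) *\<^sub>R A = 0"
      by blast+
    then show "v = w" using A(1) by (simp add: prod_eq_iff)
  qed
  moreover have "range ?f = ambient P"
  proof -
    have "ambient P = {u + v | u v. u \<in> part1 P \<and> v \<in> part2 P}" by (rule matched_pairD(3)[OF P])
    also have "\<dots> = range ?f"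
    proof (rule subset_antisym; rule subsetI)
      fix w assume "w \<in> {u + v | u v. u \<in> part1 P \<and> v \<in> part2 P}"
      then obtain x y t where "w = (x *\<^sub>R X + y *\<^sub>R Y) + t *\<^sub>R A" unfolding part1 A(2) span_singleton by auto
      then show "w \<in> range ?f" by (intro image_eqI[of _ _ "((x, y), t)"]) simp_all
    next
      fix w assume "w \<in> range ?f"
      then obtain v where v: "w = ?f v" by (elim rangeE)
      show "w \<in> {u + v | u v. u \<in> part1 P \<and> v \<in> part2 P}"
        unfolding v
        by (intro CollectI exI[of _ "fst (fst v) *\<^sub>R X + snd (fst v) *\<^sub>R Y"] exI[of _ "snd v *\<^sub>R A"] conjI refl mem1 mem2)
    qed
    finally show ?thesis by (rule sym)
  qed
  ultimately have "bij_betw ?f UNIV (ambient P)" by (simp add: bij_betw_def)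
  moreover have "?f ` (UNIV \<times> {0}) = part1 P"
  proof (rule subset_antisym; rule subsetI)
    fix w assume "w \<in> ?f ` (UNIV \<times> {0})"
    then obtain v where "snd v = 0" "w = ?f v" by auto
    then show "w \<in> part1 P" using mem1 by simp
  next
    fix w assume "w \<in> part1 P"
    then obtain x y where "w = x *\<^sub>R X + y *\<^sub>R Y" unfolding part1 mem_Collect_eq by (elim exE conjE)
    then show "w \<in> ?f ` (UNIV \<times> {0})" by (intro image_eqI[of _ _ "((x, y), 0)"]) simp_all
  qed
  moreover have "?f ` ({0} \<times> UNIV) = part2 P"
    unfolding A(2) span_singleton by (auto simp: image_iff zero_prod_def)
  ultimately show ?thesis
    unfolding lie_pair_iso_def ambient_pair2 part1_pair2 part2_pair2
    using lin br by (intro exI[of _ ?f] conjI ballI allI)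
qed

text \<open>The Jacobi identity at the basis \<open>X\<close>, \<open>Y\<close>, \<open>A\<close>,
  pulled back from the abstract pair. These equations drive the case distinction of the
  classification.\<close>

lemma jacobi_pair2:
  assumes iso: "lie_pair_iso (pair2 e b c h k) P" and P: "matched_pair P"
  shows "fst e * h + snd e * k = 0"
    "(snd c + fst b) * fst e + k * fst b - h * fst c - fst e * fst b - snd e * fst c = 0"
    "(snd c + fst b) * snd e + k * snd b - h * snd c - fst e * snd b - snd e * snd c = 0"
proof -
  let ?Q = "pair2 e b c h k"
  obtain f where f: "bij_betw f UNIV (ambient P)" "\<And>x y. f (x + y) = f x + f y"
    "\<And>c x. f (c *\<^sub>R x) = c *\<^sub>R f x" "\<And>x y. f (bracket ?Q x y) = bracket P (f x) (f y)"
    using iso by (auto simp: lie_pair_iso_def)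
  have f0: "f 0 = 0" using f(3)[of 0 0] by simp
  have fm: "f v \<in> ambient P" for v using f(1) by (auto simp: bij_betw_def)
  have J: "bracket ?Q x (bracket ?Q y z) + bracket ?Q y (bracket ?Q z x) + bracket ?Q z (bracket ?Q x y) = 0" for x y z
  proof -
    have "f (bracket ?Q x (bracket ?Q y z) + bracket ?Q y (bracket ?Q z x) + bracket ?Q z (bracket ?Q x y)) = 0"
      using matched_pairD(1)[OF P] fm by (simp add: f(2,4) lie_algebra_def)
    then show ?thesis
      using injD[OF bij_betw_imp_inj_on[OF f(1)], of _ 0] f0 by simp
  qed
  have "0 = bracket ?Q ((1, 0), 0) (bracket ?Q ((0, 1), 0) ((0, 0), 1)) + bracket ?Q ((0, 1), 0) (bracket ?Q ((0, 0), 1) ((1, 0), 0))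
      + bracket ?Q ((0, 0), 1) (bracket ?Q ((1, 0), 0) ((0, 1), 0))"
    using J[of "((1, 0), 0)" "((0, 1), 0)" "((0, 0), 1)"] by simp
  then show "fst e * h + snd e * k = 0"
    "(snd c + fst b) * fst e + k * fst b - h * fst c - fst e * fst b - snd e * fst c = 0"
    "(snd c + fst b) * snd e + k * snd b - h * snd c - fst e * snd b - snd e * snd c = 0"
    by (simp_all add: bracket_pair2 prod_eq_iff algebra_simps)
qed

subsection \<open>The classification\<close>

definition listable :: "'a::real_vector lie_pair \<Rightarrow> bool"
  where "listable P \<longleftrightarrow> (\<exists>e. admissible e \<and> lie_pair_iso P (listed2 e))"

lemma change_of_basis:
  assumes "lie_pair_iso (pair2 e' b' c' h' k') P" "pair2_change p q r s l e b c h k e' b' c' h' k'"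
  shows "lie_pair_iso (pair2 e b c h k) P"
  by (rule lie_pair_iso_trans[OF lie_pair_iso_sym_UNIV[OF lie_pair_iso_pair2I[OF assms(2)] ambient_pair2] assms(1)])

lemma listableI:
  assumes "lie_pair_iso (pair2 e' b' c' h' k') P" "listed2 en = pair2 e b c h k" "admissible en"
    and "pair2_change p q r s l e b c h k e' b' c' h' k'"
  shows "listable P"
  unfolding listable_def
  using lie_pair_iso_sym_UNIV[OF change_of_basis[OF assms(1,4)] ambient_pair2] assms(2,3)
  by (intro exI[of _ en] conjI) simp_all

text \<open>With \<open>A\<close> kept fixed, any invertible matrix is a change of basis, and the
  new structure constants come from Cramer's rule.\<close>

lemma exists_change_of_basis:
  assumes D: "p * s - q * r \<noteq> (0::real)"
  shows "\<exists>e b c. pair2_change p q r s 1 e b c (p * h + q * k) (r * h + s * k) e' b' c' h k"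
proof -
  let ?D = "p * s - q * r"
  have co: "(u * s - v * r) / ?D * p + (p * v - q * u) / ?D * r = u"
    "(u * s - v * r) / ?D * q + (p * v - q * u) / ?D * s = v" for u v
  proof -
    have "(u * s - v * r) * p + (p * v - q * u) * r = u * ?D" "(u * s - v * r) * q + (p * v - q * u) * s = v * ?D"
      by algebra+
    then show "(u * s - v * r) / ?D * p + (p * v - q * u) / ?D * r = u"
      "(u * s - v * r) / ?D * q + (p * v - q * u) / ?D * s = v"
      using D by (simp_all add: add_divide_distrib[symmetric])
  qed
  let ?cc = "\<lambda>u v. ((u * s - v * r) / ?D, (p * v - q * u) / ?D)"
  let ?b = "?cc (p * fst b' + q * fst c') (p * snd b' + q * snd c')"
    and ?c = "?cc (r * fst b' + s * fst c') (r * snd b' + s * snd c')"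
    and ?e = "?cc (?D * fst e') (?D * snd e')"
  have "pair2_change p q r s 1 ?e ?b ?c (p * h + q * k) (r * h + s * k) e' b' c' h k"
    unfolding pair2_change_def fst_conv snd_conv mult_1 co by (intro conjI D refl) simp
  then show ?thesis by (intro exI)
qed

lemma listable_triangular:
  assumes iso: "lie_pair_iso (pair2 (0, 0) (\<alpha>, \<gamma>) (0, \<mu>) 0 0) P"
  shows "listable P"
proof (cases "\<alpha> = \<mu>")
  case True
  consider "\<gamma> = 0" "\<alpha> = 0" | "\<gamma> = 0" "\<alpha> \<noteq> 0" | "\<gamma> \<noteq> 0" "\<alpha> = 0" | "\<gamma> \<noteq> 0" "\<alpha> \<noteq> 0" by blast
  then show ?thesis
  proof cases
    case 1
    then show ?thesis
      using True by (intro listableI[OF iso listed2_eq(1), of 1 0 0 1 1]) (simp_all add: pair2_change_def)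
  next
    case 2
    then show ?thesis
      using True by (intro listableI[OF iso listed2_eq(3)[of 1], of 1 0 0 1 "1 / \<alpha>"]) (simp_all add: pair2_change_def)
  next
    case 3
    then show ?thesis
      using True by (intro listableI[OF iso listed2_eq(5), of 1 0 0 \<gamma> 1]) (simp_all add: pair2_change_def)
  next
    case 4
    then show ?thesis
      using True
      by (intro listableI[OF iso listed2_eq(4), of 1 0 0 "\<gamma> / \<alpha>" "1 / \<alpha>"]) (simp_all add: pair2_change_def)
  qed
next
  case False
  \<comment> \<open>Then \<open>X + t Y\<close> is an eigenvector of \<open>\<beta>\<close> for
    \<open>\<alpha>\<close>. Below, the eigenvalue of larger absolute value is scaled to 1, which
    puts the other one between \<open>- 1\<close> and 1.\<close>
  define t where "t = \<gamma> / (\<alpha> - \<mu>)"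
  have "t * (\<alpha> - \<mu>) = \<gamma>" using False by (simp add: t_def)
  then have t: "\<gamma> = t * \<alpha> - t * \<mu>" by (simp add: algebra_simps)
  show ?thesis
  proof (cases "\<bar>\<mu>\<bar> \<le> \<bar>\<alpha>\<bar>")
    case True
    then have "\<alpha> \<noteq> 0" using False by auto
    moreover from this have "\<bar>\<mu> / \<alpha>\<bar> \<le> 1" using True by (simp add: abs_divide)
    then have "admissible (E21 (\<mu> / \<alpha>))" unfolding admissible.simps by linarith
    ultimately show ?thesis
      by (intro listableI[OF iso listed2_eq(3)[of "\<mu> / \<alpha>"], of 1 t 0 1 "1 / \<alpha>"])
         (simp_all add: pair2_change_def t)
  next
    case False
    then have "\<mu> \<noteq> 0" by auto
    moreover from this have "\<bar>\<alpha> / \<mu>\<bar> \<le> 1" using False by (simp add: abs_divide)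
    then have "admissible (E21 (\<alpha> / \<mu>))" unfolding admissible.simps by linarith
    ultimately show ?thesis
      by (intro listableI[OF iso listed2_eq(3)[of "\<alpha> / \<mu>"], of 0 1 1 t "1 / \<mu>"])
         (simp_all add: pair2_change_def t)
  qed
qed

text \<open>If \<open>c \<noteq> 0\<close>, the vector \<open>X - (b / c) Y\<close> lies in the
  kernel of \<open>\<beta>\<close>, and rescaling \<open>A\<close> makes \<open>c\<close> equal to
  1. If \<open>c = 0\<close>, rescaling \<open>Y\<close> normalises \<open>b\<close>.\<close>

lemma listable_nonabelian:
  assumes iso: "lie_pair_iso (pair2 (0, 1) (0, b) (0, c) 0 0) P"
  shows "listable P"
proof (cases "c = 0")
  case False
  then show ?thesis
    by (intro listableI[OF iso listed2_eq(7), of 1 "- (b / c)" 0 1 "1 / c"]) (simp_all add: pair2_change_def)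
next
  case c: True
  show ?thesis
  proof (cases "b = 0")
    case True
    then show ?thesis
      using c by (intro listableI[OF iso listed2_eq(2), of 1 0 0 1 1]) (simp_all add: pair2_change_def)
  next
    case False
    then show ?thesis
      using c by (intro listableI[OF iso listed2_eq(6), of 1 0 0 b 1]) (simp_all add: pair2_change_def)
  qed
qed

text \<open>For \<open>b \<noteq> 0\<close> rescaling \<open>A\<close> makes the eigenvalues of
  \<open>\<beta>\<close> equal to 1 and \<open>d\<close>. If \<open>d \<noteq> 1\<close>, a suitable
  \<open>X + t Y\<close> is an eigenvector and removes \<open>b'\<close>; if \<open>d = 1\<close>,
  the quotient \<open>b' / b\<close> stays as the parameter.\<close>

lemma listable_chi_triangular:
  assumes iso: "lie_pair_iso (pair2 (0, d) (b, b') (0, b * d) 1 0) P"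
  shows "listable P"
proof (cases "b = 0")
  case b: True
  show ?thesis
  proof (cases "b' = 0")
    case True
    then show ?thesis
      using b by (intro listableI[OF iso listed2_eq(8)[of d], of 1 0 0 1 1]) (simp_all add: pair2_change_def)
  next
    case False
    then show ?thesis
      using b by (intro listableI[OF iso listed2_eq(10)[of d], of 1 0 0 b' 1]) (simp_all add: pair2_change_def)
  qed
next
  case b: False
  show ?thesis
  proof (cases "d = 1")
    case True
    then show ?thesis
      using b by (intro listableI[OF iso listed2_eq(9)[of d "b' / b"], of 1 0 0 1 "1 / b"]) (simp_all add: pair2_change_def)
  next
    case False
    define t where "t = b' / (b * (1 - d))"
    have "t * (b * (1 - d)) = b'" using b False by (simp add: t_def)
    moreover have "t * (b * (1 - d)) = t * b - t * b * d" by (simp add: algebra_simps)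
    ultimately have t: "b' = t * b - t * b * d" by simp
    show ?thesis
      using b False
      by (intro listableI[OF iso listed2_eq(9)[of d 0], of 1 t 0 1 "1 / b"]) (simp_all add: pair2_change_def t)
  qed
qed

lemma listable_sl2:
  assumes iso: "lie_pair_iso (pair2 (0, - 1) (b, b') (c, - b) 1 0) P" and c: "c \<noteq> 0"
  shows "listable P"
proof -
  \<comment> \<open>With \<open>X' = X - (b / c) Y\<close>, the map \<open>\<beta>\<close> sends
    \<open>X'\<close> to \<open>g c Y\<close> and \<open>Y\<close> to \<open>c X'\<close>. Taking
    \<open>Y' = u Y\<close> and \<open>A' = A / (u c)\<close> turns these into
    \<open>(g / (u u)) Y'\<close> and \<open>X'\<close>, so \<open>u\<close> is chosen to leave only
    the sign of \<open>g\<close>.\<close>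
  define g where "g = (b' + b * b / c) / c"
  define u where "u = (if g = 0 then 1 else sqrt \<bar>g\<bar>)"
  have u: "u \<noteq> 0" "sgn g * u * u = g" by (auto simp: u_def sgn_if mult.assoc)
  have b': "b' = g * c - b * b / c" using c by (simp add: g_def)
  have *: "u * (u * sgn g) = g" using u(2) by (simp add: ac_simps)
  have "admissible (E43 (sgn g))" by (simp add: sgn_if)
  then show ?thesis
    using u(1) c
    by (intro listableI[OF iso listed2_eq(11)[of "sgn g"], of 1 "- (b / c)" 0 u "1 / (u * c)"])
       (simp_all add: pair2_change_def b' * field_simps)
qed

text \<open>A distinguished line of part 1 is taken as the line of \<open>Y\<close>: the kernel of
  \<open>chi\<close> if \<open>chi \<noteq> 0\<close>, the derived algebra if \<open>chi = 0\<close>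
  and the bracket is nonzero, a real eigenline of \<open>\<beta>\<close> if both vanish. Only in the
  last case may such a line fail to exist.\<close>

lemma listable_or_no_eigenvector:
  assumes P: "matched_pair P" and iso: "lie_pair_iso (pair2 e b c h k) P"
  shows "listable P \<or> (h = 0 \<and> k = 0 \<and> e = (0, 0) \<and>
    (\<forall>x y m. x * fst b + y * fst c = m * x \<longrightarrow> x * snd b + y * snd c = m * y \<longrightarrow> x = 0 \<and> y = 0))"
proof (cases "h = 0 \<and> k = 0")
  case False
  \<comment> \<open>The new \<open>X\<close> is \<open>(h, k) / N\<close>, with \<open>chi\<close>
    equal to 1, and the new \<open>Y\<close> is \<open>(- k, h)\<close>, in the kernel of
    \<open>chi\<close>.\<close>
  define N where "N = h * h + k * k"
  have N: "N \<noteq> 0" using False by (simp add: N_def sum_squares_eq_zero_iff)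
  have D: "h / N * h - k / N * (- k) \<noteq> 0" "h / N * h + k / N * k = 1"
    using N by (simp_all add: add_divide_distrib[symmetric] flip: N_def)
  obtain e1 e2 b1 b2 c1 c2 where ch: "pair2_change (h / N) (k / N) (- k) h 1 (e1, e2) (b1, b2) (c1, c2)
      (h / N * h + k / N * k) (- k * h + h * k) e b c h k"
    using exists_change_of_basis[OF D(1), of h k e b c] by (metis prod.exhaust)
  then have iso': "lie_pair_iso (pair2 (e1, e2) (b1, b2) (c1, c2) 1 0) P"
    using change_of_basis[OF iso ch] D(2) by (simp add: mult.commute)
  note J = jacobi_pair2[OF iso' P]
  have e1: "e1 = 0" using J(1) by simp
  \<comment> \<open>The dichotomy between the solvable pairs, where \<open>\<beta>\<close> preserves
    the line of \<open>Y\<close>, and the pairs with ambient algebra of type sl(2), where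
    \<open>e2 = - 1\<close>.\<close>
  have c1: "c1 * (1 + e2) = 0" and c2: "c2 = b1 * e2" using J(2,3) e1 by (simp_all add: algebra_simps)
  show ?thesis
  proof (cases "c1 = 0")
    case True
    then show ?thesis using listable_chi_triangular[of e2 b1 b2 P] iso' e1 c2 by simp
  next
    case False
    then have "e2 = - 1" using c1 by simp
    then show ?thesis using listable_sl2[of b1 b2 c1 P] iso' e1 c2 False by simp
  qed
next
  case hk: True
  show ?thesis
  proof (cases "e = (0, 0)")
    case False
    \<comment> \<open>The new \<open>Y\<close> is the bracket \<open>e\<close> itself, and the new
      \<open>X\<close> is \<open>(snd e, - fst e) / N\<close>; the determinant is 1, so their
      bracket is again \<open>Y\<close>.\<close>
    define N where "N = fst e * fst e + snd e * snd e"
    have N: "N \<noteq> 0" using False by (simp add: N_def sum_squares_eq_zero_iff prod_eq_iff)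
    have D: "snd e / N * snd e - (- (fst e) / N) * fst e = 1"
      using N by (simp add: add_divide_distrib[symmetric]) (simp add: N_def add.commute)
    then have D0: "snd e / N * snd e - (- (fst e) / N) * fst e \<noteq> 0" by simp
    obtain e' b' c' where ch: "pair2_change (snd e / N) (- (fst e) / N) (fst e) (snd e) 1 e' b' c'
        (snd e / N * h + - (fst e) / N * k) (fst e * h + snd e * k) e b c h k"
      using exists_change_of_basis[OF D0, of h k e b c] by blast
    then have ch': "pair2_change (snd e / N) (- (fst e) / N) (fst e) (snd e) 1 (0, 1) b' c' 0 0 e b c 0 0"
      using D hk by (simp add: pair2_change_def)
    obtain b1 b2 c1 c2 where bc: "b' = (b1, b2)" "c' = (c1, c2)" by (cases b', cases c')
    have iso': "lie_pair_iso (pair2 (0, 1) (b1, b2) (c1, c2) 0 0) P"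
      using change_of_basis[OF _ ch'] iso hk bc by simp
    note J = jacobi_pair2[OF iso' P]
    \<comment> \<open>The Jacobi identity makes \<open>\<beta>\<close> a derivation, and derivations
      of the nonabelian plane algebra map into its derived line.\<close>
    have "c1 = 0" "b1 = 0" using J(2,3) by simp_all
    then show ?thesis using listable_nonabelian[of b2 c2 P] iso' by simp
  next
    case e: True
    show ?thesis
    proof (cases "\<exists>x y m. x * fst b + y * fst c = m * x \<and> x * snd b + y * snd c = m * y \<and> \<not> (x = 0 \<and> y = 0)")
      case False
      then show ?thesis using hk e by blast
    next
      case True
      then obtain x y m where xy: "x * fst b + y * fst c = m * x" "x * snd b + y * snd c = m * y" "\<not> (x = 0 \<and> y = 0)"
        by blast
      \<comment> \<open>The eigenvector \<open>(x, y)\<close> becomes the new \<open>Y\<close>,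
        completed to a basis by the orthogonal vector \<open>(y, - x)\<close>.\<close>
      have D: "y * y - (- x) * x \<noteq> 0" using xy(3) sum_squares_eq_zero_iff[of y x] by auto
      obtain e' b' c' where ch: "pair2_change y (- x) x y 1 e' b' c' (y * h + - x * k) (x * h + y * k) e b c h k"
        using exists_change_of_basis[OF D, of h k e b c] by blast
      then have ch': "pair2_change y (- x) x y 1 (0, 0) b' (0, m) 0 0 e b c 0 0"
        using hk e xy by (simp add: pair2_change_def)
      obtain b1 b2 where bc: "b' = (b1, b2)" by (cases b')
      have "lie_pair_iso (pair2 (0, 0) (b1, b2) (0, m) 0 0) P"
        using change_of_basis[OF _ ch'] iso hk bc by simp
      then show ?thesis using listable_triangular by blast
    qed
  qed
qed

lemma dim_1_span:
  fixes V :: "'a::real_vector set"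
  assumes "subspace V" "dim V = 1"
  obtains X where "X \<noteq> 0" "V = span {X}"
proof -
  obtain B where B: "B \<subseteq> V" "independent B" "V \<subseteq> span B" "card B = dim V"
    using real_vector.basis_exists by blast
  obtain X where X: "B = {X}" using B(4) assms(2) by (auto simp: card_1_singleton_iff)
  have "V = span {X}" using B(1,3) span_minimal[OF _ assms(1)] by (intro subset_antisym) (simp_all add: X)
  moreover have "X \<noteq> 0" using B(2) by (auto simp: X)
  ultimately show ?thesis by (intro that)
qed

lemma dim_2_span:
  fixes V :: "'a::real_vector set"
  assumes "subspace V" "dim V = 2"
  obtains X Y where "V = {x *\<^sub>R X + y *\<^sub>R Y | x y. True}" "\<And>x y. x *\<^sub>R X + y *\<^sub>R Y = 0 \<Longrightarrow> x = 0 \<and> y = 0"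
proof -
  obtain B where B: "B \<subseteq> V" "independent B" "V \<subseteq> span B" "card B = dim V"
    using real_vector.basis_exists by blast
  obtain X Y where X: "B = {X, Y}" "X \<noteq> Y" using B(4) assms(2) by (auto simp: card_2_iff)
  have "V = span {X, Y}" using B(1,3) span_minimal[OF _ assms(1)] by (intro subset_antisym) (simp_all add: X)
  then have "V = {x *\<^sub>R X + y *\<^sub>R Y | x y. True}" unfolding span_pair .
  moreover have "x = 0 \<and> y = 0" if xy: "x *\<^sub>R X + y *\<^sub>R Y = 0" for x y
  proof -
    have XY: "X \<notin> span {Y}" "Y \<noteq> 0" using B(2) X(2) by (auto simp: X(1) independent_insert)
    have "x = 0"
    proof (rule ccontr)
      assume x: "x \<noteq> 0"
      have "x *\<^sub>R X = - y *\<^sub>R Y" using xy by (simp add: eq_neg_iff_add_eq_0)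
      then have "(1 / x) *\<^sub>R x *\<^sub>R X = (1 / x) *\<^sub>R (- y) *\<^sub>R Y" by simp
      then have "X = (- y / x) *\<^sub>R Y" using x by simp
      moreover have "(- y / x) *\<^sub>R Y \<in> span {Y}" by (intro span_scale span_base) simp
      ultimately show False using XY(1) by simp
    qed
    then show ?thesis using xy XY(2) by simp
  qed
  ultimately show ?thesis by (rule that)
qed

lemma span_singleton_scaleR:
  assumes "u \<noteq> 0"
  shows "span {u *\<^sub>R X} = span {X}"
proof -
  have "X = (1 / u) *\<^sub>R u *\<^sub>R X" using assms by simp
  then have "X \<in> span {u *\<^sub>R X}" by (metis insertI1 span_base span_scale)
  moreover have "u *\<^sub>R X \<in> span {X}" by (simp add: span_base span_scale)
  ultimately show ?thesis unfolding span_eq by simp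
qed

lemma classification_1_1:
  assumes P: "matched_pair_dim P 1 1"
  shows "\<exists>e. lie_pair_iso P (listed1 e)"
proof -
  have mp: "matched_pair P" and dims: "dim (part1 P) = 1" "dim (part2 P) = 1"
    using P by (simp_all add: matched_pair_dim_def)
  note dec = matched_pair_decomposition[OF mp]
  obtain X where X: "X \<noteq> 0" "part1 P = span {X}" by (rule dim_1_span[OF dec(3) dims(1)])
  obtain A where A: "A \<noteq> 0" "part2 P = span {A}" by (rule dim_1_span[OF dec(4) dims(2)])
  have L: "lie_algebra (ambient P) (bracket P)" by (rule matched_pairD(1)[OF mp])
  have mem: "X \<in> ambient P" "A \<in> ambient P"
    using dec(1,2) X(2) A(2) span_base[of X "{X}"] span_base[of A "{A}"] by auto
  have "bracket P X A \<in> ambient P" using L mem by (simp add: lie_algebra_def)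
  then obtain b x where br: "bracket P X A = b *\<^sub>R X + x *\<^sub>R A"
    unfolding matched_pairD(3)[OF mp] X(2) A(2) span_singleton by auto
  \<comment> \<open>Rescaling \<open>A\<close> affects only \<open>b\<close> and rescaling
    \<open>X\<close> only \<open>x\<close>, so each nonzero constant can be made 1
    independently.\<close>
  have scaled: "lie_pair_iso P (pair1 (l * b) (u * x))" if ul: "u \<noteq> 0" "l \<noteq> 0" for u l
  proof (rule lie_pair_iso_pair1_coordinates[OF mp, of "u *\<^sub>R X" "l *\<^sub>R A"])
    show "u *\<^sub>R X \<noteq> 0" "l *\<^sub>R A \<noteq> 0" using X A ul by simp_all
    show "part1 P = span {u *\<^sub>R X}" "part2 P = span {l *\<^sub>R A}"
      using ul by (simp_all add: X(2) A(2) span_singleton_scaleR)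
    have "bracket P (u *\<^sub>R X) (l *\<^sub>R A) = (u * l) *\<^sub>R bracket P X A"
      using lie_bracket_expand[OF L mem(1,1,2), of u 0 0 0 0 l] by simp
    then show "bracket P (u *\<^sub>R X) (l *\<^sub>R A) = (l * b) *\<^sub>R u *\<^sub>R X + (u * x) *\<^sub>R l *\<^sub>R A"
      by (simp add: br scaleR_add_right ac_simps)
  qed
  consider "b = 0" "x = 0" | "b \<noteq> 0" "x = 0" | "b = 0" "x \<noteq> 0" | "b \<noteq> 0" "x \<noteq> 0" by blast
  then show ?thesis
  proof cases
    case 1
    then have "lie_pair_iso P (listed1 E1)" using scaled[of 1 1] by simp
    then show ?thesis by (rule exI)
  next
    case 2
    then have "lie_pair_iso P (listed1 E2)" using scaled[of 1 "1 / b"] by simp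
    then show ?thesis by (rule exI)
  next
    case 3
    then have "lie_pair_iso P (listed1 E3)" using scaled[of "1 / x" 1] by simp
    then show ?thesis by (rule exI)
  next
    case 4
    then have "lie_pair_iso P (listed1 E4)" using scaled[of "1 / x" "1 / b"] by simp
    then show ?thesis by (rule exI)
  qed
qed

text \<open>The coordinates in a basis give structure constants to which
  \<open>listable_or_no_eigenvector\<close> applies; its exceptional case is carried back to the
  abstract pair, where a failing eigenvector equation in coordinates means that
  \<open>\<beta>\<close> has no eigenvector.\<close>

lemma classification_2_1:
  assumes P: "matched_pair_dim P 2 1" and desc: "described_by P A \<beta> chi"
  shows "listable P \<or>
    ((\<forall>X\<in>part1 P. chi X = 0) \<and> (\<forall>X\<in>part1 P. \<forall>Y\<in>part1 P. bracket P X Y = 0) \<and>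
     \<not> (\<exists>X\<in>part1 P. X \<noteq> 0 \<and> (\<exists>c. \<beta> X = c *\<^sub>R X)))"
proof -
  have mp: "matched_pair P" and dims: "dim (part1 P) = 2"
    using P by (simp_all add: matched_pair_dim_def)
  have A: "A \<noteq> 0" "part2 P = span {A}" and \<beta>: "\<And>X. X \<in> part1 P \<Longrightarrow> \<beta> X \<in> part1 P"
    "\<And>X. X \<in> part1 P \<Longrightarrow> bracket P X A = \<beta> X + chi X *\<^sub>R A"
    using desc by (auto simp: described_by_def)
  note dec = matched_pair_decomposition[OF mp]
  have L: "lie_algebra (ambient P) (bracket P)" by (rule matched_pairD(1)[OF mp])
  obtain X Y where XY: "part1 P = {x *\<^sub>R X + y *\<^sub>R Y | x y. True}"
    and ind: "\<And>x y. x *\<^sub>R X + y *\<^sub>R Y = 0 \<Longrightarrow> x = 0 \<and> y = 0"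
    by (rule dim_2_span[OF dec(3) dims], rule that)
  have mem1: "x *\<^sub>R X + y *\<^sub>R Y \<in> part1 P" for x y unfolding XY by blast
  have X1: "X \<in> part1 P" and Y1: "Y \<in> part1 P" using mem1[of 1 0] mem1[of 0 1] by simp_all
  have A2: "a *\<^sub>R A \<in> part2 P" for a unfolding A(2) by (intro span_scale span_base) simp
  have mem: "X \<in> ambient P" "Y \<in> ambient P" "A \<in> ambient P"
    using dec(1,2) X1 Y1 A2[of 1] by auto
  have "bracket P X Y \<in> part1 P"
    using mp X1 Y1 by (simp add: matched_pair_def lie_subalgebra_def)
  then obtain e where e: "bracket P X Y = fst e *\<^sub>R X + snd e *\<^sub>R Y" unfolding XY by auto
  obtain b where b: "\<beta> X = fst b *\<^sub>R X + snd b *\<^sub>R Y" using \<beta>(1)[OF X1] unfolding XY by auto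
  obtain c where c: "\<beta> Y = fst c *\<^sub>R X + snd c *\<^sub>R Y" using \<beta>(1)[OF Y1] unfolding XY by auto
  have "lie_pair_iso (pair2 e b c (chi X) (chi Y)) P"
    by (rule lie_pair_iso_pair2_coordinates[OF mp ind XY A e])
       (simp_all only: \<beta>(2)[OF X1] \<beta>(2)[OF Y1] b c)
  from listable_or_no_eigenvector[OF mp this] show ?thesis
  proof (elim disjE conjE)
    assume chi: "chi X = 0" "chi Y = 0" and e0: "e = (0, 0)"
      and no: "\<forall>x y m. x * fst b + y * fst c = m * x \<longrightarrow> x * snd b + y * snd c = m * y \<longrightarrow> x = 0 \<and> y = 0"
    \<comment> \<open>\<open>described_by\<close> does not state that \<open>\<beta>\<close> and
      \<open>chi\<close> are linear on part 1. Their values on linear combinations follow from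
      bilinearity of the bracket and the directness of the sum.\<close>
    have \<beta>_chi: "\<beta> (x *\<^sub>R X + y *\<^sub>R Y) = (x * fst b + y * fst c) *\<^sub>R X + (x * snd b + y * snd c) *\<^sub>R Y
      \<and> chi (x *\<^sub>R X + y *\<^sub>R Y) = 0" for x y
    proof -
      let ?u = "x *\<^sub>R X + y *\<^sub>R Y" and ?w = "(x * fst b + y * fst c) *\<^sub>R X + (x * snd b + y * snd c) *\<^sub>R Y"
      have "bracket P ?u A = x *\<^sub>R bracket P X A + y *\<^sub>R bracket P Y A"
        using lie_bracket_expand[OF L mem, of x y 0 0 0 1] by simp
      also have "\<dots> = ?w"
        by (simp add: \<beta>(2)[OF X1] \<beta>(2)[OF Y1] b c chi algebra_simps)
      finally have "\<beta> ?u + chi ?u *\<^sub>R A = ?w" using \<beta>(2)[OF mem1] by simp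
      then have "(\<beta> ?u - ?w) + chi ?u *\<^sub>R A = 0" by (simp add: algebra_simps)
      from dec(5)[OF subspace_diff[OF dec(3) \<beta>(1)[OF mem1] mem1] A2 this]
      show ?thesis using A(1) by simp
    qed
    have "chi u = 0" if u: "u \<in> part1 P" for u
    proof -
      obtain x y where "u = x *\<^sub>R X + y *\<^sub>R Y" using u unfolding XY by auto
      then show ?thesis using \<beta>_chi by simp
    qed
    moreover have "bracket P u v = 0" if "u \<in> part1 P" "v \<in> part1 P" for u v
    proof -
      obtain x y where u: "u = x *\<^sub>R X + y *\<^sub>R Y" using \<open>u \<in> part1 P\<close> unfolding XY by auto
      obtain x' y' where v: "v = x' *\<^sub>R X + y' *\<^sub>R Y" using \<open>v \<in> part1 P\<close> unfolding XY by auto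
      show ?thesis
        using lie_bracket_expand[OF L mem, of x y 0 x' y' 0] e e0 by (simp add: u v)
    qed
    moreover have "\<not> (\<exists>u\<in>part1 P. u \<noteq> 0 \<and> (\<exists>m. \<beta> u = m *\<^sub>R u))"
    proof
      assume "\<exists>u\<in>part1 P. u \<noteq> 0 \<and> (\<exists>m. \<beta> u = m *\<^sub>R u)"
      then obtain u m where u: "u \<in> part1 P" "u \<noteq> 0" "\<beta> u = m *\<^sub>R u" by blast
      then obtain x y where xy: "u = x *\<^sub>R X + y *\<^sub>R Y" unfolding XY by auto
      have "(x * fst b + y * fst c - m * x) *\<^sub>R X + (x * snd b + y * snd c - m * y) *\<^sub>R Y = 0"
        using u(3) \<beta>_chi[of x y] by (simp add: xy algebra_simps)
      then have "x * fst b + y * fst c = m * x" "x * snd b + y * snd c = m * y" using ind by force+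
      then have "x = 0 \<and> y = 0" using no by blast
      then show False using u(2) xy by simp
    qed
    ultimately show ?thesis by blast
  qed blast
qed

lemma exponentiable_listed1: "exponentiable_le2 (listed1 e)"
  by (cases e) (simp_all add: exponentiable_pair1_chi_0 exponentiable_pair1_0_1 exponentiable_pair1_1_1)

lemma matched_pair_listed1: "matched_pair_dim (listed1 e) 1 1"
  by (cases e) (simp_all only: listed1.simps matched_pair_pair1)

theorem theorem5p1:
  shows
    "(\<forall>e. matched_pair_dim (listed1 e) 1 1) \<and>
     (\<forall>e e'. lie_pair_iso (listed1 e) (listed1 e') \<longrightarrow> e = e') \<and>
     (\<forall>P :: 'a::real_vector lie_pair. matched_pair_dim P 1 1 \<longrightarrow>
        (\<exists>e. lie_pair_iso P (listed1 e))) \<and>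
     (\<forall>e. exponentiable_le2 (listed1 e)) \<and>
     (\<forall>e. admissible e \<longrightarrow> matched_pair_dim (listed2 e) 2 1) \<and>
     (\<forall>e e'. admissible e \<and> admissible e' \<and> lie_pair_iso (listed2 e) (listed2 e') \<longrightarrow>
        e = e' \<or> (\<exists>b b'. b \<noteq> 0 \<and> b' \<noteq> 0 \<and> e = E41 1 b \<and> e' = E41 1 b')) \<and>
     (\<forall>(P :: 'a lie_pair) A \<beta> chi. matched_pair_dim P 2 1 \<and> described_by P A \<beta> chi \<longrightarrow>
        (\<exists>e. admissible e \<and> lie_pair_iso P (listed2 e)) \<or>
        ((\<forall>X\<in>part1 P. chi X = 0) \<and> (\<forall>X\<in>part1 P. \<forall>Y\<in>part1 P. bracket P X Y = 0) \<and>
         \<not> (\<exists>X\<in>part1 P. X \<noteq> 0 \<and> (\<exists>c. \<beta> X = c *\<^sub>R X)))) \<and>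
     (\<forall>e. admissible e \<longrightarrow> exponentiable_le2 (listed2 e))"
proof (intro conjI)
  show "\<forall>e. matched_pair_dim (listed1 e) 1 1"
    by (intro allI matched_pair_listed1)
  show "\<forall>e e'. lie_pair_iso (listed1 e) (listed1 e') \<longrightarrow> e = e'"
    by (intro allI impI listed1_pairwise_non_isomorphic)
  show "\<forall>P :: 'a lie_pair. matched_pair_dim P 1 1 \<longrightarrow> (\<exists>e. lie_pair_iso P (listed1 e))"
    by (intro allI impI classification_1_1)
  show "\<forall>e. exponentiable_le2 (listed1 e)"
    by (intro allI exponentiable_listed1)
  show "\<forall>e. admissible e \<longrightarrow> matched_pair_dim (listed2 e) 2 1"
    by (intro allI impI matched_pair_listed2)
  show "\<forall>e e'. admissible e \<and> admissible e' \<and> lie_pair_iso (listed2 e) (listed2 e') \<longrightarrow>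
        e = e' \<or> (\<exists>b b'. b \<noteq> 0 \<and> b' \<noteq> 0 \<and> e = E41 1 b \<and> e' = E41 1 b')"
    by (intro allI impI listed2_pairwise_non_isomorphic; elim conjE)
  show "\<forall>(P :: 'a lie_pair) A \<beta> chi. matched_pair_dim P 2 1 \<and> described_by P A \<beta> chi \<longrightarrow>
        (\<exists>e. admissible e \<and> lie_pair_iso P (listed2 e)) \<or>
        ((\<forall>X\<in>part1 P. chi X = 0) \<and> (\<forall>X\<in>part1 P. \<forall>Y\<in>part1 P. bracket P X Y = 0) \<and>
         \<not> (\<exists>X\<in>part1 P. X \<noteq> 0 \<and> (\<exists>c. \<beta> X = c *\<^sub>R X)))"
    by (intro allI impI classification_2_1[unfolded listable_def]; elim conjE)
  show "\<forall>e. admissible e \<longrightarrow> exponentiable_le2 (listed2 e)"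
    by (intro allI impI exponentiable_listed2)
qed

end
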